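(* Let $l$ be a Lie algebra structure on the $\mathbb Z_2$-graded $\mathbf k$-module $V$, with an invariant inner product. Then the Lie algebra cyclic cohomology $HC(V)$ of $V$ classifies the infinitesimal deformations of the Lie algebra into an $L_\infty$ algebra preserving the inner product. Precisely: let $W=\Pi V$, let $d\in C(W)$ be the odd codifferential corresponding to $l$, and let $u$ be an infinitesimal parameter of parity $p\in\mathbb Z_2$. Then $d+u\delta\mapsto[\lambda]$, where $\lambda=\eta^{-1}\circ\delta\circ\eta$, induces a bijection from the set of infinitesimal deformations $d+u\delta$ (into an $L_\infty$ algebra) preserving the inner product, modulo inner-product-preserving equivalence, onto the part of $HC(V)$ of total parity $1-p$.
   Context: $\mathbf k$ is a commutative ring, $V=V_0\oplus V_1$ a $\mathbb Z_2$-graded $\mathbf k$-module, $|v|$ the parity. For a permutation $\sigma$ of $\{1,\dots,n\}$ and homogeneous $v_i$, $\epsilon(\sigma)$ is the Koszul sign determined by $v_1\cdots v_n=\epsilon(\sigma)v_{\sigma(1)}\cdots v_{\sigma(n)}$ in the graded symmetric algebra; $(-1)^\sigma$ is the sign of $\sigma$. $\mathrm{Sh}(p,q)$ is the set of unshuffles: permutations $\sigma$ of $\{1,\dots,p+q\}$ with $\sigma(i)<\sigma(i+1)$ for $i\ne p$. $\bigwedge V=\bigoplus_{n\ge1}\bigwedge^nV$ (quotient of the tensor algebra by $x\otimes y+(-1)^{|x||y|}y\otimes x$) and $S(V)=\bigoplus_{n\ge1}S^n(V)$ (quotient by $x\otimes y-(-1)^{|x||y|}y\otimes x$) have no degree $0$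 part. $C(V)=\mathrm{Hom}(\bigwedge V,V)=\prod_{k\ge1}C^k(V)$, $C^k(V)=\mathrm{Hom}(\bigwedge^kV,V)$; $\varphi_k$ is the restriction of $\varphi$ to $\bigwedge^kV$; the total parity of $\varphi_k$ is $|\varphi_k|+k-1\bmod2$. For homogeneous $\varphi_k\in C^k(V)$, $\psi_j\in C^j(V)$, $n=k+j-1$: $$(\varphi_k\circ\psi_j)(v_1,\dots,v_n)=\sum_{\sigma\in\mathrm{Sh}(j,n-j)}(-1)^\sigma\epsilon(\sigma)\varphi_k(\psi_j(v_{\sigma(1)},\dots,v_{\sigma(j)}),v_{\sigma(j+1)},\dots,v_{\sigma(n)}),$$ $[\varphi_k,\psi_j]=\varphi_k\circ\psi_j-(-1)^{|\varphi_k||\psi_j|+(k-1)(j-1)}\psi_j\circ\varphi_k$, $\{\varphi_k,\psi_j\}=(-1)^{(k-1)|\psi_j|}[\varphi_k,\psi_j]$, $\{\varphi,\psi\}_n=\sum_{k+j=n+1}\{\varphi_k,\psi_j\}$. A Lie algebra structure on $V$ is an even $l\in C^2(V)$ with $\sum_{\sigma\in\mathrm{Sh}(2,1)}(-1)^\sigma\epsilon(\sigma)l(l(v_{\sigma(1)},v_{\sigma(2)}),v_{\sigma(3)})=0$. The inner product is a bilinear form $\langle\cdot,\cdot\rangle:V\times V\to\mathbf k$, even ($\langle v,w\rangle=0$ if $|v|\ne|w|$), graded symmetric ($\langle v,w\rangle=(-1)^{|v||w|}\langle w,v\rangle$), nondegenerate ($v\mapsto\langle v,\cdot\rangle$ is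 an isomorphism $V\to\mathrm{Hom}(V,\mathbf k)$). $\varphi\in C^n(V)$ is cyclic if $\tilde\varphi(v_1,\dots,v_{n+1})=\langle\varphi(v_1,\dots,v_n),v_{n+1}\rangle$ is graded antisymmetric, i.e. lies in $\mathrm{Hom}(\bigwedge^{n+1}V,\mathbf k)$; $\varphi\in C(V)$ is cyclic if all $\varphi_n$ are. $CC(V)\subset C(V)$ is the submodule of cyclic elements. The inner product is invariant for $l$ if $l$ is cyclic; then $D(\varphi)=\{\varphi,l\}$ is a differential on $CC(V)$, and the (Lie algebra) cyclic cohomology $HC(V)$ is the cohomology of $(CC(V),D)$, $\mathbb Z_2$-graded by total parity. Passage to $W=\Pi V$ (the same module with parity reversed, $\pi:V\to\Pi V$ the odd identity map): $\eta:\bigwedge V\to S(W)$ is the isomorphism $\eta(v_1\wedge\cdots\wedge v_n)=(-1)^{(n-1)|v_1|+(n-2)|v_2|+\cdots+|v_{n-1}|}\pi v_1\cdots\pi v_n$, with restrictions $\eta_k$. Let $C(W)=\mathrm{Hom}(S(W),W)$; $\delta\in C(W)$ corresponds to $\eta^{-1}\circ\delta\circ\eta\in C(V)$, with components $\eta_1^{-1}\circ\delta_k\circ\eta_k$, and parity of $\delta$ corresponds to total parity. $\delta\in C(W)$ is identified with the coderivation of the symmetric coalgebra $S(W)$ given by $\delta(w_1\cdots w_n)=\sum_{1\le k\le n,\ \sigma\in\mathrm{Sh}(k,n-k)}\epsilon(\sigma)\delta_k(w_{\sigma(1)},\dots,w_{\sigma(k)})w_{\sigma(k+1)}\cdots w_{\sigma(n)}$.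 An $L_\infty$ structure on $V$ is an element of $C(V)$ corresponding to an odd $d\in C(W)$ with $d\circ d=0$ (as coderivations); a Lie algebra structure is the case where only the component in $C^2$ is nonzero. Infinitesimal deformations: let $u$ be a parameter of parity $p$ with $u^2=0$, graded-commuting with everything, $\mathbf k[u]=\mathbf k\oplus\mathbf ku$. For $\delta\in C(W)$ of parity $1-p$, $d_u=d+u\delta$ (on $\mathbf k[u]\otimes S(W)$) is an infinitesimal deformation of $d$ into an $L_\infty$ algebra if $d_u^2=0$; it preserves the inner product if $\lambda=\eta^{-1}\circ\delta\circ\eta$ is cyclic. Two such deformations $d_u,d'_u$ are equivalent preserving the inner product if there is $\alpha\in C(W)$ of parity $p$, with $\eta^{-1}\circ\alpha\circ\eta$ cyclic, such that the coalgebra automorphism $f=\mathrm{id}+u\alpha$ of $\mathbf k[u]\otimes S(W)$ satisfies $f\circ d_u\circ f^{-1}=d'_u$. *)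

theory Defs
  imports
    Complex_Main
    "HOL-Library.Poly_Mapping"
    "HOL-Library.Set_Algebras"
    "HOL-Library.Z2"
    "HOL-Combinatorics.Permutations"
begin

section \<open>Graded modules\<close>

text \<open>
  Parities live in the type \<^typ>\<open>bit\<close> of integers modulo 2. The underlying module is a whole
  type; the grading is a family of two submodules.
\<close>

record ('k, 'v) smodule =
  scl :: "'k \<Rightarrow> 'v \<Rightarrow> 'v"
  deg :: "bit \<Rightarrow> 'v set"

definition graded_module :: "('k::comm_ring_1, 'v::ab_group_add) smodule \<Rightarrow> bool" where
  "graded_module M \<longleftrightarrow>
     module (scl M) \<and> (\<forall>p. module.subspace (scl M) (deg M p)) \<and>
     deg M 0 \<inter> deg M 1 = {0} \<and> (\<forall>v. \<exists>x\<in>deg M 0. \<exists>y\<in>deg M 1. v = x + y)"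

text \<open>The parity reversed module has the same elements, so the odd map \<open>\<pi>\<close> is the identity function.\<close>

definition parity_shift :: "('k, 'v) smodule \<Rightarrow> ('k, 'v) smodule" (\<open>\<Pi>\<close>) where
  "\<Pi> M = M\<lparr>deg := (\<lambda>p. deg M (p + 1))\<rparr>"

definition hproj :: "('k, 'v::ab_group_add) smodule \<Rightarrow> bit \<Rightarrow> 'v \<Rightarrow> 'v" where
  "hproj M p v = (THE x. x \<in> deg M p \<and> v - x \<in> deg M (p + 1))"

definition homogeneous :: "('k, 'v) smodule \<Rightarrow> bit list \<Rightarrow> 'v list \<Rightarrow> bool" where
  "homogeneous M ps vs \<longleftrightarrow> list_all2 (\<lambda>p v. v \<in> deg M p) ps vs"


section \<open>Signs and unshuffles\<close>

text \<open>\<open>psign a\<close> is \<open>(-1)\<^sup>a\<close>.\<close>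

definition psign :: "bit \<Rightarrow> int" where
  "psign a = (if a = 0 then 1 else - 1)"

text \<open>
  Indices run through \<open>0, \<dots>, n - 1\<close> instead of \<open>1, \<dots>, n\<close>. The tuple
  \<open>(v\<^bsub>\<sigma>(1)\<^esub>, \<dots>, v\<^bsub>\<sigma>(n)\<^esub>)\<close> is \<^term>\<open>permute_list \<sigma> vs\<close>.
\<close>

definition Sh :: "nat \<Rightarrow> nat \<Rightarrow> (nat \<Rightarrow> nat) set" where
  "Sh p q = {\<sigma>. \<sigma> permutes {..<p + q} \<and>
                 (\<forall>i. Suc i < p + q \<and> Suc i \<noteq> p \<longrightarrow> \<sigma> i < \<sigma> (Suc i))}"

text \<open>
  The Koszul sign for vectors with parities \<open>ps\<close>: sorting \<open>v\<^bsub>\<sigma>(1)\<^esub> \<cdots> v\<^bsub>\<sigma>(n)\<^esub>\<close> back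
  into \<open>v\<^sub>1 \<cdots> v\<^sub>n\<close> exchanges exactly the pairs of factors in inverted order, each exchange
  costing \<open>(-1)\<^sup>a\<^sup>b\<close> for factors of parities \<open>a\<close> and \<open>b\<close>.
\<close>

definition koszul :: "(nat \<Rightarrow> nat) \<Rightarrow> bit list \<Rightarrow> int" where
  "koszul \<sigma> ps =
     (\<Prod>(i, j)\<in>{(i, j). i < j \<and> j < length ps \<and> \<sigma> j < \<sigma> i}. psign (ps ! \<sigma> i * ps ! \<sigma> j))"


section \<open>Graded exterior and symmetric powers\<close>

text \<open>
  The free module on the words in \<open>V\<close>, modulo the multilinearity relations, is the tensor algebra.
  The symmetric algebra (\<open>s = 1\<close>) is its quotient by the ideal generated by
  \<open>x \<otimes> y - (-1)\<^sup>|\<^sup>x\<^sup>|\<^sup>|\<^sup>y\<^sup>| y \<otimes> x\<close>, the exterior algebra (\<open>s = -1\<close>) the one by the ideal generated by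
  \<open>x \<otimes> y + (-1)\<^sup>|\<^sup>x\<^sup>|\<^sup>|\<^sup>y\<^sup>| y \<otimes> x\<close>. All relations are imposed at once, inside arbitrary words.
\<close>

type_synonym ('k, 'v) words = "'v list \<Rightarrow>\<^sub>0 'k"

definition wscl :: "'k \<Rightarrow> ('k::comm_ring_1, 'v) words \<Rightarrow> ('k, 'v) words" where
  "wscl c x = Poly_Mapping.map ((*) c) x"

definition relators :: "('k::comm_ring_1, 'v::ab_group_add) smodule \<Rightarrow> int \<Rightarrow> ('k, 'v) words set" where
  "relators M s =
     {Poly_Mapping.single (xs @ [a + b] @ ys) 1 - Poly_Mapping.single (xs @ [a] @ ys) 1
        - Poly_Mapping.single (xs @ [b] @ ys) 1 | xs ys a b. True} \<union>
     {Poly_Mapping.single (xs @ [scl M c a] @ ys) 1 - Poly_Mapping.single (xs @ [a] @ ys) c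
        | xs ys c a. True} \<union>
     {Poly_Mapping.single (xs @ [x, y] @ ys) 1
        - Poly_Mapping.single (xs @ [y, x] @ ys) (of_int (s * psign (p * q)))
        | xs ys x y p q. x \<in> deg M p \<and> y \<in> deg M q}"

definition relmod :: "('k::comm_ring_1, 'v::ab_group_add) smodule \<Rightarrow> int \<Rightarrow> ('k, 'v) words set" where
  "relmod M s = module.span wscl (relators M s)"

type_synonym ('k, 'v) qelem = "('k, 'v) words set"

definition cls :: "('k::comm_ring_1, 'v::ab_group_add) smodule \<Rightarrow> int \<Rightarrow> ('k, 'v) words \<Rightarrow> ('k, 'v) qelem" where
  "cls M s x = x +o relmod M s"

text \<open>
  The elements of \<open>\<Lambda> V\<close> and \<open>S(V)\<close> are cosets; the empty word is excluded since there is no part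
  of degree 0. Cosets are added by the elementwise sum \<open>+\<close> of sets from
  \<^theory>\<open>HOL-Library.Set_Algebras\<close>, whereas scaling has to add the submodule of relations again.
\<close>

definition qpow :: "('k::comm_ring_1, 'v::ab_group_add) smodule \<Rightarrow> int \<Rightarrow> ('k, 'v) qelem set" where
  "qpow M s = {cls M s x | x. Poly_Mapping.lookup x [] = 0}"

definition qscl :: "('k::comm_ring_1, 'v::ab_group_add) smodule \<Rightarrow> int \<Rightarrow> 'k \<Rightarrow> ('k, 'v) qelem \<Rightarrow> ('k, 'v) qelem" where
  "qscl M s c X = wscl c ` X + relmod M s"

definition mon :: "('k::comm_ring_1, 'v::ab_group_add) smodule \<Rightarrow> int \<Rightarrow> 'v list \<Rightarrow> ('k, 'v) qelem" where
  "mon M s vs = cls M s (Poly_Mapping.single vs 1)"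

abbreviation Ext :: "('k::comm_ring_1, 'v::ab_group_add) smodule \<Rightarrow> ('k, 'v) qelem set" where
  "Ext M \<equiv> qpow M (- 1)"

abbreviation Sym :: "('k::comm_ring_1, 'v::ab_group_add) smodule \<Rightarrow> ('k, 'v) qelem set" where
  "Sym M \<equiv> qpow M 1"

abbreviation wedge :: "('k::comm_ring_1, 'v::ab_group_add) smodule \<Rightarrow> 'v list \<Rightarrow> ('k, 'v) qelem" where
  "wedge M vs \<equiv> mon M (- 1) vs"

abbreviation sprod :: "('k::comm_ring_1, 'v::ab_group_add) smodule \<Rightarrow> 'v list \<Rightarrow> ('k, 'v) qelem" where
  "sprod M vs \<equiv> mon M 1 vs"

text \<open>
  Linear maps from \<open>\<Lambda> V\<close> or \<open>S(V)\<close> to a module with scalar multiplication \<open>t\<close>. As functions on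
  all sets of words they are made unique by the value 0 off the carrier.
\<close>

definition Hom :: "('k::comm_ring_1, 'v::ab_group_add) smodule \<Rightarrow> int \<Rightarrow> ('k \<Rightarrow> 'x \<Rightarrow> 'x)
    \<Rightarrow> (('k, 'v) qelem \<Rightarrow> 'x::ab_group_add) set" where
  "Hom M s t =
     {f. (\<forall>X\<in>qpow M s. \<forall>Y\<in>qpow M s. f (X + Y) = f X + f Y) \<and>
         (\<forall>c. \<forall>X\<in>qpow M s. f (qscl M s c X) = t c (f X)) \<and>
         (\<forall>X. X \<notin> qpow M s \<longrightarrow> f X = 0)}"

text \<open>
  Linear maps between two such quotients. Off the carrier they have the value \<open>{}\<close>, which is not
  a coset.
\<close>

definition QHom :: "('k::comm_ring_1, 'v::ab_group_add) smodule \<Rightarrow> int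
    \<Rightarrow> ('k, 'w::ab_group_add) smodule \<Rightarrow> int \<Rightarrow> (('k, 'v) qelem \<Rightarrow> ('k, 'w) qelem) set" where
  "QHom M s N t =
     {f. (\<forall>X\<in>qpow M s. f X \<in> qpow N t) \<and>
         (\<forall>X\<in>qpow M s. \<forall>Y\<in>qpow M s. f (X + Y) = f X + f Y) \<and>
         (\<forall>c. \<forall>X\<in>qpow M s. f (qscl M s c X) = qscl N t c (f X)) \<and>
         (\<forall>X. X \<notin> qpow M s \<longrightarrow> f X = {})}"


section \<open>The cochain module \<open>C(V)\<close> and its bracket\<close>

type_synonym ('k, 'v) cochain = "('k, 'v) qelem \<Rightarrow> 'v"

definition CV :: "('k::comm_ring_1, 'v::ab_group_add) smodule \<Rightarrow> ('k, 'v) cochain set" where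
  "CV M = Hom M (- 1) (scl M)"

text \<open>
  The cochain with prescribed values \<open>f ps vs\<close> on wedge products of homogeneous vectors \<open>vs\<close> of
  parities \<open>ps\<close>; the explicit parities make signs meaningful also for vectors that are 0.
\<close>

definition cochain_of :: "('k::comm_ring_1, 'v::ab_group_add) smodule
    \<Rightarrow> (bit list \<Rightarrow> 'v list \<Rightarrow> 'v) \<Rightarrow> ('k, 'v) cochain" where
  "cochain_of M f =
     (THE \<chi>. \<chi> \<in> CV M \<and> (\<forall>ps vs. vs \<noteq> [] \<and> homogeneous M ps vs \<longrightarrow> \<chi> (wedge M vs) = f ps vs))"

text \<open>\<open>hpart M k a \<phi>\<close> is the parity \<open>a\<close> part of \<open>\<phi>\<^sub>k\<close>, extended by 0 to the other exterior powers.\<close>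

definition hpart :: "('k::comm_ring_1, 'v::ab_group_add) smodule \<Rightarrow> nat \<Rightarrow> bit
    \<Rightarrow> ('k, 'v) cochain \<Rightarrow> ('k, 'v) cochain" where
  "hpart M k a \<phi> =
     cochain_of M (\<lambda>ps vs. if length vs = k then hproj M (a + sum_list ps) (\<phi> (wedge M vs)) else 0)"

text \<open>
  For \<open>\<phi>\<close> in \<open>C\<^sup>k\<close> and \<open>\<psi>\<close> in \<open>C\<^sup>j\<close> only one term of the outer sum is nonzero, namely the one in
  degree \<open>n = k + j - 1\<close>.
\<close>

definition circ :: "('k::comm_ring_1, 'v::ab_group_add) smodule
    \<Rightarrow> ('k, 'v) cochain \<Rightarrow> ('k, 'v) cochain \<Rightarrow> ('k, 'v) cochain" where
  "circ M \<phi> \<psi> =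
     cochain_of M (\<lambda>ps vs.
       \<Sum>j = 1..length vs. \<Sum>\<sigma>\<in>Sh j (length vs - j).
         scl M (of_int (sign \<sigma> * koszul \<sigma> ps))
           (\<phi> (wedge M (\<psi> (wedge M (take j (permute_list \<sigma> vs))) # drop j (permute_list \<sigma> vs)))))"

text \<open>\<open>[\<phi>, \<psi>]\<close> and \<open>{\<phi>, \<psi>}\<close> for \<open>\<phi>\<close> in \<open>C\<^sup>k\<close> of parity \<open>a\<close> and \<open>\<psi>\<close> in \<open>C\<^sup>j\<close> of parity \<open>b\<close>.\<close>

definition hcomm :: "('k::comm_ring_1, 'v::ab_group_add) smodule \<Rightarrow> nat \<Rightarrow> bit \<Rightarrow> nat \<Rightarrow> bit
    \<Rightarrow> ('k, 'v) cochain \<Rightarrow> ('k, 'v) cochain \<Rightarrow> ('k, 'v) cochain" where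
  "hcomm M k a j b \<phi> \<psi> =
     (\<lambda>X. circ M \<phi> \<psi> X
        - scl M (of_int (psign (a * b + of_nat (k - 1) * of_nat (j - 1)))) (circ M \<psi> \<phi> X))"

definition hbracket :: "('k::comm_ring_1, 'v::ab_group_add) smodule \<Rightarrow> nat \<Rightarrow> bit \<Rightarrow> nat \<Rightarrow> bit
    \<Rightarrow> ('k, 'v) cochain \<Rightarrow> ('k, 'v) cochain \<Rightarrow> ('k, 'v) cochain" where
  "hbracket M k a j b \<phi> \<psi> =
     (\<lambda>X. scl M (of_int (psign (of_nat (k - 1) * b))) (hcomm M k a j b \<phi> \<psi> X))"

definition bracket :: "('k::comm_ring_1, 'v::ab_group_add) smodule
    \<Rightarrow> ('k, 'v) cochain \<Rightarrow> ('k, 'v) cochain \<Rightarrow> ('k, 'v) cochain" where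
  "bracket M \<phi> \<psi> =
     cochain_of M (\<lambda>ps vs.
       \<Sum>k = 1..length vs. let j = length vs + 1 - k in
         \<Sum>a\<in>{0, 1}. \<Sum>b\<in>{0, 1}.
           hbracket M k a j b (hpart M k a \<phi>) (hpart M j b \<psi>) (wedge M vs))"

definition total_parity :: "('k::comm_ring_1, 'v::ab_group_add) smodule \<Rightarrow> bit \<Rightarrow> ('k, 'v) cochain \<Rightarrow> bool" where
  "total_parity M t \<phi> \<longleftrightarrow>
     (\<forall>ps vs. vs \<noteq> [] \<and> homogeneous M ps vs \<longrightarrow>
        \<phi> (wedge M vs) \<in> deg M (t - of_nat (length vs - 1) + sum_list ps))"

definition lie_structure :: "('k::comm_ring_1, 'v::ab_group_add) smodule \<Rightarrow> ('k, 'v) cochain \<Rightarrow> bool" where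
  "lie_structure M l \<longleftrightarrow>
     l \<in> CV M \<and>
     (\<forall>vs. vs \<noteq> [] \<and> length vs \<noteq> 2 \<longrightarrow> l (wedge M vs) = 0) \<and>
     (\<forall>p q v w. v \<in> deg M p \<and> w \<in> deg M q \<longrightarrow> l (wedge M [v, w]) \<in> deg M (p + q)) \<and>
     (\<forall>ps vs. length vs = 3 \<and> homogeneous M ps vs \<longrightarrow>
        (\<Sum>\<sigma>\<in>Sh 2 1. scl M (of_int (sign \<sigma> * koszul \<sigma> ps))
           (l (wedge M [l (wedge M [vs ! \<sigma> 0, vs ! \<sigma> 1]), vs ! \<sigma> 2]))) = 0)"


section \<open>Inner products and cyclic cohomology\<close>

definition inner_product :: "('k::comm_ring_1, 'v::ab_group_add) smodule \<Rightarrow> ('v \<Rightarrow> 'v \<Rightarrow> 'k) \<Rightarrow> bool" where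
  "inner_product M B \<longleftrightarrow>
     (\<forall>v. module_hom (scl M) (*) (B v)) \<and> (\<forall>w. module_hom (scl M) (*) (\<lambda>v. B v w)) \<and>
     (\<forall>p q v w. v \<in> deg M p \<and> w \<in> deg M q \<and> p \<noteq> q \<longrightarrow> B v w = 0) \<and>
     (\<forall>p q v w. v \<in> deg M p \<and> w \<in> deg M q \<longrightarrow> B v w = of_int (psign (p * q)) * B w v) \<and>
     bij_betw B UNIV {f. module_hom (scl M) (*) f}"

text \<open>The functional \<open>g\<close> is relevant only on the exterior power of degree \<open>n + 1\<close>.\<close>

definition cyclic :: "('k::comm_ring_1, 'v::ab_group_add) smodule \<Rightarrow> ('v \<Rightarrow> 'v \<Rightarrow> 'k)
    \<Rightarrow> ('k, 'v) cochain \<Rightarrow> bool" where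
  "cyclic M B \<phi> \<longleftrightarrow>
     (\<forall>n\<ge>1. \<exists>g\<in>Hom M (- 1) (*). \<forall>vs v. length vs = n \<longrightarrow>
        g (wedge M (vs @ [v])) = B (\<phi> (wedge M vs)) v)"

definition CC :: "('k::comm_ring_1, 'v::ab_group_add) smodule \<Rightarrow> ('v \<Rightarrow> 'v \<Rightarrow> 'k) \<Rightarrow> ('k, 'v) cochain set" where
  "CC M B = {\<phi> \<in> CV M. cyclic M B \<phi>}"

definition cocycles :: "('k::comm_ring_1, 'v::ab_group_add) smodule \<Rightarrow> ('v \<Rightarrow> 'v \<Rightarrow> 'k)
    \<Rightarrow> ('k, 'v) cochain \<Rightarrow> ('k, 'v) cochain set" where
  "cocycles M B l = {\<phi> \<in> CC M B. \<forall>X. bracket M \<phi> l X = 0}"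

definition cohomologous :: "('k::comm_ring_1, 'v::ab_group_add) smodule \<Rightarrow> ('v \<Rightarrow> 'v \<Rightarrow> 'k)
    \<Rightarrow> ('k, 'v) cochain \<Rightarrow> (('k, 'v) cochain \<times> ('k, 'v) cochain) set" where
  "cohomologous M B l =
     {(\<phi>, \<psi>). \<phi> \<in> cocycles M B l \<and> \<psi> \<in> cocycles M B l \<and>
        (\<exists>\<chi>\<in>CC M B. \<forall>X. \<psi> X - \<phi> X = bracket M \<chi> l X)}"

definition HC :: "('k::comm_ring_1, 'v::ab_group_add) smodule \<Rightarrow> ('v \<Rightarrow> 'v \<Rightarrow> 'k)
    \<Rightarrow> ('k, 'v) cochain \<Rightarrow> ('k, 'v) cochain set set" where
  "HC M B l = cocycles M B l // cohomologous M B l"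

definition hc_class :: "('k::comm_ring_1, 'v::ab_group_add) smodule \<Rightarrow> ('v \<Rightarrow> 'v \<Rightarrow> 'k)
    \<Rightarrow> ('k, 'v) cochain \<Rightarrow> ('k, 'v) cochain \<Rightarrow> ('k, 'v) cochain set" where
  "hc_class M B l \<phi> = cohomologous M B l `` {\<phi>}"

definition HC_part :: "('k::comm_ring_1, 'v::ab_group_add) smodule \<Rightarrow> ('v \<Rightarrow> 'v \<Rightarrow> 'k)
    \<Rightarrow> ('k, 'v) cochain \<Rightarrow> bit \<Rightarrow> ('k, 'v) cochain set set" where
  "HC_part M B l t = {c \<in> HC M B l. \<exists>\<phi>\<in>c. total_parity M t \<phi>}"


section \<open>Coderivations of the symmetric coalgebra\<close>

definition CW :: "('k::comm_ring_1, 'v::ab_group_add) smodule \<Rightarrow> ('k, 'v) cochain set" where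
  "CW W = Hom W 1 (scl W)"

definition has_parity :: "('k::comm_ring_1, 'v::ab_group_add) smodule \<Rightarrow> bit \<Rightarrow> ('k, 'v) cochain \<Rightarrow> bool" where
  "has_parity W a \<delta> \<longleftrightarrow>
     (\<forall>ps ws. ws \<noteq> [] \<and> homogeneous W ps ws \<longrightarrow> \<delta> (sprod W ws) \<in> deg W (a + sum_list ps))"

definition coder :: "('k::comm_ring_1, 'v::ab_group_add) smodule \<Rightarrow> ('k, 'v) cochain
    \<Rightarrow> ('k, 'v) qelem \<Rightarrow> ('k, 'v) qelem" where
  "coder W \<delta> =
     (THE D. D \<in> QHom W 1 W 1 \<and>
        (\<forall>ps ws. ws \<noteq> [] \<and> homogeneous W ps ws \<longrightarrow>
           D (sprod W ws) = cls W 1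
             (\<Sum>k = 1..length ws. \<Sum>\<sigma>\<in>Sh k (length ws - k).
                Poly_Mapping.single
                  (\<delta> (sprod W (take k (permute_list \<sigma> ws))) # drop k (permute_list \<sigma> ws))
                  (of_int (koszul \<sigma> ps)))))"

definition eta :: "('k::comm_ring_1, 'v::ab_group_add) smodule \<Rightarrow> ('k, 'v) qelem \<Rightarrow> ('k, 'v) qelem" where
  "eta M =
     (THE h. h \<in> QHom M (- 1) (\<Pi> M) 1 \<and>
        (\<forall>ps vs. vs \<noteq> [] \<and> homogeneous M ps vs \<longrightarrow>
           h (wedge M vs) = qscl (\<Pi> M) 1
             (of_int (psign (\<Sum>i<length vs. of_nat (length vs - 1 - i) * ps ! i)))
             (sprod (\<Pi> M) vs)))"

text \<open>
  The components of \<open>\<eta>\<^sup>-\<^sup>1 \<circ> \<delta> \<circ> \<eta>\<close> are \<open>\<eta>\<^sub>1\<^sup>-\<^sup>1 \<circ> \<delta>\<^sub>k \<circ> \<eta>\<^sub>k\<close>, and \<open>\<eta>\<^sub>1 = \<pi>\<close> is the identity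
  function from \<open>V\<close> to \<open>\<Pi> V\<close>.
\<close>

definition conj_eta :: "('k::comm_ring_1, 'v::ab_group_add) smodule \<Rightarrow> ('k, 'v) cochain \<Rightarrow> ('k, 'v) cochain" where
  "conj_eta M \<delta> = (\<lambda>X. if X \<in> Ext M then \<delta> (eta M X) else 0)"


section \<open>Infinitesimal deformations\<close>

text \<open>
  The pair \<open>(a, b)\<close> stands for \<open>a + u b\<close> in \<open>k[u] \<otimes> S(W) = S(W) \<oplus> u S(W)\<close>. Moving the odd map \<open>d\<close>
  past \<open>u\<close> costs the sign \<open>(-1)\<^sup>p\<close>, and \<open>u\<^sup>2 = 0\<close>; hence
  \<open>(d + u \<delta>) (a + u b) = d a + u (\<delta> a + (-1)\<^sup>p d b)\<close> and \<open>(id + u \<alpha>) (a + u b) = a + u (\<alpha> a + b)\<close>.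
\<close>

type_synonym ('k, 'v) uelem = "('k, 'v) qelem \<times> ('k, 'v) qelem"

definition uSym :: "('k::comm_ring_1, 'v::ab_group_add) smodule \<Rightarrow> ('k, 'v) uelem set" where
  "uSym W = Sym W \<times> Sym W"

definition udef :: "('k::comm_ring_1, 'v::ab_group_add) smodule \<Rightarrow> bit
    \<Rightarrow> ('k, 'v) cochain \<Rightarrow> ('k, 'v) cochain \<Rightarrow> ('k, 'v) uelem \<Rightarrow> ('k, 'v) uelem" where
  "udef W p d \<delta> =
     (\<lambda>(a, b)\<in>uSym W. (coder W d a, coder W \<delta> a + qscl W 1 (of_int (psign p)) (coder W d b)))"

definition uaut :: "('k::comm_ring_1, 'v::ab_group_add) smodule
    \<Rightarrow> ('k, 'v) cochain \<Rightarrow> ('k, 'v) uelem \<Rightarrow> ('k, 'v) uelem" where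
  "uaut W \<alpha> = (\<lambda>(a, b)\<in>uSym W. (a, coder W \<alpha> a + b))"

text \<open>
  \<open>is_deformation M B p d \<delta>\<close>: \<open>d + u \<delta>\<close> is an infinitesimal deformation preserving the inner product.
  The zero of \<open>k[u] \<otimes> S(W)\<close> is the pair of zero cosets.
\<close>

definition is_deformation :: "('k::comm_ring_1, 'v::ab_group_add) smodule \<Rightarrow> ('v \<Rightarrow> 'v \<Rightarrow> 'k) \<Rightarrow> bit
    \<Rightarrow> ('k, 'v) cochain \<Rightarrow> ('k, 'v) cochain \<Rightarrow> bool" where
  "is_deformation M B p d \<delta> \<longleftrightarrow>
     \<delta> \<in> CW (\<Pi> M) \<and> has_parity (\<Pi> M) (1 - p) \<delta> \<and>
     (\<forall>x\<in>uSym (\<Pi> M). udef (\<Pi> M) p d \<delta> (udef (\<Pi> M) p d \<delta> x) = (cls (\<Pi> M) 1 0, cls (\<Pi> M) 1 0)) \<and>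
     cyclic M B (conj_eta M \<delta>)"

definition deformations :: "('k::comm_ring_1, 'v::ab_group_add) smodule \<Rightarrow> ('v \<Rightarrow> 'v \<Rightarrow> 'k) \<Rightarrow> bit
    \<Rightarrow> ('k, 'v) cochain \<Rightarrow> (('k, 'v) uelem \<Rightarrow> ('k, 'v) uelem) set" where
  "deformations M B p d = {udef (\<Pi> M) p d \<delta> | \<delta>. is_deformation M B p d \<delta>}"

definition deformation_equiv :: "('k::comm_ring_1, 'v::ab_group_add) smodule \<Rightarrow> ('v \<Rightarrow> 'v \<Rightarrow> 'k) \<Rightarrow> bit
    \<Rightarrow> ('k, 'v) cochain
    \<Rightarrow> ((('k, 'v) uelem \<Rightarrow> ('k, 'v) uelem) \<times> (('k, 'v) uelem \<Rightarrow> ('k, 'v) uelem)) set" where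
  "deformation_equiv M B p d =
     {(D, D'). D \<in> deformations M B p d \<and> D' \<in> deformations M B p d \<and>
        (\<exists>\<alpha>\<in>CW (\<Pi> M). has_parity (\<Pi> M) p \<alpha> \<and> cyclic M B (conj_eta M \<alpha>) \<and>
           (\<forall>x\<in>uSym (\<Pi> M).
              uaut (\<Pi> M) \<alpha> (D (inv_into (uSym (\<Pi> M)) (uaut (\<Pi> M) \<alpha>) x)) = D' x))}"

end

theory Submission
  imports Defs
begin

text \<open>
  On the symmetric side, \<open>d_u\<^sup>2 = 0\<close> says that the graded commutator of the coderivations \<open>\<delta>\<close> and \<open>d\<close>
  vanishes, and conjugating \<open>d + u \<delta>\<close> by \<open>id + u \<alpha>\<close> adds the commutator of \<open>\<alpha>\<close> and \<open>d\<close> to \<open>\<delta>\<close>. Such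
  commutators are coderivations, hence determined by their corestrictions, and the signs of \<open>\<eta>\<close> are
  made so that the corestriction of the commutator with \<open>d\<close> corresponds to \<open>{-, l}\<close>. So deformations
  are cocycles and equivalences are coboundaries; a coboundary between cochains of total parity
  \<open>1 - p\<close> may be taken to come from a cyclic cochain of total parity \<open>p\<close>, because the parity
  components of a cyclic cochain are cyclic.

  Multilinear functions of lists replace maps out of the exterior and symmetric powers. A coderivation
  is described through its graded commutators with left multiplication by a letter, which reduces the
  commutator formula to an induction on words without any combinatorics of unshuffles.
\<close>

section \<open>Signs\<close>

text \<open>Two features of the setting shape the proof. The ring is arbitrary: the module need not
  be free and 2 need not be invertible, so neither bases nor halved commutators are at hand, and
  coderivations are compared through the projection to words of length one. Letters, moreover, may
  be inhomogeneous, while every sign depends on parities. The constructions therefore apply their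
  signs to the two homogeneous components of each letter (\<open>twist\<close>, \<open>etal\<close>,
  \<open>gproj\<close>), which makes them multilinear on all words; identities between them are then
  checked on homogeneous words only.

  The sign in {\<phi>, \<psi>} comes from \<eta>. A letter is weighted there by the number of
  letters behind it, and in \<phi>_k(\<psi>_j(A), B) the letter \<psi>_j(A) stands before k-1
  others; conjugation by \<eta> thus produces (-1)^((k-1)|\<psi>_j|). This also spares a direct
  check that the composite \<phi> \<circ> \<psi> is graded antisymmetric: it inherits this from the
  symmetric side, where composites of coderivations respect the relations.\<close>

declare add_bit_eq_xor [simp del] mult_bit_eq_and [simp del]

text \<open>Signs are kept as exponents in \<open>bit\<close>: products of signs become sums of
  exponents, which ring normalisation can handle once the rewriting into Boolean operations is
  switched off. No scalars are involved, so one operation serves words, vectors and ring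
  elements.\<close>

definition sg :: "bit \<Rightarrow> 'x::ab_group_add \<Rightarrow> 'x" where
  "sg a x = (if a = 0 then x else - x)"

lemma bit_add_self [simp]: "a + a = (0::bit)" "a + (a + b) = (b::bit)"
  by (cases a; cases b; simp)+

lemma sg_0 [simp]: "sg 0 x = x" and sg_1 [simp]: "sg 1 x = - x"
  and sg_zero [simp]: "sg a 0 = 0"
  by (simp_all add: sg_def)

lemma sg_sg [simp]: "sg a (sg b x) = sg (a + b) x"
  by (cases a; cases b; simp)

lemma sg_add: "sg a (x + y) = sg a x + sg a y"
  and sg_diff: "sg a (x - y) = sg a x - sg a y"
  and sg_uminus: "sg a (- x) = - sg a x"
  by (simp_all add: sg_def)

lemma sg_sum: "sg a (sum f A) = (\<Sum>x\<in>A. sg a (f x))"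
  by (simp add: sg_def sum_negf)

lemma psign_add: "psign (a + b) = psign a * psign b"
  by (cases a; cases b; simp add: psign_def)

lemma module_psign: "module t \<Longrightarrow> t (of_int (psign a)) x = sg a x"
  by (cases a) (simp_all add: psign_def module.scale_one module.scale_minus_left)

lemma (in module) scale_sg: "scale c (sg a x) = sg a (scale c x)"
  by (simp add: sg_def)

lemma (in module) subspace_sg: "subspace N \<Longrightarrow> x \<in> N \<Longrightarrow> sg a x \<in> N"
  by (simp add: sg_def subspace_neg)

lemma (in module_hom) hom_sg: "f (sg a x) = sg a (f x)"
  by (simp add: sg_def neg)

lemma module_hom_sg: "module t \<Longrightarrow> module_hom t t (sg a)"
  by (simp add: module_hom_iff sg_add module.scale_sg)

lemma module_ring [simp]: "module ((*) :: 'a::comm_ring_1 \<Rightarrow> 'a \<Rightarrow> 'a)"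
  by (simp add: module_def algebra_simps)


section \<open>Words and linear extension\<close>

lemma lookup_wscl [simp]: "Poly_Mapping.lookup (wscl c x) w = c * Poly_Mapping.lookup x w"
  unfolding wscl_def by transfer (auto simp: when_def)

lemma module_wscl [simp]: "module wscl"
  by (auto simp: module_def poly_mapping_eq_iff fun_eq_iff lookup_add algebra_simps)

interpretation words: module wscl
  by simp

abbreviation wd :: "'v list \<Rightarrow> ('k::comm_ring_1, 'v) words" where
  "wd w \<equiv> Poly_Mapping.single w 1"

lemma single_eq_wscl: "Poly_Mapping.single w c = wscl c (wd w)"
  by (auto simp: poly_mapping_eq_iff fun_eq_iff lookup_single when_def)

lemma words_eq_sum: "x = (\<Sum>w\<in>Poly_Mapping.keys x. wscl (Poly_Mapping.lookup x w) (wd w))"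
proof (rule poly_mapping_eqI)
  fix w
  have "(\<Sum>v\<in>Poly_Mapping.keys x. Poly_Mapping.lookup x v * Poly_Mapping.lookup (wd v) w)
      = (\<Sum>v\<in>Poly_Mapping.keys x. if v = w then Poly_Mapping.lookup x v else 0)"
    by (rule sum.cong) (auto simp: lookup_single when_def)
  also have "\<dots> = Poly_Mapping.lookup x w"
    by (simp add: in_keys_iff)
  finally show "Poly_Mapping.lookup x w
      = Poly_Mapping.lookup (\<Sum>w\<in>Poly_Mapping.keys x. wscl (Poly_Mapping.lookup x w) (wd w)) w"
    by (simp add: lookup_sum)
qed

text \<open>The first case is restricted to words occurring in \<open>x\<close>, so that the
  induction can be used for combinations of nonempty words; \<open>qpow_induct\<close> relies on
  this.\<close>

lemma words_induct [case_names single zero add scale]: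
  assumes "\<And>w. w \<in> Poly_Mapping.keys x \<Longrightarrow> P (wd w)"
    and "P 0" "\<And>x y. P x \<Longrightarrow> P y \<Longrightarrow> P (x + y)" and "\<And>c x. P x \<Longrightarrow> P (wscl c x)"
  shows "P x"
proof -
  have "P (\<Sum>w\<in>A. wscl (Poly_Mapping.lookup x w) (wd w))"
    if "finite A" "A \<subseteq> Poly_Mapping.keys x" for A
    using that by (induction A rule: finite_induct) (auto intro: assms)
  from this[of "Poly_Mapping.keys x"] show ?thesis
    using words_eq_sum[of x] by simp
qed

definition ext :: "('k \<Rightarrow> 'x \<Rightarrow> 'x) \<Rightarrow> ('v list \<Rightarrow> 'x) \<Rightarrow> ('k::comm_ring_1, 'v) words \<Rightarrow> 'x::ab_group_add" where
  "ext t F x = (\<Sum>w\<in>Poly_Mapping.keys x. t (Poly_Mapping.lookup x w) (F w))"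

lemma ext_superset:
  assumes "module t" "finite A" "Poly_Mapping.keys x \<subseteq> A"
  shows "ext t F x = (\<Sum>w\<in>A. t (Poly_Mapping.lookup x w) (F w))"
  unfolding ext_def using assms
  by (intro sum.mono_neutral_left) (auto simp: in_keys_iff module.scale_zero_left)

lemma module_hom_ext:
  assumes t: "module t"
  shows "module_hom wscl t (ext t F)"
proof -
  interpret module t by fact
  have "ext t F (x + y) = ext t F x + ext t F y" for x y
  proof -
    let ?A = "Poly_Mapping.keys x \<union> Poly_Mapping.keys y"
    have "ext t F (x + y) = (\<Sum>w\<in>?A. t (Poly_Mapping.lookup (x + y) w) (F w))"
      using keys_add[of x y] by (intro ext_superset t) auto
    also have "\<dots> = (\<Sum>w\<in>?A. t (Poly_Mapping.lookup x w) (F w)) + (\<Sum>w\<in>?A. t (Poly_Mapping.lookup y w) (F w))"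
      by (simp add: lookup_add scale_left_distrib sum.distrib)
    also have "\<dots> = ext t F x + ext t F y"
      by (simp add: ext_superset[OF t, of ?A])
    finally show ?thesis .
  qed
  moreover have "ext t F (wscl c x) = t c (ext t F x)" for c x
  proof -
    have "ext t F (wscl c x) = (\<Sum>w\<in>Poly_Mapping.keys x. t (Poly_Mapping.lookup (wscl c x) w) (F w))"
      by (intro ext_superset t) (auto simp: in_keys_iff)
    also have "\<dots> = t c (ext t F x)"
      by (simp add: ext_def scale_sum_right)
    finally show ?thesis .
  qed
  ultimately show ?thesis
    using t by (simp add: module_hom_iff)
qed

lemma ext_single: "module t \<Longrightarrow> ext t F (Poly_Mapping.single w c) = t c (F w)"
  by (cases "c = 0") (simp_all add: ext_def module.scale_zero_left)

lemma ext_wd [simp]: "module t \<Longrightarrow> ext t F (wd w) = F w"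
  by (simp add: ext_single module.scale_one)

lemma
  assumes "module t"
  shows ext_add: "ext t F (x + y) = ext t F x + ext t F y"
    and ext_diff: "ext t F (x - y) = ext t F x - ext t F y"
    and ext_zero [simp]: "ext t F 0 = 0"
    and ext_scale: "ext t F (wscl c x) = t c (ext t F x)"
    and ext_sg: "ext t F (sg a x) = sg a (ext t F x)"
proof -
  interpret h: module_hom wscl t "ext t F"
    by (rule module_hom_ext) fact
  show "ext t F (x + y) = ext t F x + ext t F y" "ext t F (x - y) = ext t F x - ext t F y"
    "ext t F 0 = 0" "ext t F (wscl c x) = t c (ext t F x)" "ext t F (sg a x) = sg a (ext t F x)"
    by (simp_all add: h.add h.diff h.scale h.hom_sg)
qed

lemma ext_cong: "(\<And>w. w \<in> Poly_Mapping.keys x \<Longrightarrow> F w = G w) \<Longrightarrow> ext t F x = ext t G x"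
  by (simp add: ext_def)

lemma ext_add_fun: "module t \<Longrightarrow> ext t (\<lambda>w. F w + G w) x = ext t F x + ext t G x"
  by (simp add: ext_def module.scale_right_distrib sum.distrib)

lemma ext_scale_fun:
  assumes "module t"
  shows "ext t (\<lambda>w. t c (F w)) x = t c (ext t F x)"
proof -
  interpret module t by fact
  show ?thesis by (simp add: ext_def scale_sum_right mult.commute)
qed

lemma ext_sg_fun: "module t \<Longrightarrow> ext t (\<lambda>w. sg a (F w)) x = sg a (ext t F x)"
  by (simp add: ext_def module.scale_sg sg_sum)

lemma ext_zero_fun [simp]: "module t \<Longrightarrow> ext t (\<lambda>w. 0) x = 0"
  by (simp add: ext_def module.scale_zero_right)

lemma module_hom_on_words:
  assumes "module_hom wscl t \<Phi>"
  shows "\<Phi> x = ext t (\<lambda>w. \<Phi> (wd w)) x"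
proof -
  interpret module_hom wscl t \<Phi> by fact
  show ?thesis
    using arg_cong[OF words_eq_sum[of x], of \<Phi>] by (simp only: ext_def sum scale)
qed

lemma ext_ext:
  assumes "module t"
  shows "ext t F (ext wscl G x) = ext t (\<lambda>w. ext t F (G w)) x"
proof -
  interpret h: module_hom wscl t "ext t F"
    by (rule module_hom_ext) fact
  show ?thesis by (simp add: ext_def[of wscl] ext_def[of t _ x] h.sum h.scale)
qed


section \<open>Multilinear graded symmetric functions of lists\<close>

text \<open>
  A function of lists satisfying \<open>gsym M e t N\<close> is the same thing as a linear map on words that sends
  the relations of sign \<open>(-1)\<^sup>e\<close> into \<open>N\<close>.
\<close>

definition gsym :: "('k::comm_ring_1, 'v::ab_group_add) smodule \<Rightarrow> bit \<Rightarrow> ('k \<Rightarrow> 'x \<Rightarrow> 'x) \<Rightarrow> 'x set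
    \<Rightarrow> ('v list \<Rightarrow> 'x::ab_group_add) \<Rightarrow> bool" where
  "gsym M e t N F \<longleftrightarrow>
     (\<forall>xs ys a b. F (xs @ (a + b) # ys) - F (xs @ a # ys) - F (xs @ b # ys) \<in> N) \<and>
     (\<forall>xs ys c a. F (xs @ scl M c a # ys) - t c (F (xs @ a # ys)) \<in> N) \<and>
     (\<forall>xs ys x y p q. x \<in> deg M p \<longrightarrow> y \<in> deg M q \<longrightarrow>
        F (xs @ x # y # ys) - sg (e + p * q) (F (xs @ y # x # ys)) \<in> N)"

abbreviation gsym0 :: "('k::comm_ring_1, 'v::ab_group_add) smodule \<Rightarrow> bit \<Rightarrow> ('k \<Rightarrow> 'x \<Rightarrow> 'x)
    \<Rightarrow> ('v list \<Rightarrow> 'x::ab_group_add) \<Rightarrow> bool" where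
  "gsym0 M e t \<equiv> gsym M e t {0}"

lemma
  assumes "gsym M e t N F"
  shows gsym_addD: "F (xs @ (a + b) # ys) - F (xs @ a # ys) - F (xs @ b # ys) \<in> N"
    and gsym_scaleD: "F (xs @ scl M c a # ys) - t c (F (xs @ a # ys)) \<in> N"
    and gsym_swapD: "x \<in> deg M p \<Longrightarrow> y \<in> deg M q \<Longrightarrow>
      F (xs @ x # y # ys) - sg (e + p * q) (F (xs @ y # x # ys)) \<in> N"
  using assms by (auto simp: gsym_def)

text \<open>The preimage of \<open>N\<close> is a submodule containing the relators, hence their
  span. A target submodule is allowed because many functions below take values in words and are
  multilinear and symmetric only modulo the relations among those.\<close>

lemma relmod_gsym:
  assumes "module t" "module.subspace t N" "gsym M e t N F" "x \<in> relmod M (psign e)"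
  shows "ext t F x \<in> N"
proof -
  interpret h: module_hom wscl t "ext t F"
    by (rule module_hom_ext) fact
  have "psign e * psign (p * q) = psign (e + p * q)" for p q
    by (simp add: psign_add)
  then have "ext t F r \<in> N" if "r \<in> relators M (psign e)" for r
    using that assms(1,3) unfolding relators_def gsym_def
    by (auto simp: ext_diff ext_single module.scale_one module_psign)
  then have "relators M (psign e) \<subseteq> ext t F -` N"
    by blast
  then have "words.span (relators M (psign e)) \<subseteq> ext t F -` N"
    by (rule words.span_minimal) (rule h.subspace_vimage[OF assms(2)])
  then show ?thesis
    using assms(4) unfolding relmod_def by blast
qed

lemma gsym_hom:
  assumes h: "module_hom wscl t \<Phi>" and N: "\<And>x. x \<in> relmod M (psign e) \<Longrightarrow> \<Phi> x \<in> N"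
  shows "gsym M e t N (\<lambda>vs. \<Phi> (wd vs))"
proof -
  interpret h: module_hom wscl t \<Phi> by fact
  have R: "\<Phi> r \<in> N" if "r \<in> relators M (psign e)" for r
    using that unfolding relmod_def by (intro N) (simp add: relmod_def words.span_base)
  have 1: "\<Phi> (wd (xs @ (a + b) # ys)) - \<Phi> (wd (xs @ a # ys)) - \<Phi> (wd (xs @ b # ys)) \<in> N" for xs ys a b
  proof -
    have "wd (xs @ (a + b) # ys) - wd (xs @ a # ys) - wd (xs @ b # ys) \<in> relators M (psign e)"
      unfolding relators_def by (simp, blast)
    from R[OF this] show ?thesis
      by (simp add: h.diff)
  qed
  have 2: "\<Phi> (wd (xs @ scl M c a # ys)) - t c (\<Phi> (wd (xs @ a # ys))) \<in> N" for xs ys c a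
  proof -
    have "wd (xs @ scl M c a # ys) - Poly_Mapping.single (xs @ a # ys) c \<in> relators M (psign e)"
      unfolding relators_def by (simp, blast)
    from R[OF this] show ?thesis
      by (simp add: h.diff single_eq_wscl[of _ c] h.scale)
  qed
  have 3: "\<Phi> (wd (xs @ x # y # ys)) - sg (e + p * q) (\<Phi> (wd (xs @ y # x # ys))) \<in> N"
    if "x \<in> deg M p" "y \<in> deg M q" for xs ys x y p q
  proof -
    have "wd (xs @ x # y # ys) - Poly_Mapping.single (xs @ y # x # ys) (of_int (psign e * psign (p * q)))
        \<in> relators M (psign e)"
      unfolding relators_def using that by (simp, blast)
    from R[OF this] show ?thesis
      by (simp add: h.diff single_eq_wscl[of _ "_ * _"] h.scale
          module_psign[OF h.m2.module_axioms] flip: h.m2.scale_scale)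
  qed
  show ?thesis
    unfolding gsym_def using 1 2 3 by blast
qed

text \<open>Each relation compares words of one length, so the map applied afterwards may vary with
  the length. Signs and parities that depend on the arity enter in this way.\<close>

lemma gsym_comp:
  assumes "gsym M e s N F" and h: "\<And>n. module_hom s t (\<Phi> n)" and N: "\<And>n x. x \<in> N \<Longrightarrow> \<Phi> n x \<in> N'"
  shows "gsym M e t N' (\<lambda>vs. \<Phi> (length vs) (F vs))"
  unfolding gsym_def
proof (intro conjI allI impI)
  fix xs ys :: "'b list" and a b
  let ?n = "Suc (length xs + length ys)"
  interpret module_hom s t "\<Phi> ?n" by (rule h)
  show "\<Phi> (length (xs @ (a + b) # ys)) (F (xs @ (a + b) # ys)) - \<Phi> (length (xs @ a # ys)) (F (xs @ a # ys))
      - \<Phi> (length (xs @ b # ys)) (F (xs @ b # ys)) \<in> N'"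
    using N[OF gsym_addD[OF assms(1)], of ?n xs a b ys] by (simp add: diff)
next
  fix xs ys :: "'b list" and a c
  let ?n = "Suc (length xs + length ys)"
  interpret module_hom s t "\<Phi> ?n" by (rule h)
  show "\<Phi> (length (xs @ scl M c a # ys)) (F (xs @ scl M c a # ys))
      - t c (\<Phi> (length (xs @ a # ys)) (F (xs @ a # ys))) \<in> N'"
    using N[OF gsym_scaleD[OF assms(1)], of ?n xs c a ys] by (simp add: diff scale)
next
  fix xs ys :: "'b list" and x y p q
  assume "x \<in> deg M p" "y \<in> deg M q"
  let ?n = "Suc (Suc (length xs + length ys))"
  interpret module_hom s t "\<Phi> ?n" by (rule h)
  show "\<Phi> (length (xs @ x # y # ys)) (F (xs @ x # y # ys))
      - sg (e + p * q) (\<Phi> (length (xs @ y # x # ys)) (F (xs @ y # x # ys))) \<in> N'"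
    using N[OF gsym_swapD[OF assms(1) \<open>x \<in> deg M p\<close> \<open>y \<in> deg M q\<close>], of ?n xs ys] by (simp add: diff hom_sg)
qed

lemma gsym_comp_const:
  assumes "gsym M e s N F" and "module_hom s t \<Phi>" and "\<And>x. x \<in> N \<Longrightarrow> \<Phi> x \<in> N'"
  shows "gsym M e t N' (\<lambda>vs. \<Phi> (F vs))"
  using gsym_comp[of M e s N F t "\<lambda>_. \<Phi>" N'] assms by blast

lemma gsym_cong_length:
  assumes "\<And>n. gsym M e t N (F n)"
  shows "gsym M e t N (\<lambda>vs. F (length vs) vs)"
  using assms unfolding gsym_def by simp

text \<open>Relations are imposed inside arbitrary words, so a fixed first letter does no harm.
  Absorbing the letters of a word one at a time rests on this.\<close>

lemma gsym_shift: "gsym M e t N F \<Longrightarrow> gsym M e t N (\<lambda>vs. F (w # vs))"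
  unfolding gsym_def append_Cons[symmetric] by blast

lemma gsym_add:
  assumes t: "module t" "module.subspace t N" and "gsym M e t N F" "gsym M e t N G"
  shows "gsym M e t N (\<lambda>vs. F vs + G vs)"
proof -
  interpret module t by fact
  have *: "(a + a') - (b + b') \<in> N" if "a - b \<in> N" "a' - b' \<in> N" for a a' b b'
    using subspace_add[OF t(2) that] by (simp add: algebra_simps)
  have **: "(a + a') - (b + b') - (c + c') \<in> N" if "a - b - c \<in> N" "a' - b' - c' \<in> N" for a a' b b' c c'
    using subspace_add[OF t(2) that] by (simp add: algebra_simps)
  show ?thesis
    unfolding gsym_def sg_add scale_right_distrib
  proof (intro conjI allI impI)
    show "F (xs @ (a + b) # ys) + G (xs @ (a + b) # ys) - (F (xs @ a # ys) + G (xs @ a # ys))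
        - (F (xs @ b # ys) + G (xs @ b # ys)) \<in> N" for xs ys a b
      by (rule ** gsym_addD assms(3,4))+
    show "F (xs @ scl M c a # ys) + G (xs @ scl M c a # ys)
        - (t c (F (xs @ a # ys)) + t c (G (xs @ a # ys))) \<in> N" for xs ys c a
      by (rule * gsym_scaleD assms(3,4))+
    show "F (xs @ x # y # ys) + G (xs @ x # y # ys)
        - (sg (e + p * q) (F (xs @ y # x # ys)) + sg (e + p * q) (G (xs @ y # x # ys))) \<in> N"
      if "x \<in> deg M p" "y \<in> deg M q" for xs ys x y p q
      using gsym_swapD[OF assms(3) that] gsym_swapD[OF assms(4) that] by (intro *)
  qed
qed

lemma gsym_zero: "module t \<Longrightarrow> module.subspace t N \<Longrightarrow> gsym M e t N (\<lambda>_. 0)"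
  by (simp add: gsym_def module.subspace_0 module.scale_zero_right)

lemma gsym_sg:
  assumes "module t" "module.subspace t N" "gsym M e t N F"
  shows "gsym M e t N (\<lambda>vs. sg (a (length vs)) (F vs))"
  by (rule gsym_comp[OF assms(3), of t "\<lambda>n. sg (a n)"])
    (use assms in \<open>auto simp: module_hom_sg module.subspace_sg\<close>)

lemma gsym_if_length:
  assumes "module t" "module.subspace t N" "gsym M e t N F"
  shows "gsym M e t N (\<lambda>vs. if P (length vs) then F vs else 0)"
  by (rule gsym_comp[OF assms(3), of t "\<lambda>n x. if P n then x else 0"])
    (use assms in \<open>auto simp: module_hom_iff module.subspace_0 module.scale_zero_right\<close>)

lemma gsym_uminus: "module t \<Longrightarrow> module.subspace t N \<Longrightarrow> gsym M e t N F \<Longrightarrow> gsym M e t N (\<lambda>vs. - F vs)"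
  using gsym_sg[of t N M e F "\<lambda>_. 1"] by simp

lemma gsym_diff:
  assumes "module t" "module.subspace t N" "gsym M e t N F" "gsym M e t N G"
  shows "gsym M e t N (\<lambda>vs. F vs - G vs)"
  using gsym_add[OF assms(1-3) gsym_uminus[OF assms(1,2,4)]] by simp

lemma gsym_sum:
  assumes "module t" "module.subspace t N" "\<And>i. i \<in> I \<Longrightarrow> gsym M e t N (F i)"
  shows "gsym M e t N (\<lambda>vs. \<Sum>i\<in>I. F i vs)"
  using assms(3)
proof (induction I rule: infinite_finite_induct)
  case (insert i I)
  then have "gsym M e t N (\<lambda>vs. F i vs + (\<Sum>i\<in>I. F i vs))"
    using insert by (intro gsym_add assms(1,2)) auto
  then show ?case using insert by simp
qed (simp_all add: gsym_zero assms)

lemma gsym0_add: "gsym0 M e t F \<Longrightarrow> F (xs @ (a + b) # ys) = F (xs @ a # ys) + F (xs @ b # ys)"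
  using gsym_addD[of M e t "{0}" F xs a b ys] by (simp only: singleton_iff diff_diff_eq right_minus_eq)

lemma gsym0_scale: "gsym0 M e t F \<Longrightarrow> F (xs @ scl M c a # ys) = t c (F (xs @ a # ys))"
  using gsym_scaleD[of M e t "{0}" F xs c a ys] by (simp only: singleton_iff right_minus_eq)

lemma gsym0_swap: "gsym0 M e t F \<Longrightarrow> x \<in> deg M p \<Longrightarrow> y \<in> deg M q \<Longrightarrow>
    F (xs @ x # y # ys) = sg (e + p * q) (F (xs @ y # x # ys))"
  using gsym_swapD[of M e t "{0}" F x p y q xs ys] by (simp only: singleton_iff right_minus_eq)

lemma gsym0_zero: "gsym0 M e t F \<Longrightarrow> F (xs @ 0 # ys) = 0"
  using gsym0_add[of M e t F xs 0 0 ys] by (simp only: add_0_left add_cancel_right_right)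

lemma gsym_ext:
  assumes "gsym M e wscl (relmod M (psign e)) F" "module t" "gsym0 M e t G"
  shows "gsym0 M e t (\<lambda>vs. ext t G (F vs))"
  by (rule gsym_comp_const[OF assms(1) module_hom_ext])
    (use assms relmod_gsym[of t "{0}" M e G] in \<open>auto simp: module.subspace_single_0\<close>)

lemma gsym0_relmod: "module t \<Longrightarrow> gsym0 M e t F \<Longrightarrow> x \<in> relmod M (psign e) \<Longrightarrow> ext t F x = 0"
  using relmod_gsym[of t "{0}" M e F] by (auto simp: module.subspace_single_0)

lemma gsym_ext_words: "module t \<Longrightarrow> module.subspace t N \<Longrightarrow> gsym M e t N F \<Longrightarrow> x - y \<in> relmod M (psign e)
    \<Longrightarrow> ext t F x - ext t F y \<in> N"
  using relmod_gsym[of t N M e F "x - y"] by (simp only: ext_diff)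

section \<open>Maps out of graded symmetric and exterior powers\<close>

lemma psign_simps: "psign 0 = 1" "psign 1 = - 1"
  by (simp_all add: psign_def)

section \<open>Homogeneous components and the reduction to homogeneous words\<close>

locale graded =
  fixes M :: "('k::comm_ring_1, 'v::ab_group_add) smodule"
  assumes graded: "graded_module M"
begin

sublocale V: module "scl M"
  using graded by (simp add: graded_module_def)

lemma subspace_deg: "V.subspace (deg M p)"
  using graded by (simp add: graded_module_def)

lemma deg_zero [simp]: "0 \<in> deg M p"
  and deg_add: "x \<in> deg M p \<Longrightarrow> y \<in> deg M p \<Longrightarrow> x + y \<in> deg M p"
  and deg_scale: "x \<in> deg M p \<Longrightarrow> scl M c x \<in> deg M p"
  and deg_diff: "x \<in> deg M p \<Longrightarrow> y \<in> deg M p \<Longrightarrow> x - y \<in> deg M p"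
  and deg_sg: "x \<in> deg M p \<Longrightarrow> sg a x \<in> deg M p"
  using subspace_deg[of p]
  by (auto simp: V.subspace_0 V.subspace_add V.subspace_scale V.subspace_diff V.subspace_sg)

lemma deg_disjoint: "x \<in> deg M p \<Longrightarrow> x \<in> deg M (p + 1) \<Longrightarrow> x = 0"
  using graded unfolding graded_module_def by (cases p) auto

lemma hproj_eqI:
  assumes "x \<in> deg M p" "v - x \<in> deg M (p + 1)"
  shows "hproj M p v = x"
  unfolding hproj_def
proof (rule the_equality)
  fix y assume y: "y \<in> deg M p \<and> v - y \<in> deg M (p + 1)"
  have "x - y = (v - y) - (v - x)"
    by simp
  then have "x - y \<in> deg M (p + 1)"
    using y assms by (metis deg_diff)
  moreover have "x - y \<in> deg M p"
    using y assms by (simp add: deg_diff)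
  ultimately show "y = x"
    using deg_disjoint by (metis right_minus_eq)
qed (use assms in simp)

lemma hproj_split: "hproj M 0 v + hproj M 1 v = v" (is ?split)
  and hproj_deg [simp]: "hproj M p v \<in> deg M p"
proof -
  obtain x y where xy: "x \<in> deg M 0" "y \<in> deg M 1" "v = x + y"
    using graded unfolding graded_module_def by metis
  have *: "hproj M 0 v = x" "hproj M 1 v = y"
    by (rule hproj_eqI; use xy in simp)+
  then show ?split "hproj M p v \<in> deg M p"
    using xy by (simp, cases p, auto)
qed

lemma hproj_compl: "v - hproj M p v = hproj M (p + 1) v"
  using hproj_split[of v] by (cases p) (auto simp: algebra_simps)

lemma hproj_add: "hproj M p (v + w) = hproj M p v + hproj M p w"
proof (rule hproj_eqI)
  have "v + w - (hproj M p v + hproj M p w) = (v - hproj M p v) + (w - hproj M p w)"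
    by simp
  then show "v + w - (hproj M p v + hproj M p w) \<in> deg M (p + 1)"
    by (simp add: hproj_compl deg_add)
qed (simp add: deg_add)

lemma hproj_scale: "hproj M p (scl M c v) = scl M c (hproj M p v)"
  by (rule hproj_eqI)
    (simp_all add: deg_scale hproj_compl flip: V.scale_right_diff_distrib)

lemma module_hom_hproj: "module_hom (scl M) (scl M) (hproj M p)"
  by (simp add: module_hom_iff V.module_axioms hproj_add hproj_scale)

lemma hproj_same: "x \<in> deg M p \<Longrightarrow> hproj M p x = x"
  by (rule hproj_eqI) simp_all

lemma hproj_other: "x \<in> deg M p \<Longrightarrow> hproj M (p + 1) x = 0"
  by (rule hproj_eqI) (simp_all add: add.assoc)

lemma hproj_homogeneous: "x \<in> deg M p \<Longrightarrow> hproj M q x = (if p = q then x else 0)"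
  using hproj_same[of x p] hproj_other[of x p] by (cases p; cases q) auto

lemma hproj_zero [simp]: "hproj M p 0 = 0"
  by (rule hproj_eqI) simp_all

lemma homogeneous_Nil [simp]: "homogeneous M ps [] \<longleftrightarrow> ps = []" "homogeneous M [] vs \<longleftrightarrow> vs = []"
  by (simp_all add: homogeneous_def)

lemma homogeneous_Cons [simp]:
  "homogeneous M (p # ps) (v # vs) \<longleftrightarrow> v \<in> deg M p \<and> homogeneous M ps vs"
  by (simp add: homogeneous_def)

lemma homogeneous_length: "homogeneous M ps vs \<Longrightarrow> length ps = length vs"
  by (simp add: homogeneous_def list_all2_lengthD)

lemma homogeneous_append:
  "length ps = length vs \<Longrightarrow> homogeneous M (ps @ qs) (vs @ ws) \<longleftrightarrow> homogeneous M ps vs \<and> homogeneous M qs ws"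
  by (auto simp: homogeneous_def list_all2_append)

text \<open>From left to right each letter is split into its even and its odd part; the inner
  induction keeps the letters of \<open>xs\<close> homogeneous. Multilinear identities need checking
  only where signs make sense.\<close>

lemma multilinear_induct [case_names homogeneous add]:
  assumes hom: "\<And>ps vs. homogeneous M ps vs \<Longrightarrow> Q vs"
    and add: "\<And>xs a b ys. Q (xs @ a # ys) \<Longrightarrow> Q (xs @ b # ys) \<Longrightarrow> Q (xs @ (a + b) # ys)"
  shows "Q vs"
proof -
  have "Q (xs @ ys)" if "homogeneous M ps xs" for ps xs ys
    using that
  proof (induction ys arbitrary: ps xs)
    case Nil
    then show ?case by (simp add: hom)
  next
    case (Cons y ys)
    have "Q (xs @ hproj M q y # ys)" for q
      using Cons.IH[of "ps @ [q]" "xs @ [hproj M q y]"] Cons.prems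
      by (simp add: homogeneous_append homogeneous_length)
    then have "Q (xs @ (hproj M 0 y + hproj M 1 y) # ys)"
      by (intro add)
    then show ?case by (simp add: hproj_split)
  qed
  from this[of "[]" "[]" vs] show ?thesis by simp
qed

lemma gsym0_eqI:
  assumes "gsym0 M e t F" "gsym0 M e t G" "\<And>ps vs. homogeneous M ps vs \<Longrightarrow> vs \<noteq> [] \<Longrightarrow> F vs = G vs"
  shows "vs \<noteq> [] \<Longrightarrow> F vs = G vs"
proof (induction vs rule: multilinear_induct)
  case (add xs a b ys)
  then show ?case by (simp add: gsym0_add[OF assms(1)] gsym0_add[OF assms(2)])
qed (simp add: assms(3))

section \<open>Cosets of words modulo the relations\<close>

lemma subspace_relmod [simp]: "words.subspace (relmod M s)"
  by (simp add: relmod_def)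

lemma relmod_zero [simp]: "0 \<in> relmod M s"
  by (simp add: words.subspace_0)

lemma mem_cls: "y \<in> cls M s x \<longleftrightarrow> y - x \<in> relmod M s"
  by (force simp: cls_def elt_set_plus_def algebra_simps)

lemma self_mem_cls: "x \<in> cls M s x"
  by (simp add: mem_cls)

lemma cls_eq_iff: "cls M s x = cls M s y \<longleftrightarrow> x - y \<in> relmod M s"
proof
  assume "cls M s x = cls M s y"
  then show "x - y \<in> relmod M s"
    using self_mem_cls[of x s] by (simp add: mem_cls)
next
  assume xy: "x - y \<in> relmod M s"
  have "z - x \<in> relmod M s \<longleftrightarrow> z - y \<in> relmod M s" for z
  proof
    assume "z - x \<in> relmod M s"
    from words.subspace_add[OF subspace_relmod this xy] show "z - y \<in> relmod M s" by simp
  next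
    assume "z - y \<in> relmod M s"
    from words.subspace_diff[OF subspace_relmod this xy] show "z - x \<in> relmod M s" by simp
  qed
  then show "cls M s x = cls M s y" by (auto simp: mem_cls)
qed

lemma cls_add: "cls M s x + cls M s y = cls M s (x + y)"
proof -
  have "x \<in> relmod M s + relmod M s" if "x \<in> relmod M s" for x
    using set_plus_intro[OF that relmod_zero[of s]] by simp
  then have "relmod M s + relmod M s = relmod M s"
    using words.subspace_add[OF subspace_relmod[of s]] by (auto elim!: set_plus_elim)
  then show ?thesis
    by (simp add: cls_def set_plus_rearrange)
qed

lemma qscl_cls: "qscl M s c (cls M s x) = cls M s (wscl c x)"
proof (intro equalityI subsetI)
  fix y assume "y \<in> qscl M s c (cls M s x)"
  then obtain z r where zr: "z - x \<in> relmod M s" "r \<in> relmod M s" "y = wscl c z + r"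
    by (auto simp: qscl_def mem_cls elim!: set_plus_elim)
  have "y - wscl c x = wscl c (z - x) + r"
    using zr by (simp add: words.scale_right_diff_distrib)
  also have "\<dots> \<in> relmod M s"
    by (intro words.subspace_add words.subspace_scale subspace_relmod zr)
  finally show "y \<in> cls M s (wscl c x)"
    by (simp add: mem_cls)
next
  fix y assume "y \<in> cls M s (wscl c x)"
  then have "y - wscl c x \<in> relmod M s"
    by (simp add: mem_cls)
  then have "wscl c x + (y - wscl c x) \<in> qscl M s c (cls M s x)"
    unfolding qscl_def by (intro set_plus_intro imageI self_mem_cls)
  then show "y \<in> qscl M s c (cls M s x)" by simp
qed

text \<open>Relations involve nonempty words only, so taking the coefficient of the empty word is a
  functional that kills them. Whether a coset lies in \<open>qpow\<close> can therefore be read off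
  from any representative.\<close>

lemma relmod_lookup_Nil:
  assumes "r \<in> relmod M (psign e)"
  shows "Poly_Mapping.lookup r [] = 0"
proof -
  have "gsym0 M e (*) (\<lambda>vs. if vs = [] then 1 else 0 :: 'k)"
    by (simp add: gsym_def)
  from gsym0_relmod[OF _ this assms] show ?thesis
    by (simp add: ext_def in_keys_iff if_distrib[of "(*) _"] cong: if_cong split: if_splits)
qed

lemma cls_in_qpow [simp]: "cls M (psign e) x \<in> qpow M (psign e) \<longleftrightarrow> Poly_Mapping.lookup x [] = 0"
proof
  assume "cls M (psign e) x \<in> qpow M (psign e)"
  then obtain y where "x - y \<in> relmod M (psign e)" "Poly_Mapping.lookup y [] = 0"
    by (auto simp: qpow_def cls_eq_iff)
  then show "Poly_Mapping.lookup x [] = 0"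
    using relmod_lookup_Nil[of "x - y" e] by (simp add: lookup_minus)
qed (auto simp: qpow_def)

lemma lookup_wd_Nil [simp]: "Poly_Mapping.lookup (wd vs) [] = (if vs = [] then 1 else 0)"
  by (simp add: lookup_single)

lemma mon_in_qpow: "vs \<noteq> [] \<Longrightarrow> mon M (psign e) vs \<in> qpow M (psign e)"
  by (simp add: mon_def)

lemma qpow_cases:
  assumes "X \<in> qpow M (psign e)"
  obtains x where "X = cls M (psign e) x" "Poly_Mapping.lookup x [] = 0"
  using assms by (auto simp: qpow_def)

lemma mon_add: "mon M (psign e) (xs @ (a + b) # ys)
    = mon M (psign e) (xs @ a # ys) + mon M (psign e) (xs @ b # ys)"
proof -
  have "wd (xs @ (a + b) # ys) - wd (xs @ a # ys) - wd (xs @ b # ys) \<in> relators M (psign e)"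
    unfolding relators_def by (simp, blast)
  then show ?thesis
    by (simp add: mon_def cls_add cls_eq_iff relmod_def words.span_base diff_diff_eq)
qed

lemma qpow_induct [consumes 1, case_names mon add scale]:
  assumes "X \<in> qpow M (psign e)"
    and mon: "\<And>ps vs. vs \<noteq> [] \<Longrightarrow> homogeneous M ps vs \<Longrightarrow> P (mon M (psign e) vs)"
    and add: "\<And>X Y. X \<in> qpow M (psign e) \<Longrightarrow> Y \<in> qpow M (psign e) \<Longrightarrow> P X \<Longrightarrow> P Y \<Longrightarrow> P (X + Y)"
    and scale: "\<And>c X. X \<in> qpow M (psign e) \<Longrightarrow> P X \<Longrightarrow> P (qscl M (psign e) c X)"
  shows "P X"
proof -
  have words: "P (mon M (psign e) vs)" if "vs \<noteq> []" for vs
    using that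
  proof (induction vs rule: multilinear_induct)
    case (add xs a b ys)
    then show ?case
      unfolding mon_add by (intro assms(3) mon_in_qpow) auto
  qed (rule mon)
  \<comment> \<open>The zero coset is not among the given cases; it arises as 0 times the class of a
    one-letter word.\<close>
  have zero: "P (cls M (psign e) 0)"
    using scale[of "mon M (psign e) [0]" 0] words[of "[0]"] mon_in_qpow[of "[0]" e]
    by (simp add: mon_def qscl_cls)
  obtain x where x: "X = cls M (psign e) x" "Poly_Mapping.lookup x [] = 0"
    using assms(1) by (rule qpow_cases)
  have "Poly_Mapping.lookup x [] = 0 \<and> P (cls M (psign e) x)"
  proof (induction x rule: words_induct)
    case (single w)
    then have "w \<noteq> []"
      using x(2) by (auto simp: in_keys_iff)
    then show ?case using words[of w] by (simp add: mon_def)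
  next
    case (add x y)
    then show ?case
      using assms(3)[of "cls M (psign e) x" "cls M (psign e) y"] by (simp add: cls_add lookup_add)
  next
    case (scale c x)
    then show ?case
      using assms(4)[of "cls M (psign e) x" c] by (simp add: qscl_cls)
  qed (simp add: zero)
  then show ?thesis by (simp add: x)
qed

lemma Hom_eqI:
  assumes f: "f \<in> Hom M (psign e) t" and g: "g \<in> Hom M (psign e) t"
    and eq: "\<And>ps vs. vs \<noteq> [] \<Longrightarrow> homogeneous M ps vs \<Longrightarrow> f (mon M (psign e) vs) = g (mon M (psign e) vs)"
  shows "f = g"
proof
  fix X
  show "f X = g X"
  proof (cases "X \<in> qpow M (psign e)")
    case True
    then show ?thesis
      by (induction X rule: qpow_induct) (use f g eq in \<open>auto simp: Hom_def\<close>)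
  qed (use f g in \<open>auto simp: Hom_def\<close>)
qed

lemma QHom_eqI:
  assumes f: "f \<in> QHom M (psign e) N s" and g: "g \<in> QHom M (psign e) N s"
    and eq: "\<And>ps vs. vs \<noteq> [] \<Longrightarrow> homogeneous M ps vs \<Longrightarrow> f (mon M (psign e) vs) = g (mon M (psign e) vs)"
  shows "f = g"
proof
  fix X
  show "f X = g X"
  proof (cases "X \<in> qpow M (psign e)")
    case True
    then show ?thesis
      by (induction X rule: qpow_induct) (use f g eq in \<open>auto simp: QHom_def\<close>)
  qed (use f g in \<open>auto simp: QHom_def\<close>)
qed

section \<open>Universal property: maps on powers and multilinear functions of lists\<close>

definition rep :: "('k, 'v) qelem \<Rightarrow> ('k, 'v) words" where
  "rep X = (SOME x. x \<in> X)"

lemma rep_cls: "rep (cls M s x) - x \<in> relmod M s"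
  unfolding rep_def mem_cls[symmetric] by (rule someI) (rule self_mem_cls)

definition hom_of :: "bit \<Rightarrow> ('k \<Rightarrow> 'x \<Rightarrow> 'x) \<Rightarrow> ('v list \<Rightarrow> 'x) \<Rightarrow> ('k, 'v) qelem \<Rightarrow> 'x::ab_group_add" where
  "hom_of e t F X = (if X \<in> qpow M (psign e) then ext t F (rep X) else 0)"

lemma
  assumes t: "module t" and F: "gsym0 M e t F"
  shows hom_of_mon: "vs \<noteq> [] \<Longrightarrow> hom_of e t F (mon M (psign e) vs) = F vs"
    and hom_of_in_Hom: "hom_of e t F \<in> Hom M (psign e) t"
proof -
  have *: "hom_of e t F (cls M (psign e) x) = ext t F x" if "Poly_Mapping.lookup x [] = 0" for x
    using gsym0_relmod[OF t F rep_cls, of x] that by (simp add: hom_of_def ext_diff[OF t])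
  then show "vs \<noteq> [] \<Longrightarrow> hom_of e t F (mon M (psign e) vs) = F vs"
    by (simp add: mon_def t)
  show "hom_of e t F \<in> Hom M (psign e) t"
    unfolding Hom_def
    by (auto elim!: qpow_cases simp: cls_add qscl_cls * lookup_add ext_add[OF t] ext_scale[OF t])
       (simp add: hom_of_def)
qed

definition qhom_of :: "bit \<Rightarrow> ('k, 'w::ab_group_add) smodule \<Rightarrow> bit \<Rightarrow> ('v list \<Rightarrow> ('k, 'w) words)
    \<Rightarrow> ('k, 'v) qelem \<Rightarrow> ('k, 'w) qelem" where
  "qhom_of e N e' G X = (if X \<in> qpow M (psign e) then cls N (psign e') (ext wscl G (rep X)) else {})"

lemma lookup_ext_Nil:
  assumes "\<And>vs. vs \<noteq> [] \<Longrightarrow> Poly_Mapping.lookup (G vs) [] = 0" "Poly_Mapping.lookup x [] = 0"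
  shows "Poly_Mapping.lookup (ext wscl G x) [] = 0"
proof -
  have "Poly_Mapping.lookup (G w) [] = 0" if "w \<in> Poly_Mapping.keys x" for w
    using that assms by (metis in_keys_iff)
  then show ?thesis
    by (simp add: ext_def lookup_sum)
qed

lemma
  fixes N :: "('k, 'w::ab_group_add) smodule"
  assumes N: "graded N" and G: "gsym M e wscl (relmod N (psign e')) G"
    and nil: "\<And>vs. vs \<noteq> [] \<Longrightarrow> Poly_Mapping.lookup (G vs) [] = 0"
  shows qhom_of_cls: "Poly_Mapping.lookup x [] = 0 \<Longrightarrow>
      qhom_of e N e' G (cls M (psign e) x) = cls N (psign e') (ext wscl G x)"
    and qhom_of_mon: "vs \<noteq> [] \<Longrightarrow> qhom_of e N e' G (mon M (psign e) vs) = cls N (psign e') (G vs)"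
    and qhom_of_in_QHom: "qhom_of e N e' G \<in> QHom M (psign e) N (psign e')"
proof -
  interpret N: graded N by fact
  show *: "qhom_of e N e' G (cls M (psign e) x) = cls N (psign e') (ext wscl G x)"
    if "Poly_Mapping.lookup x [] = 0" for x
    using relmod_gsym[OF _ _ G rep_cls, of x] that
    by (simp add: qhom_of_def N.cls_eq_iff ext_diff)
  then show "vs \<noteq> [] \<Longrightarrow> qhom_of e N e' G (mon M (psign e) vs) = cls N (psign e') (G vs)"
    by (simp add: mon_def)
  show "qhom_of e N e' G \<in> QHom M (psign e) N (psign e')"
    unfolding QHom_def
    by (auto elim!: qpow_cases simp: cls_add qscl_cls * lookup_add ext_add ext_scale
        N.cls_add N.qscl_cls lookup_ext_Nil nil)
       (simp add: qhom_of_def)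
qed

text \<open>The empty word has no class in \<open>qpow\<close>. The default 0 there makes the
  unshuffle terms with an empty inner block vanish by multilinearity, in accordance with sums that
  start at block length 1.\<close>

definition vals :: "bit \<Rightarrow> (('k, 'v) qelem \<Rightarrow> 'x) \<Rightarrow> 'v list \<Rightarrow> 'x::zero" where
  "vals e f vs = (if vs = [] then 0 else f (mon M (psign e) vs))"

lemma vals_Nil [simp]: "vals e f [] = 0"
  by (simp add: vals_def)

lemma gsym_vals:
  assumes t: "module t" and f: "f \<in> Hom M (psign e) t"
  shows "gsym0 M e t (vals e f)"
proof -
  \<comment> \<open>\<open>f\<close> is linear only on classes without constant term. Subtracting
    the constant term first extends it to a linear map on all words, to which
    \<open>gsym_hom\<close> applies.\<close>
  let ?\<Phi> = "\<lambda>x. f (cls M (psign e) (x - Poly_Mapping.single [] (Poly_Mapping.lookup x [])))"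
  have add: "f (cls M (psign e) (x + y)) = f (cls M (psign e) x) + f (cls M (psign e) y)"
    if "Poly_Mapping.lookup x [] = 0" "Poly_Mapping.lookup y [] = 0" for x y
    using f that unfolding Hom_def by (simp flip: cls_add)
  have scale: "f (cls M (psign e) (wscl c x)) = t c (f (cls M (psign e) x))"
    if "Poly_Mapping.lookup x [] = 0" for c x
    using f that unfolding Hom_def by (simp flip: qscl_cls)
  have h: "module_hom wscl t ?\<Phi>"
  proof -
    have "?\<Phi> (x + y) = ?\<Phi> x + ?\<Phi> y" for x y
      by (subst add[symmetric]) (simp_all add: lookup_minus lookup_add single_add algebra_simps)
    moreover have "?\<Phi> (wscl c x) = t c (?\<Phi> x)" for c x
    proof -
      have "wscl c x - Poly_Mapping.single [] (Poly_Mapping.lookup (wscl c x) [])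
          = wscl c (x - Poly_Mapping.single [] (Poly_Mapping.lookup x []))"
        by (rule poly_mapping_eqI) (simp add: lookup_minus lookup_single when_def algebra_simps)
      then show ?thesis
        by (simp only:) (rule scale, simp add: lookup_minus)
    qed
    ultimately show ?thesis
      using t by (simp add: module_hom_iff)
  qed
  have zero: "f (cls M (psign e) 0) = 0"
    using scale[of 0 0] t by (simp add: module.scale_zero_left)
  have v: "?\<Phi> (wd w) = vals e f w" for w
    by (simp add: vals_def mon_def zero)
  have "?\<Phi> x \<in> {0}" if "x \<in> relmod M (psign e)" for x
  proof -
    have "cls M (psign e) x = cls M (psign e) 0"
      using that by (simp add: cls_eq_iff)
    then show ?thesis
      by (simp add: relmod_lookup_Nil[OF that] zero)
  qed
  from gsym_hom[OF h this] show "gsym0 M e t (vals e f)"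
    unfolding v .
qed

lemma vals_hom_of:
  assumes "module t" "gsym0 M e t F" "F [] = 0"
  shows "vals e (hom_of e t F) = F"
  using hom_of_mon[OF assms(1,2)] assms(3) by (auto simp: vals_def fun_eq_iff)

lemma
  assumes t: "module t"
  shows Hom_zero: "(\<lambda>_. 0) \<in> Hom M (psign e) t"
    and Hom_add: "f \<in> Hom M (psign e) t \<Longrightarrow> g \<in> Hom M (psign e) t \<Longrightarrow> (\<lambda>X. f X + g X) \<in> Hom M (psign e) t"
    and Hom_uminus: "f \<in> Hom M (psign e) t \<Longrightarrow> (\<lambda>X. - f X) \<in> Hom M (psign e) t"
    and Hom_diff: "f \<in> Hom M (psign e) t \<Longrightarrow> g \<in> Hom M (psign e) t \<Longrightarrow> (\<lambda>X. f X - g X) \<in> Hom M (psign e) t"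
    and Hom_sg: "f \<in> Hom M (psign e) t \<Longrightarrow> (\<lambda>X. sg a (f X)) \<in> Hom M (psign e) t"
proof -
  interpret t: module t by fact
  show "(\<lambda>_. 0) \<in> Hom M (psign e) t"
    by (simp add: Hom_def)
  show "f \<in> Hom M (psign e) t \<Longrightarrow> g \<in> Hom M (psign e) t \<Longrightarrow> (\<lambda>X. f X + g X) \<in> Hom M (psign e) t"
    by (simp add: Hom_def t.scale_right_distrib)
  show "f \<in> Hom M (psign e) t \<Longrightarrow> (\<lambda>X. - f X) \<in> Hom M (psign e) t"
    by (simp add: Hom_def)
  show "f \<in> Hom M (psign e) t \<Longrightarrow> g \<in> Hom M (psign e) t \<Longrightarrow> (\<lambda>X. f X - g X) \<in> Hom M (psign e) t"
    by (simp add: Hom_def t.scale_right_diff_distrib)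
  show "f \<in> Hom M (psign e) t \<Longrightarrow> (\<lambda>X. sg a (f X)) \<in> Hom M (psign e) t"
    by (simp add: Hom_def sg_add t.scale_sg)
qed

end

section \<open>Sums over unshuffles\<close>

definition unshuffles :: "nat \<Rightarrow> nat \<Rightarrow> (nat \<Rightarrow> nat) set" where
  "unshuffles k n = {\<sigma>. \<sigma> permutes {..<n} \<and> (\<forall>i. Suc i < n \<and> Suc i \<noteq> k \<longrightarrow> \<sigma> i < \<sigma> (Suc i))}"

lemma Sh_eq_unshuffles: "k \<le> n \<Longrightarrow> Sh k (n - k) = unshuffles k n"
  by (simp add: Sh_def unshuffles_def)

lemma finite_unshuffles [simp]: "finite (unshuffles k n)"
  using finite_permutations[of "{..<n}"] by (auto simp: unshuffles_def intro: finite_subset[rotated])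

definition plift :: "(nat \<Rightarrow> nat) \<Rightarrow> nat \<Rightarrow> nat" where
  "plift \<tau> i = (case i of 0 \<Rightarrow> 0 | Suc j \<Rightarrow> Suc (\<tau> j))"

text \<open>The cycle (0 1 ... k). In \<open>plift \<tau> \<circ> pcycle k\<close> it turns an
  arrangement \<tau> of the remaining letters into one of all letters, in which the first letter
  heads the second block.\<close>

definition pcycle :: "nat \<Rightarrow> nat \<Rightarrow> nat" where
  "pcycle k i = (if i < k then Suc i else if i = k then 0 else i)"

lemma plift_simps [simp]: "plift \<tau> 0 = 0" "plift \<tau> (Suc j) = Suc (\<tau> j)"
  by (simp_all add: plift_def)

lemma plift_inj: "plift \<tau> = plift \<tau>' \<Longrightarrow> \<tau> = \<tau>'"
  by (auto simp: fun_eq_iff plift_def split: nat.splits)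

lemma plift_eq_map_permutation:
  assumes "\<tau> permutes {..<n}"
  shows "plift \<tau> = map_permutation {..<n} Suc \<tau>"
proof
  fix i
  show "plift \<tau> i = map_permutation {..<n} Suc \<tau> i"
    using assms permutes_not_in[OF assms, of "i - 1"]
    by (cases i) (auto simp: map_permutation_def restrict_id_def inv_into_f_f
        image_iff plift_def)
qed

lemma plift_permutes: "\<tau> permutes {..<n} \<Longrightarrow> plift \<tau> permutes {..<Suc n}"
  by (simp add: plift_eq_map_permutation lessThan_Suc_eq_insert_0 del: lessThan_Suc)
    (meson inj_Suc map_permutation_permutes bij_betw_imageI inj_on_subset
      permutes_subset subset_UNIV subset_insertI)

lemma sign_plift: "\<tau> permutes {..<n} \<Longrightarrow> sign (plift \<tau>) = sign \<tau>"
  by (simp add: plift_eq_map_permutation sign_map_permutation)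

lemma pcycle_Suc: "pcycle (Suc k) = pcycle k \<circ> transpose k (Suc k)"
  by (auto simp: fun_eq_iff pcycle_def transpose_def)

lemma pcycle_permutes: "pcycle k permutes {..<Suc k}"
proof (induction k)
  case 0
  have "pcycle 0 = id" by (auto simp: fun_eq_iff pcycle_def)
  then show ?case by (simp only: permutes_id)
next
  case (Suc k)
  show ?case
    unfolding pcycle_Suc
    by (intro permutes_compose permutes_subset[OF Suc] permutes_swap_id) auto
qed

lemma sign_pcycle: "sign (pcycle k) = psign (of_nat k)"
proof (induction k)
  case 0
  have "pcycle 0 = id" by (auto simp: fun_eq_iff pcycle_def)
  then show ?case by (simp add: psign_def)
next
  case (Suc k)
  have "permutation (pcycle k)"
    using pcycle_permutes by (rule permutes_imp_permutation[rotated]) simp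
  then have "sign (pcycle (Suc k)) = sign (pcycle k) * sign (transpose k (Suc k))"
    unfolding pcycle_Suc by (intro sign_compose permutation_swap_id)
  then show ?case
    by (simp add: sign_swap_id Suc psign_add psign_simps)
qed

lemma pcycle_permutes': "k \<le> n \<Longrightarrow> pcycle k permutes {..<Suc n}"
  by (rule permutes_subset[OF pcycle_permutes]) auto

lemma fix_zero_plift:
  assumes \<rho>: "\<rho> permutes {..<Suc n}" and 0: "\<rho> 0 = 0"
  obtains \<tau> where "\<tau> permutes {..<n}" "\<rho> = plift \<tau>"
proof
  have pos: "\<rho> (Suc i) > 0" for i
    using 0 permutes_inj[OF \<rho>] by (metis gr0I inj_eq nat.distinct(1))
  then have S: "\<rho> (Suc i) = Suc (\<rho> (Suc i) - 1)" for i
    using Suc_pred' by metis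
  show "\<rho> = plift (\<lambda>i. \<rho> (Suc i) - 1)"
    using S 0 by (auto simp: fun_eq_iff plift_def split: nat.splits)
  show "(\<lambda>i. \<rho> (Suc i) - 1) permutes {..<n}"
  proof (rule bij_imp_permutes)
    show "\<rho> (Suc i) - 1 = i" if "i \<notin> {..<n}" for i
      using that permutes_not_in[OF \<rho>, of "Suc i"] by simp
    have inj: "inj_on (\<lambda>i. \<rho> (Suc i) - 1) {..<n}"
      using S permutes_inj[OF \<rho>] by (intro inj_onI) (metis Suc_inject inj_eq)
    moreover have "(\<lambda>i. \<rho> (Suc i) - 1) ` {..<n} \<subseteq> {..<n}"
    proof safe
      fix i assume "i < n"
      then have "\<rho> (Suc i) < Suc n"
        using permutes_in_image[OF \<rho>, of "Suc i"] by simp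
      with S[of i] show "\<rho> (Suc i) - 1 < n" by linarith
    qed
    ultimately show "bij_betw (\<lambda>i. \<rho> (Suc i) - 1) {..<n} {..<n}"
      by (simp add: bij_betw_def endo_inj_surj)
  qed
qed

lemma plift_pcycle: "i < k \<Longrightarrow> plift \<tau> (pcycle k i) = Suc (\<tau> i)"
  "plift \<tau> (pcycle k k) = 0"
  "k < i \<Longrightarrow> plift \<tau> (pcycle k i) = Suc (\<tau> (i - 1))"
  by (auto simp: pcycle_def plift_def split: nat.splits)

text \<open>Both blocks are increasing, so the smallest index heads one of them: it sits in slot 0
  or in slot \<open>k\<close>. Deleting it leaves an unshuffle of the other letters. For
  \<open>k = 0\<close> or \<open>k = Suc n\<close> one block is empty and only one case
  remains.\<close>

lemma unshuffles_Suc: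
  assumes "k \<le> Suc n"
  shows "unshuffles k (Suc n) =
    (if k = 0 then {} else plift ` unshuffles (k - 1) n) \<union>
    (if k = Suc n then {} else (\<lambda>\<tau>. plift \<tau> \<circ> pcycle k) ` unshuffles k n)" (is "_ = ?A \<union> ?B")
proof (intro equalityI subsetI)
  fix \<sigma> assume "\<sigma> \<in> ?A \<union> ?B"
  then consider \<tau> where "k > 0" "\<tau> \<in> unshuffles (k - 1) n" "\<sigma> = plift \<tau>"
    | \<tau> where "k \<le> n" "\<tau> \<in> unshuffles k n" "\<sigma> = plift \<tau> \<circ> pcycle k"
    using assms by (auto split: if_splits)
  then show "\<sigma> \<in> unshuffles k (Suc n)"
  proof cases
    case 1
    then show ?thesis
      by (auto simp: unshuffles_def plift_permutes plift_def split: nat.splits)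
  next
    case 2
    have "(plift \<tau> \<circ> pcycle k) i < (plift \<tau> \<circ> pcycle k) (Suc i)" if "Suc i < Suc n" "Suc i \<noteq> k" for i
    proof -
      from that(2) consider "Suc i < k" | "i = k" | "k < i" by linarith
      then show ?thesis
      proof cases
        case 3
        with 2 that show ?thesis
          by (cases i) (auto simp: unshuffles_def plift_pcycle)
      qed (use 2 that in \<open>auto simp: unshuffles_def plift_pcycle\<close>)
    qed
    moreover have "plift \<tau> \<circ> pcycle k permutes {..<Suc n}"
      using 2 by (intro permutes_compose pcycle_permutes' plift_permutes) (auto simp: unshuffles_def)
    ultimately show ?thesis
      using 2 by (simp add: unshuffles_def)
  qed
next
  fix \<sigma> assume \<sigma>: "\<sigma> \<in> unshuffles k (Suc n)"
  then have perm: "\<sigma> permutes {..<Suc n}"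
    and mono: "\<And>i. Suc i < Suc n \<Longrightarrow> Suc i \<noteq> k \<Longrightarrow> \<sigma> i < \<sigma> (Suc i)"
    by (auto simp: unshuffles_def)
  obtain m where m: "m < Suc n" "\<sigma> m = 0"
    using permutes_image[OF perm] by (metis (no_types, lifting) imageE lessThan_iff zero_less_Suc)
  \<comment> \<open>Otherwise slot m - 1 belongs to the same block as m and would have to hold an
    index below 0.\<close>
  have "m = 0 \<or> m = k"
    using mono[of "m - 1"] m by (cases m) auto
  then consider "m = 0" "k > 0" | "m = k" by auto
  then show "\<sigma> \<in> ?A \<union> ?B"
  proof cases
    case 1
    obtain \<tau> where \<tau>: "\<tau> permutes {..<n}" "\<sigma> = plift \<tau>"
      using fix_zero_plift[OF perm] m 1 by auto
    have "\<tau> i < \<tau> (Suc i)" if "Suc i < n" "Suc i \<noteq> k - 1" for i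
      using mono[of "Suc i"] that 1 by (auto simp: \<tau>)
    then have "\<tau> \<in> unshuffles (k - 1) n"
      using \<tau> by (simp add: unshuffles_def)
    with 1 \<tau> show ?thesis by auto
  next
    case 2
    then have k: "k \<le> n" using m by simp
    note pc = pcycle_permutes'[OF k]
    have "\<sigma> \<circ> inv (pcycle k) permutes {..<Suc n}"
      by (intro permutes_compose permutes_inv pc perm)
    moreover have "(\<sigma> \<circ> inv (pcycle k)) 0 = 0"
    proof -
      have "inv (pcycle k) 0 = k"
        using permutes_inv_eq[OF pc, of 0 k] by (simp add: pcycle_def)
      then show ?thesis using m 2 by simp
    qed
    ultimately obtain \<tau> where \<tau>: "\<tau> permutes {..<n}" "\<sigma> \<circ> inv (pcycle k) = plift \<tau>"
      using fix_zero_plift by blast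
    have eq: "\<sigma> = plift \<tau> \<circ> pcycle k"
      unfolding \<tau>(2)[symmetric] using permutes_inv_o(2)[OF pc] by (simp add: comp_assoc)
    have "\<tau> i < \<tau> (Suc i)" if "Suc i < n" "Suc i \<noteq> k" for i
    proof (cases "Suc i < k")
      case True
      then show ?thesis
        using mono[of i] that by (simp add: eq plift_pcycle)
    next
      case False
      then show ?thesis
        using mono[of "Suc i"] that by (simp add: eq plift_pcycle)
    qed
    then have "\<tau> \<in> unshuffles k n"
      using \<tau> by (simp add: unshuffles_def)
    with k eq show ?thesis by auto
  qed
qed

section \<open>Signs as sums over inversions\<close>

definition inversions :: "(nat \<Rightarrow> nat) \<Rightarrow> nat \<Rightarrow> (nat \<times> nat) set" where
  "inversions \<sigma> n = {(i, j). i < j \<and> j < n \<and> \<sigma> j < \<sigma> i}"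

lemma finite_inversions [simp]: "finite (inversions \<sigma> n)"
  by (rule finite_subset[of _ "{..<n} \<times> {..<n}"]) (auto simp: inversions_def)

text \<open>One exponent for three signs: \<open>c\<close> is the product for the Koszul sign, the
  constant 1 for the sign of the permutation, and \<open>1 + a * b\<close> for their product, the
  sign of the exterior algebra. The first argument of \<open>c\<close> is the parity of the letter
  that came first originally.\<close>

definition invsum :: "(bit \<Rightarrow> bit \<Rightarrow> bit) \<Rightarrow> (nat \<Rightarrow> nat) \<Rightarrow> bit list \<Rightarrow> bit" where
  "invsum c \<sigma> ps = (\<Sum>(i, j)\<in>inversions \<sigma> (length ps). c (ps ! \<sigma> j) (ps ! \<sigma> i))"

lemma psign_sum: "psign (sum f A) = (\<Prod>x\<in>A. psign (f x))"
  by (induction A rule: infinite_finite_induct) (simp_all add: psign_add psign_simps)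

lemma koszul_eq_psign: "koszul \<sigma> ps = psign (invsum (*) \<sigma> ps)"
  by (simp add: koszul_def invsum_def psign_sum inversions_def case_prod_unfold mult.commute)

lemma invsum_plift:
  assumes "length ps = n"
  shows "invsum c (plift \<tau>) (p # ps) = invsum c \<tau> ps"
proof -
  have "inversions (plift \<tau>) (Suc n) = map_prod Suc Suc ` inversions \<tau> n"
  proof (intro equalityI subsetI)
    fix x assume "x \<in> inversions (plift \<tau>) (Suc n)"
    then obtain i j where x: "x = (i, j)" "i < j" "j < Suc n" "plift \<tau> j < plift \<tau> i"
      by (auto simp: inversions_def)
    then obtain i' j' where ij: "i = Suc i'" "j = Suc j'"
      by (cases i; cases j) auto
    with x have "(i', j') \<in> inversions \<tau> n"
      by (simp add: inversions_def)
    then have "map_prod Suc Suc (i', j') \<in> map_prod Suc Suc ` inversions \<tau> n"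
      by (rule imageI)
    then show "x \<in> map_prod Suc Suc ` inversions \<tau> n"
      by (simp add: x(1) ij)
  qed (auto simp: inversions_def)
  moreover have "inj_on (map_prod Suc Suc) (inversions \<tau> n)"
    by (auto intro!: inj_onI)
  ultimately show ?thesis
    using assms by (simp add: invsum_def sum.reindex case_prod_unfold)
qed

text \<open>Besides the inversions of \<tau>, renumbered around slot \<open>k\<close>, the only new
  ones are between the first letter and the \<open>k\<close> letters it was moved behind.\<close>

lemma invsum_pcycle:
  assumes n: "length ps = n" "k \<le> n"
  shows "invsum c (plift \<tau> \<circ> pcycle k) (p # ps) = (\<Sum>i<k. c p (ps ! \<tau> i)) + invsum c \<tau> ps"
proof -
  let ?s = "\<lambda>i. if i < k then i else Suc i"
  have s: "(plift \<tau> \<circ> pcycle k) (?s i) = Suc (\<tau> i)" for i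
    by (simp add: plift_pcycle)
  have split: "inversions (plift \<tau> \<circ> pcycle k) (Suc n)
      = (\<lambda>i. (i, k)) ` {..<k} \<union> map_prod ?s ?s ` inversions \<tau> n" (is "?I = ?P \<union> ?Q")
  proof (intro equalityI subsetI)
    fix x assume "x \<in> ?I"
    then obtain i j where x: "x = (i, j)" "i < j" "j < Suc n"
      "(plift \<tau> \<circ> pcycle k) j < (plift \<tau> \<circ> pcycle k) i"
      by (auto simp: inversions_def)
    show "x \<in> ?P \<union> ?Q"
    proof (cases "j = k")
      case True
      with x show ?thesis by auto
    next
      case False
      have "i \<noteq> k"
        using x plift_pcycle(2)[of \<tau> k] by auto
      define i' j' where "i' = (if i < k then i else i - 1)" "j' = (if j < k then j else j - 1)"
      have ij: "?s i' = i" "?s j' = j"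
        using \<open>i \<noteq> k\<close> False by (auto simp: i'_j'_def)
      have "i' < j'" "j' < n"
        using x \<open>i \<noteq> k\<close> False n(2) by (auto simp: i'_j'_def split: if_splits)
      moreover have "\<tau> j' < \<tau> i'"
        using x(4) s[of i'] s[of j'] by (simp add: ij)
      ultimately have "(i', j') \<in> inversions \<tau> n"
        by (simp add: inversions_def)
      then have "map_prod ?s ?s (i', j') \<in> ?Q" by (rule imageI)
      then show ?thesis
        using x(1) ij by simp
    qed
  next
    fix x assume "x \<in> ?P \<union> ?Q"
    then consider i where "x = (i, k)" "i < k"
      | i j where "x = (?s i, ?s j)" "i < j" "j < n" "\<tau> j < \<tau> i"
      by (auto simp: inversions_def)
    then show "x \<in> ?I"
    proof cases
      case 1
      then show ?thesis using n(2) by (simp add: inversions_def plift_pcycle)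
    next
      case 2
      then have "?s i < ?s j" "?s j < Suc n" by (auto split: if_splits)
      with 2(4) show ?thesis
        unfolding 2(1) inversions_def using s[of i] s[of j] by simp
    qed
  qed
  have sm: "strict_mono ?s"
    by (rule strict_monoI) (auto split: if_splits)
  have inj: "inj_on (map_prod ?s ?s) (inversions \<tau> n)"
    by (intro inj_on_subset[OF map_prod_inj_on[of ?s UNIV ?s UNIV]] strict_mono_imp_inj_on[OF sm]) auto
  have disj: "?P \<inter> ?Q = {}"
    by (auto split: if_splits)
  let ?f = "\<lambda>(i, j). c ((p # ps) ! (plift \<tau> \<circ> pcycle k) j) ((p # ps) ! (plift \<tau> \<circ> pcycle k) i)"
  have "invsum c (plift \<tau> \<circ> pcycle k) (p # ps) = sum ?f ?P + sum ?f ?Q"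
    unfolding invsum_def using n(1) split disj
    by (simp add: sum.union_disjoint)
  also have "sum ?f ?P = (\<Sum>i<k. c p (ps ! \<tau> i))"
    by (subst sum.reindex) (auto simp: inj_on_def plift_pcycle)
  also have "sum ?f ?Q = (\<Sum>(i, j)\<in>inversions \<tau> n. c (ps ! \<tau> j) (ps ! \<tau> i))"
    unfolding sum.reindex[OF inj]
  proof (rule sum.cong)
    fix x assume "x \<in> inversions \<tau> n"
    show "(?f \<circ> map_prod ?s ?s) x = (case x of (i, j) \<Rightarrow> c (ps ! \<tau> j) (ps ! \<tau> i))"
      using s[of "fst x"] s[of "snd x"] by (simp add: case_prod_unfold)
  qed simp
  finally show ?thesis
    using n(1) by (simp only: invsum_def)
qed

text \<open>The recursion on unshuffles applies to both sides: the k new inversions account for the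
  sign (-1)^k of the cycle.\<close>

lemma sign_unshuffle: "\<lbrakk>\<sigma> \<in> unshuffles k n; k \<le> n; length ps = n\<rbrakk> \<Longrightarrow> sign \<sigma> = psign (invsum (\<lambda>_ _. 1) \<sigma> ps)"
proof (induction n arbitrary: \<sigma> k ps)
  case 0
  then have "\<sigma> = id" by (simp add: unshuffles_def)
  with 0 show ?case by (simp add: invsum_def inversions_def psign_simps)
next
  case (Suc n)
  obtain p qs where ps: "ps = p # qs" "length qs = n"
    using Suc.prems(3) by (cases ps) auto
  consider \<tau> where "k > 0" "\<tau> \<in> unshuffles (k - 1) n" "\<sigma> = plift \<tau>"
    | \<tau> where "k \<le> n" "\<tau> \<in> unshuffles k n" "\<sigma> = plift \<tau> \<circ> pcycle k"
    using Suc.prems(1,2) unfolding unshuffles_Suc[OF Suc.prems(2)] by (auto split: if_splits)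
  then show ?case
  proof cases
    case 1
    then have "sign \<tau> = psign (invsum (\<lambda>_ _. 1) \<tau> qs)"
      using Suc.IH[of \<tau> "k - 1" qs] Suc.prems ps by simp
    then show ?thesis
      using 1 ps sign_plift[of \<tau> n] by (simp add: unshuffles_def invsum_plift)
  next
    case 2
    have "permutation (plift \<tau>)" "permutation (pcycle k)"
      using 2 plift_permutes[of \<tau> n] pcycle_permutes[of k]
      by (auto simp: unshuffles_def intro: permutes_imp_permutation[rotated])
    then have "sign \<sigma> = psign (of_nat k) * sign \<tau>"
      using 2 sign_plift[of \<tau> n] by (simp add: sign_compose sign_pcycle unshuffles_def)
    moreover have "invsum (\<lambda>_ _. 1) \<sigma> ps = of_nat k + invsum (\<lambda>_ _. 1) \<tau> qs"
      unfolding 2(3) ps(1) invsum_pcycle[OF ps(2) 2(1)] by simp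
    ultimately show ?thesis
      using Suc.IH[OF 2(2,1) ps(2)] by (simp add: psign_add)
  qed
qed

lemma invsum_add: "invsum (\<lambda>a b. c a b + c' a b) \<sigma> ps = invsum c \<sigma> ps + invsum c' \<sigma> ps"
  by (simp add: invsum_def case_prod_unfold sum.distrib)

lemma sign_koszul:
  assumes "\<sigma> \<in> unshuffles k n" "k \<le> n" "length ps = n"
  shows "sign \<sigma> * koszul \<sigma> ps = psign (invsum (\<lambda>a b. 1 + a * b) \<sigma> ps)"
  using sign_unshuffle[OF assms] by (simp add: koszul_eq_psign invsum_add psign_add)

text \<open>
  The sum over all unshuffles of \<open>xs\<close> into two blocks, by recursion on whether the first entry goes
  to the first block or has to be moved behind it.
\<close>

fun shuffle_sum :: "(bit \<Rightarrow> bit \<Rightarrow> bit) \<Rightarrow> (bit \<times> 'v) list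
    \<Rightarrow> ((bit \<times> 'v) list \<Rightarrow> (bit \<times> 'v) list \<Rightarrow> 'x::ab_group_add) \<Rightarrow> 'x" where
  "shuffle_sum c [] F = F [] []"
| "shuffle_sum c (x # xs) F = shuffle_sum c xs (\<lambda>A B. F (x # A) B)
     + shuffle_sum c xs (\<lambda>A B. sg (\<Sum>a\<leftarrow>A. c (fst x) (fst a)) (F A (x # B)))"

lemma permute_list_plift: "permute_list (plift \<tau>) (x # xs) = x # permute_list \<tau> xs"
  by (auto simp: permute_list_def upt_conv_Cons map_Suc_upt[symmetric] simp del: upt_Suc)

lemma permute_list_pcycle:
  assumes "k \<le> length xs"
  shows "permute_list (plift \<tau> \<circ> pcycle k) (x # xs)
    = take k (permute_list \<tau> xs) @ x # drop k (permute_list \<tau> xs)"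
proof (rule nth_equalityI)
  fix i assume i: "i < length (permute_list (plift \<tau> \<circ> pcycle k) (x # xs))"
  consider "i < k" | "i = k" | "k < i" by linarith
  then show "permute_list (plift \<tau> \<circ> pcycle k) (x # xs) ! i
      = (take k (permute_list \<tau> xs) @ x # drop k (permute_list \<tau> xs)) ! i"
  proof cases
    case 1
    then show ?thesis
      using i assms by (simp add: permute_list_def nth_append plift_pcycle del: upt_Suc)
  next
    case 2
    then show ?thesis
      using i assms by (simp add: permute_list_def nth_append plift_pcycle del: upt_Suc)
  next
    case 3
    then have "i - k = Suc (i - Suc k)" "k + (i - Suc k) = i - 1" by auto
    then show ?thesis
      using i assms 3 by (simp add: permute_list_def nth_append plift_pcycle del: upt_Suc)
  qed
qed (use assms in simp)

text \<open>The two families in \<open>unshuffles_Suc\<close> become the two summands of the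
  recursion, and the exponent gained in \<open>invsum_pcycle\<close> is the sign paid for moving the
  first letter behind the first block.\<close>

lemma sum_unshuffles:
  "(\<Sum>k\<le>length xs. \<Sum>\<sigma>\<in>unshuffles k (length xs). sg (invsum c \<sigma> (map fst xs))
      (F (take k (permute_list \<sigma> xs)) (drop k (permute_list \<sigma> xs)))) = shuffle_sum c xs F"
proof (induction xs arbitrary: F)
  case Nil
  have "unshuffles 0 0 = {id}" by (auto simp: unshuffles_def)
  then show ?case by (simp add: invsum_def inversions_def)
next
  case (Cons x xs)
  let ?n = "length xs"
  let ?T = "\<lambda>k xs F. \<Sum>\<sigma>\<in>unshuffles k (length xs). sg (invsum c \<sigma> (map fst xs))
      (F (take k (permute_list \<sigma> xs)) (drop k (permute_list \<sigma> xs)))"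
  let ?F1 = "\<lambda>A B. F (x # A) B" and ?F2 = "\<lambda>A B. sg (\<Sum>a\<leftarrow>A. c (fst x) (fst a)) (F A (x # B))"
  have T: "?T k (x # xs) F = (if k = 0 then 0 else ?T (k - 1) xs ?F1) + (if k = Suc ?n then 0 else ?T k xs ?F2)"
    if k: "k \<le> Suc ?n" for k
  proof -
    let ?A = "if k = 0 then {} else plift ` unshuffles (k - 1) ?n"
    let ?B = "if k = Suc ?n then {} else (\<lambda>\<tau>. plift \<tau> \<circ> pcycle k) ` unshuffles k ?n"
    let ?f = "\<lambda>\<sigma>. sg (invsum c \<sigma> (map fst (x # xs)))
      (F (take k (permute_list \<sigma> (x # xs))) (drop k (permute_list \<sigma> (x # xs))))"
    have "?A \<inter> ?B = {}"
    proof -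
      \<comment> \<open>The families are told apart by slot 0: it holds the first letter in one of
        them and a later letter in the other.\<close>
      have "plift \<tau> \<noteq> plift \<tau>' \<circ> pcycle k" if "k \<noteq> 0" for \<tau> \<tau>'
      proof
        assume "plift \<tau> = plift \<tau>' \<circ> pcycle k"
        from fun_cong[OF this, of 0] that show False
          by (simp add: plift_pcycle)
      qed
      then show ?thesis by auto
    qed
    then have "?T k (x # xs) F = sum ?f ?A + sum ?f ?B"
      using unshuffles_Suc[OF k] by (simp add: sum.union_disjoint)
    also have "sum ?f ?A = (if k = 0 then 0 else ?T (k - 1) xs ?F1)"
    proof (cases "k = 0")
      case False
      have "sum ?f (plift ` unshuffles (k - 1) ?n) = (\<Sum>\<tau>\<in>unshuffles (k - 1) ?n. ?f (plift \<tau>))"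
        by (subst sum.reindex) (auto intro!: inj_onI plift_inj)
      also have "\<dots> = ?T (k - 1) xs ?F1"
        using False by (simp add: permute_list_plift invsum_plift take_Cons' drop_Cons')
      finally show ?thesis using False by simp
    qed simp
    also have "sum ?f ?B = (if k = Suc ?n then 0 else ?T k xs ?F2)"
    proof (cases "k = Suc ?n")
      case False
      with k have k: "k \<le> ?n" by simp
      have inj: "inj_on (\<lambda>\<tau>. plift \<tau> \<circ> pcycle k) (unshuffles k ?n)"
      proof (rule inj_onI)
        fix \<tau> \<tau>' assume "plift \<tau> \<circ> pcycle k = plift \<tau>' \<circ> pcycle k"
        then have "plift \<tau> = plift \<tau>'"
          using permutes_surj[OF pcycle_permutes, of k] by (metis surj_fun_eq image_cong_simp)
        then show "\<tau> = \<tau>'" by (rule plift_inj)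
      qed
      have "?f (plift \<tau> \<circ> pcycle k) = sg (invsum c \<tau> (map fst xs))
          (?F2 (take k (permute_list \<tau> xs)) (drop k (permute_list \<tau> xs)))"
        if "\<tau> \<in> unshuffles k ?n" for \<tau>
      proof -
        let ?ys = "permute_list \<tau> xs"
        have "(\<Sum>i<k. c (fst x) (map fst xs ! \<tau> i)) = (\<Sum>i<k. c (fst x) (fst (take k ?ys ! i)))"
        proof (rule sum.cong)
          fix i assume "i \<in> {..<k}"
          moreover from this have "\<tau> i < length xs"
            using \<open>\<tau> \<in> _\<close> k permutes_in_image[of \<tau> "{..<length xs}" i]
            by (simp add: unshuffles_def)
          ultimately show "c (fst x) (map fst xs ! \<tau> i) = c (fst x) (fst (take k ?ys ! i))"
            using k by (simp add: permute_list_def)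
        qed simp
        also have "\<dots> = (\<Sum>a\<leftarrow>take k ?ys. c (fst x) (fst a))"
          using k by (simp add: sum_list_sum_nth atLeast0LessThan min.absorb2)
        finally have "invsum c (plift \<tau> \<circ> pcycle k) (map fst (x # xs))
            = (\<Sum>a\<leftarrow>take k ?ys. c (fst x) (fst a)) + invsum c \<tau> (map fst xs)"
          using invsum_pcycle[of "map fst xs" ?n k c \<tau> "fst x"] k by (simp only: list.map length_map)
        moreover have "take k (take k ?ys @ x # drop k ?ys) = take k ?ys"
          "drop k (take k ?ys @ x # drop k ?ys) = x # drop k ?ys"
          using k by simp_all
        ultimately show ?thesis
          by (simp only: permute_list_pcycle[OF k] sg_sg add.commute)
      qed
      then have "(\<Sum>\<tau>\<in>unshuffles k ?n. ?f (plift \<tau> \<circ> pcycle k)) = ?T k xs ?F2"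
        by (rule sum.cong[OF refl])
      then show ?thesis
        using False by (simp only: sum.reindex[OF inj] comp_def[of ?f] if_False)
    qed simp
    finally show ?thesis .
  qed
  have "(\<Sum>k\<le>length (x # xs). ?T k (x # xs) F)
    = (\<Sum>k\<le>Suc ?n. (if k = 0 then 0 else ?T (k - 1) xs ?F1) + (if k = Suc ?n then 0 else ?T k xs ?F2))"
    by (rule sum.cong) (use T in auto)
  also have "\<dots> = (\<Sum>k\<le>Suc ?n. if k = 0 then 0 else ?T (k - 1) xs ?F1)
      + (\<Sum>k\<le>Suc ?n. if k = Suc ?n then 0 else ?T k xs ?F2)"
    by (rule sum.distrib)
  also have "(\<Sum>k\<le>Suc ?n. if k = 0 then 0 else ?T (k - 1) xs ?F1) = (\<Sum>k\<le>?n. ?T k xs ?F1)"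
    by (subst sum.atMost_Suc_shift) simp
  also have "(\<Sum>k\<le>Suc ?n. if k = Suc ?n then 0 else ?T k xs ?F2) = (\<Sum>k\<le>?n. ?T k xs ?F2)"
    by (simp add: sum.neutral)
  finally show ?case
    by (simp only: Cons.IH[of ?F1] Cons.IH[of ?F2] shuffle_sum.simps)
qed

lemma shuffle_sum_cong_mod:
  assumes t: "module t" "module.subspace t N"
    and "\<And>A B. set A \<union> set B \<subseteq> set xs \<Longrightarrow> length A + length B = length xs \<Longrightarrow> F A B - G A B \<in> N"
  shows "shuffle_sum c xs F - shuffle_sum c xs G \<in> N"
  using assms(3)
proof (induction xs arbitrary: F G)
  case (Cons x xs)
  interpret module t by fact
  have *: "(a + a') - (b + b') \<in> N" if "a - b \<in> N" "a' - b' \<in> N" for a a' b b'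
    using subspace_add[OF t(2) that] by (simp add: algebra_simps)
  show ?case
    unfolding shuffle_sum.simps
  proof (intro * Cons.IH)
    fix A B assume "set A \<union> set B \<subseteq> set xs" "length A + length B = length xs"
    then show "F (x # A) B - G (x # A) B \<in> N"
      by (intro Cons.prems) auto
    have "F A (x # B) - G A (x # B) \<in> N"
      using \<open>set A \<union> set B \<subseteq> set xs\<close> \<open>length A + length B = length xs\<close> by (intro Cons.prems) auto
    then show "sg (\<Sum>a\<leftarrow>A. c (fst x) (fst a)) (F A (x # B)) - sg (\<Sum>a\<leftarrow>A. c (fst x) (fst a)) (G A (x # B)) \<in> N"
      unfolding sg_diff[symmetric] by (rule subspace_sg[OF t(2)])
  qed
qed simp

lemma shuffle_sum_cong:
  assumes "\<And>A B. set A \<union> set B \<subseteq> set xs \<Longrightarrow> length A + length B = length xs \<Longrightarrow> F A B = G A B"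
  shows "shuffle_sum c xs F = shuffle_sum c xs G"
  using assms
proof (induction xs arbitrary: F G)
  case (Cons x xs)
  show ?case
    unfolding shuffle_sum.simps
    by (intro arg_cong2[where f = "(+)"] Cons.IH arg_cong[where f = "sg _"] Cons.prems) auto
qed simp

lemma shuffle_sum_add: "shuffle_sum c xs (\<lambda>A B. F A B + G A B) = shuffle_sum c xs F + shuffle_sum c xs G"
  by (induction xs arbitrary: F G) (simp_all add: sg_add)

lemma shuffle_sum_sg: "shuffle_sum c xs (\<lambda>A B. sg a (F A B)) = sg a (shuffle_sum c xs F)"
proof (induction xs arbitrary: F)
  case (Cons x xs)
  have "shuffle_sum c xs (\<lambda>A B. sg ((\<Sum>a\<leftarrow>A. c (fst x) (fst a)) + a) (F A (x # B)))
      = sg a (shuffle_sum c xs (\<lambda>A B. sg (\<Sum>a\<leftarrow>A. c (fst x) (fst a)) (F A (x # B))))"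
    by (simp add: add.commute flip: Cons.IH)
  then show ?case by (simp add: Cons.IH sg_add)
qed simp

lemma shuffle_sum_zero [simp]: "shuffle_sum c xs (\<lambda>A B. 0) = 0"
  by (induction xs) simp_all

text \<open>
  Shifting all parities changes the Koszul signs of the exterior algebra into those of the symmetric
  algebra, up to the signs \<open>(-1)\<^bsup>(n-1)|v\<^sub>1| + \<cdots> + |v\<^bsub>n-1\<^esub>|\<^esup>\<close> of the arguments.
\<close>

fun etasign :: "bit list \<Rightarrow> bit" where
  "etasign [] = 0"
| "etasign (p # ps) = of_nat (length ps) * p + etasign ps"

lemma etasign_append: "etasign (ps @ qs) = etasign ps + etasign qs + of_nat (length qs) * sum_list ps"
  by (induction ps) (simp_all add: algebra_simps)

lemma etasign_eq: "etasign ps = (\<Sum>i<length ps. of_nat (length ps - 1 - i) * ps ! i)"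
  by (induction ps) (simp_all add: sum.lessThan_Suc_shift del: sum.lessThan_Suc)

lemma shuffle_sum_shift:
  fixes xs :: "(bit \<times> 'b) list"
  shows "shuffle_sum (\<lambda>a b. 1 + a * b) xs F = sg (etasign (map fst xs))
     (shuffle_sum (\<lambda>a b. (a + 1) * (b + 1)) xs (\<lambda>A B. sg (etasign (map fst (A @ B))) (F A B)))"
proof (induction xs arbitrary: F)
  case (Cons x xs)
  obtain p v where x: "x = (p, v)" by force
  let ?n = "of_nat (length xs) :: bit" and ?S = "shuffle_sum (\<lambda>a b. (a + 1) * (b + 1)) xs"
  have len: "of_nat (length A) + of_nat (length B) = ?n"
    if "length A + length B = length xs" for A B :: "(bit \<times> 'b) list"
    using that by (metis of_nat_add)
  have 1: "?S (\<lambda>A B. sg (etasign (map fst (A @ B))) (F (x # A) B))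
      = ?S (\<lambda>A B. sg (?n * p) (sg (etasign (map fst ((x # A) @ B))) (F (x # A) B)))"
    by (rule shuffle_sum_cong) (simp add: x len algebra_simps)
  \<comment> \<open>Let x have parity p, and let s be the sum of the parities in A. Passing to
    shifted parities changes the exponent for moving x behind A by p|A| + s, and inserting x between
    A and B changes \<open>etasign\<close> by p|B| + s. Together this is p times the number of
    remaining letters, independently of the splitting.\<close>
  have 2: "?S (\<lambda>A B. sg (etasign (map fst (A @ B))) (sg (\<Sum>a\<leftarrow>A. 1 + fst x * fst a) (F A (x # B))))
      = ?S (\<lambda>A B. sg (?n * p) (sg (\<Sum>a\<leftarrow>A. (fst x + 1) * (fst a + 1)) (sg (etasign (map fst (A @ x # B))) (F A (x # B)))))"
  proof (rule shuffle_sum_cong)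
    fix A B :: "(bit \<times> 'b) list" assume "length A + length B = length xs"
    note n = len[OF this]
    have s1: "(\<Sum>a\<leftarrow>A. 1 + fst x * fst a) = of_nat (length A) + fst x * sum_list (map fst A)"
      by (induction A) (simp_all add: algebra_simps)
    have s2: "(\<Sum>a\<leftarrow>A. (fst x + 1) * (fst a + 1)) = (fst x + 1) * (of_nat (length A) + sum_list (map fst A))"
      by (induction A) (simp_all add: algebra_simps)
    show "sg (etasign (map fst (A @ B))) (sg (\<Sum>a\<leftarrow>A. 1 + fst x * fst a) (F A (x # B)))
      = sg (?n * p) (sg (\<Sum>a\<leftarrow>A. (fst x + 1) * (fst a + 1)) (sg (etasign (map fst (A @ x # B))) (F A (x # B))))"
      unfolding s1 s2 n[symmetric]
      by (simp add: etasign_append x algebra_simps)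
  qed
  have 3: "etasign (map fst (x # xs)) = ?n * p + etasign (map fst xs)"
    by (simp add: x)
  let ?e = "etasign (map fst xs)"
  have "shuffle_sum (\<lambda>a b. 1 + a * b) (x # xs) F
      = sg ?e (?S (\<lambda>A B. sg (etasign (map fst (A @ B))) (F (x # A) B)))
        + sg ?e (?S (\<lambda>A B. sg (etasign (map fst (A @ B))) (sg (\<Sum>a\<leftarrow>A. 1 + fst x * fst a) (F A (x # B)))))"
    unfolding shuffle_sum.simps Cons.IH ..
  also have "\<dots> = sg ?e (sg (?n * p) (?S (\<lambda>A B. sg (etasign (map fst ((x # A) @ B))) (F (x # A) B))))
      + sg ?e (sg (?n * p) (?S (\<lambda>A B. sg (\<Sum>a\<leftarrow>A. (fst x + 1) * (fst a + 1))
          (sg (etasign (map fst (A @ x # B))) (F A (x # B))))))"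
    unfolding 1 2 shuffle_sum_sg ..
  also have "\<dots> = sg (etasign (map fst (x # xs)))
     (shuffle_sum (\<lambda>a b. (a + 1) * (b + 1)) (x # xs) (\<lambda>A B. sg (etasign (map fst (A @ B))) (F A B)))"
    unfolding 3 shuffle_sum.simps sg_add sg_sg by (simp only: add.commute)
  finally show ?case .
qed simp

section \<open>Coderivations on words\<close>

lemma ext_cong_mod:
  assumes t: "module t" "module.subspace t N" and "\<And>w. F w - G w \<in> N"
  shows "ext t F x - ext t G x \<in> N"
proof -
  interpret module t by fact
  have "ext t F x - ext t G x = (\<Sum>w\<in>Poly_Mapping.keys x. t (Poly_Mapping.lookup x w) (F w - G w))"
    by (simp add: ext_def scale_right_diff_distrib sum_subtractf)
  also have "\<dots> \<in> N"
    by (intro subspace_sum subspace_scale t(2) assms(3))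
  finally show ?thesis .
qed

lemma sg_one_add: "sg (1 + a) x = - sg a x"
  by (cases a) simp_all

definition pre :: "'v \<Rightarrow> ('k::comm_ring_1, 'v) words \<Rightarrow> ('k, 'v) words" where
  "pre v = ext wscl (\<lambda>w. wd (v # w))"

lemma pre_simps: "pre v (x + y) = pre v x + pre v y" "pre v (x - y) = pre v x - pre v y"
  "pre v (sg a x) = sg a (pre v x)" "pre v (wscl c x) = wscl c (pre v x)" "pre v 0 = 0"
  by (simp_all add: pre_def ext_add ext_diff ext_sg ext_scale)

lemma pre_wd [simp]: "pre v (wd w) = wd (v # w)"
  by (simp add: pre_def)

lemma ext_pre: "module t \<Longrightarrow> ext t F (pre v x) = ext t (\<lambda>w. F (v # w)) x"
  by (simp add: pre_def ext_ext)

lemma pre_ext: "pre v (ext wscl F x) = ext wscl (\<lambda>w. pre v (F w)) x"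
  by (simp add: pre_def ext_ext)

lemma lookup_pre_Nil: "Poly_Mapping.lookup (pre v x) [] = 0"
  by (simp add: pre_def ext_def lookup_sum lookup_single)

context graded
begin

section \<open>Congruence of words in the symmetric algebra\<close>

definition eqv :: "('k, 'v) words \<Rightarrow> ('k, 'v) words \<Rightarrow> bool" (infix \<open>\<doteq>\<close> 50) where
  "x \<doteq> y \<longleftrightarrow> x - y \<in> relmod M (psign 0)"

lemma eqv_refl [intro, simp]: "x \<doteq> x"
  by (simp add: eqv_def)

lemma eqv_trans [trans]: "x \<doteq> y \<Longrightarrow> y \<doteq> z \<Longrightarrow> x \<doteq> z"
  using words.subspace_add[OF subspace_relmod, of "x - y" "psign 0" "y - z"] by (simp add: eqv_def)

lemma eqv_add: "x \<doteq> y \<Longrightarrow> x' \<doteq> y' \<Longrightarrow> x + x' \<doteq> y + y'"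
  using words.subspace_add[OF subspace_relmod, of "x - y" "psign 0" "x' - y'"]
  by (simp add: eqv_def algebra_simps)

lemma eqv_diff: "x \<doteq> y \<Longrightarrow> x' \<doteq> y' \<Longrightarrow> x - x' \<doteq> y - y'"
  using words.subspace_diff[OF subspace_relmod, of "x - y" "psign 0" "x' - y'"]
  by (simp add: eqv_def algebra_simps)

lemma eqv_sym: "x \<doteq> y \<Longrightarrow> y \<doteq> x"
  using words.subspace_neg[OF subspace_relmod, of "x - y" "psign 0"] by (simp add: eqv_def)

lemma eqv_sg: "x \<doteq> y \<Longrightarrow> sg a x \<doteq> sg a y"
  unfolding eqv_def sg_diff[symmetric] by (rule words.subspace_sg[OF subspace_relmod])

lemma cls_eqv: "cls M (psign 0) x = cls M (psign 0) y \<longleftrightarrow> x \<doteq> y"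
  by (simp add: eqv_def cls_eq_iff)

lemma eqv_ext_fun: "(\<And>w. F w \<doteq> G w) \<Longrightarrow> ext wscl F x \<doteq> ext wscl G x"
  unfolding eqv_def by (rule ext_cong_mod) auto

lemma gsym_wd: "gsym M 0 wscl (relmod M (psign 0)) wd"
  by (rule gsym_hom[of wscl "\<lambda>x. x" M 0]) (simp_all add: words.module_hom_ident)

lemma eqv_pre: "x \<doteq> y \<Longrightarrow> pre v x \<doteq> pre v y"
  unfolding eqv_def pre_def
  by (rule gsym_ext_words[OF _ _ gsym_shift[OF gsym_wd]]) auto

lemma wd_add: "wd ((a + b) # w) \<doteq> wd (a # w) + wd (b # w)"
  using gsym_addD[OF gsym_wd, of "[]" a b w] by (simp add: eqv_def diff_diff_eq)

lemma pre_add: "pre (a + b) x \<doteq> pre a x + pre b x"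
  unfolding pre_def ext_add_fun[OF module_wscl, symmetric] by (rule eqv_ext_fun) (rule wd_add)

lemma wd_scale: "wd (scl M c a # w) \<doteq> wscl c (wd (a # w))"
  using gsym_scaleD[OF gsym_wd, of "[]" c a w] by (simp add: eqv_def)

lemma pre_scale: "pre (scl M c a) x \<doteq> wscl c (pre a x)"
  unfolding pre_def ext_scale_fun[OF module_wscl, symmetric] by (rule eqv_ext_fun) (rule wd_scale)

lemma pre_sg: "pre (sg b a) x \<doteq> sg b (pre a x)"
  using pre_scale[of "of_int (psign b)" a x] by (simp add: module_psign V.module_axioms)

lemma pre_zero: "pre 0 x \<doteq> 0"
  using pre_scale[of 0 0 x] by simp

lemma pre_swap:
  assumes "x \<in> deg M p" "y \<in> deg M q"
  shows "pre x (pre y z) \<doteq> sg (p * q) (pre y (pre x z))"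
proof -
  have "wd (x # y # w) \<doteq> sg (p * q) (wd (y # x # w))" for w
    using gsym_swapD[OF gsym_wd assms, of "[]" w] by (simp add: eqv_def)
  then show ?thesis
    by (simp add: pre_def ext_ext flip: ext_sg_fun) (rule eqv_ext_fun)
qed

text \<open>The sign (-1)^(a|v|) for moving a map of parity \<open>a\<close> past v, extended
  linearly to inhomogeneous v.\<close>

definition twist :: "bit \<Rightarrow> 'v \<Rightarrow> 'v" where
  "twist a v = hproj M 0 v + sg a (hproj M 1 v)"

lemma twist_homogeneous: "v \<in> deg M p \<Longrightarrow> twist a v = sg (a * p) v"
  by (cases p) (simp_all add: twist_def hproj_homogeneous)

lemma twist_add: "twist a (v + w) = twist a v + twist a w"
  by (simp add: twist_def hproj_add sg_add)

lemma twist_scale: "twist a (scl M c v) = scl M c (twist a v)"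
  by (simp add: twist_def hproj_scale V.scale_sg V.scale_right_distrib)

text \<open>
  The coderivation with corestriction \<open>\<delta>\<close> of parity \<open>a\<close>, defined by moving one letter at a time out
  of it: its graded commutator with multiplication by \<open>w\<close> is the coderivation with corestriction
  \<open>\<delta>(w \<cdot> -)\<close>.
\<close>

fun cod :: "bit \<Rightarrow> ('v list \<Rightarrow> 'v) \<Rightarrow> 'v list \<Rightarrow> ('k, 'v) words" where
  "cod a \<delta> [] = wd [\<delta> []]"
| "cod a \<delta> (w # ws) = pre (twist a w) (cod a \<delta> ws)
     + (cod a (\<lambda>X. \<delta> (hproj M 0 w # X)) ws + cod (a + 1) (\<lambda>X. \<delta> (hproj M 1 w # X)) ws)"

lemma eqv_zeroI: "x \<doteq> 0 \<Longrightarrow> y \<doteq> 0 \<Longrightarrow> x + y \<doteq> 0"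
  using eqv_add[of x 0 y 0] by simp

text \<open>Only a congruence, since in the base case a sum of two vectors is a single letter and
  splits only modulo the relations.\<close>

lemma cod_add: "cod a (\<lambda>X. \<delta> X + \<delta>' X) ws \<doteq> cod a \<delta> ws + cod a \<delta>' ws"
proof (induction ws arbitrary: a \<delta> \<delta>')
  case Nil
  show ?case by (simp add: wd_add)
next
  case (Cons w ws)
  let ?A = "pre (twist a w) (cod a \<delta> ws)" and ?A' = "pre (twist a w) (cod a \<delta>' ws)"
  have "cod a (\<lambda>X. \<delta> X + \<delta>' X) (w # ws) \<doteq> pre (twist a w) (cod a \<delta> ws + cod a \<delta>' ws)
    + ((cod a (\<lambda>X. \<delta> (hproj M 0 w # X)) ws + cod a (\<lambda>X. \<delta>' (hproj M 0 w # X)) ws)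
     + (cod (a + 1) (\<lambda>X. \<delta> (hproj M 1 w # X)) ws + cod (a + 1) (\<lambda>X. \<delta>' (hproj M 1 w # X)) ws))"
    unfolding cod.simps by (intro eqv_add eqv_pre Cons.IH)
  also have "\<dots> = cod a \<delta> (w # ws) + cod a \<delta>' (w # ws)"
    by (simp add: pre_simps algebra_simps)
  finally show ?case .
qed

lemma cod_scale: "cod a (\<lambda>X. scl M c (\<delta> X)) ws \<doteq> wscl c (cod a \<delta> ws)"
proof (induction ws arbitrary: a \<delta>)
  case Nil
  show ?case by (simp add: wd_scale)
next
  case (Cons w ws)
  show ?case
    unfolding cod.simps words.scale_right_distrib pre_simps(4)[symmetric]
    by (intro eqv_add eqv_pre Cons.IH)
qed

lemma cod_sg: "cod a (\<lambda>X. sg b (\<delta> X)) ws \<doteq> sg b (cod a \<delta> ws)"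
  using cod_scale[of a "of_int (psign b)" \<delta> ws] by (simp add: module_psign V.module_axioms)

lemma cod_zero: "cod a (\<lambda>X. 0) ws \<doteq> 0"
  using cod_scale[of a 0 "\<lambda>X. 0" ws] by simp

abbreviation gsymV :: "('v list \<Rightarrow> 'v) \<Rightarrow> bool" where
  "gsymV \<equiv> gsym0 M 0 (scl M)"

text \<open>For homogeneous w one of the two components is 0, and its summand is a coderivation with
  zero corestriction. This is the commutator rule on which the later computations run.\<close>

lemma cod_Cons:
  assumes "gsymV \<delta>" "w \<in> deg M p"
  shows "cod a \<delta> (w # ws) \<doteq> sg (a * p) (pre w (cod a \<delta> ws)) + cod (a + p) (\<lambda>X. \<delta> (w # X)) ws"
proof -
  have z: "cod b (\<lambda>X. \<delta> (0 # X)) ws \<doteq> 0" for b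
    using gsym0_zero[OF assms(1), of "[]"] cod_zero[of b ws] by simp
  have "cod a (\<lambda>X. \<delta> (hproj M 0 w # X)) ws + cod (a + 1) (\<lambda>X. \<delta> (hproj M 1 w # X)) ws
      \<doteq> cod (a + p) (\<lambda>X. \<delta> (w # X)) ws"
  proof (cases "p = 0")
    case True
    have "cod a (\<lambda>X. \<delta> (w # X)) ws + cod (a + 1) (\<lambda>X. \<delta> (0 # X)) ws \<doteq> cod a (\<lambda>X. \<delta> (w # X)) ws + 0"
      by (intro eqv_add z eqv_refl)
    then show ?thesis using True assms(2) by (simp add: hproj_homogeneous)
  next
    case False
    have "cod a (\<lambda>X. \<delta> (0 # X)) ws + cod (a + 1) (\<lambda>X. \<delta> (w # X)) ws \<doteq> 0 + cod (a + 1) (\<lambda>X. \<delta> (w # X)) ws"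
      by (intro eqv_add z eqv_refl)
    then show ?thesis using False assms(2) by (simp add: hproj_homogeneous)
  qed
  then show ?thesis
    unfolding cod.simps twist_homogeneous[OF assms(2)] by (intro eqv_add pre_sg)
qed

text \<open>Whatever is killed by all coderivations is killed behind any prefix as well. The
  hypothesis ranges over all \<open>a\<close> and \<delta> because moving a prefix letter out
  replaces \<delta> by its absorbed versions.\<close>

lemma cod_prefix:
  assumes "\<And>a \<delta>. gsymV \<delta> \<Longrightarrow> ext wscl (cod a \<delta>) y \<doteq> 0" and "gsymV \<delta>"
  shows "ext wscl (\<lambda>s. cod a \<delta> (xs @ s)) y \<doteq> 0"
  using assms(2)
proof (induction xs arbitrary: a \<delta>)
  case Nil
  then show ?case by (simp add: assms(1))
next
  case (Cons x xs)
  have "pre (twist a x) (ext wscl (\<lambda>s. cod a \<delta> (xs @ s)) y) \<doteq> pre (twist a x) 0"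
    by (intro eqv_pre Cons)
  then have "pre (twist a x) (ext wscl (\<lambda>s. cod a \<delta> (xs @ s)) y)
    + (ext wscl (\<lambda>s. cod a (\<lambda>X. \<delta> (hproj M 0 x # X)) (xs @ s)) y
     + ext wscl (\<lambda>s. cod (a + 1) (\<lambda>X. \<delta> (hproj M 1 x # X)) (xs @ s)) y) \<doteq> 0"
    by (intro eqv_zeroI Cons.IH gsym_shift Cons.prems) (simp add: pre_simps)
  then show ?case
    by (simp add: pre_ext ext_add_fun)
qed

lemma eqv_diff_zero: "x \<doteq> y \<longleftrightarrow> x - y \<doteq> 0"
  by (simp add: eqv_def)

text \<open>Coderivations descend to the symmetric algebra. By \<open>cod_prefix\<close> a relation
  may be assumed to stand at the head of the word. For an exchange of x and y the expansion has four
  terms, according to which of the two letters \<delta> absorbs, and these correspond to each other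
  on both sides.\<close>

lemma gsym_cod:
  assumes "gsymV \<delta>"
  shows "gsym M 0 wscl (relmod M (psign 0)) (cod a \<delta>)"
proof -
  have 1: "cod a \<delta> (xs @ (v + w) # ys) - cod a \<delta> (xs @ v # ys) - cod a \<delta> (xs @ w # ys) \<doteq> 0" for xs ys v w
  proof -
    have "cod a \<delta> ((v + w) # ys) \<doteq> cod a \<delta> (v # ys) + cod a \<delta> (w # ys)" if "gsymV \<delta>" for a \<delta>
    proof -
      have add: "\<delta> (hproj M q (v + w) # X) = \<delta> (hproj M q v # X) + \<delta> (hproj M q w # X)" for q X
        using gsym0_add[OF that, of "[]"] by (simp add: hproj_add)
      have "cod a \<delta> ((v + w) # ys) \<doteq> (pre (twist a v) (cod a \<delta> ys) + pre (twist a w) (cod a \<delta> ys))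
        + ((cod a (\<lambda>X. \<delta> (hproj M 0 v # X)) ys + cod a (\<lambda>X. \<delta> (hproj M 0 w # X)) ys)
         + (cod (a + 1) (\<lambda>X. \<delta> (hproj M 1 v # X)) ys + cod (a + 1) (\<lambda>X. \<delta> (hproj M 1 w # X)) ys))"
        unfolding cod.simps twist_add add by (intro eqv_add pre_add cod_add)
      then show ?thesis by (simp add: algebra_simps)
    qed
    then have "cod a \<delta> ((v + w) # ys) - cod a \<delta> (v # ys) - cod a \<delta> (w # ys) \<doteq> 0" if "gsymV \<delta>" for a \<delta>
      using that unfolding diff_diff_eq eqv_diff_zero[symmetric] by blast
    \<comment> \<open>The relation is restated as the value of the linear extension on a relator,
      the form that \<open>cod_prefix\<close> accepts.\<close>
    then have "ext wscl (cod a \<delta>) (wd ((v + w) # ys) - wd (v # ys) - wd (w # ys)) \<doteq> 0" if "gsymV \<delta>" for a \<delta>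
      using that by (simp add: ext_diff del: cod.simps)
    from cod_prefix[OF this assms, where a = a and xs = xs] show ?thesis
      by (simp add: ext_diff)
  qed
  have 2: "cod a \<delta> (xs @ scl M c v # ys) - wscl c (cod a \<delta> (xs @ v # ys)) \<doteq> 0" for xs ys c v
  proof -
    have "cod a \<delta> (scl M c v # ys) \<doteq> wscl c (cod a \<delta> (v # ys))" if "gsymV \<delta>" for a \<delta>
    proof -
      have scale: "\<delta> (hproj M q (scl M c v) # X) = scl M c (\<delta> (hproj M q v # X))" for q X
        using gsym0_scale[OF that, of "[]"] by (simp add: hproj_scale)
      show ?thesis
        unfolding cod.simps twist_scale scale words.scale_right_distrib
        by (intro eqv_add pre_scale cod_scale)
    qed
    then have "ext wscl (cod a \<delta>) (wd (scl M c v # ys) - wscl c (wd (v # ys))) \<doteq> 0" if "gsymV \<delta>" for a \<delta>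
      using that by (simp add: ext_diff ext_scale eqv_diff_zero[symmetric])
    from cod_prefix[OF this assms, where a = a and xs = xs] show ?thesis
      by (simp add: ext_diff ext_scale)
  qed
  have 3: "cod a \<delta> (xs @ x # y # ys) - sg (p * q) (cod a \<delta> (xs @ y # x # ys)) \<doteq> 0"
    if x: "x \<in> deg M p" and y: "y \<in> deg M q" for xs ys x y p q
  proof -
    have "cod a \<delta> (x # y # ys) \<doteq> sg (p * q) (cod a \<delta> (y # x # ys))" if \<delta>: "gsymV \<delta>" for a \<delta>
    proof -
      let ?Z = "cod a \<delta> ys"
      let ?X = "cod (a + p) (\<lambda>X. \<delta> (x # X)) ys" and ?Y = "cod (a + q) (\<lambda>X. \<delta> (y # X)) ys"
      let ?XY = "cod (a + p + q) (\<lambda>X. \<delta> (x # y # X)) ys" and ?YX = "cod (a + q + p) (\<lambda>X. \<delta> (y # x # X)) ys"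
      have two: "cod a \<delta> (x # y # ys) \<doteq>
          sg (a * p) (pre x (sg (a * q) (pre y (cod a \<delta> ys)) + cod (a + q) (\<lambda>X. \<delta> (y # X)) ys))
          + (sg ((a + p) * q) (pre y (cod (a + p) (\<lambda>X. \<delta> (x # X)) ys))
             + cod (a + p + q) (\<lambda>X. \<delta> (x # y # X)) ys)"
        if "x \<in> deg M p" "y \<in> deg M q" for x y p q
        by (rule eqv_trans[OF cod_Cons[OF \<delta> that(1)]])
          (intro eqv_add eqv_sg eqv_pre cod_Cons \<delta> that cod_Cons[OF gsym_shift[OF \<delta>] that(2)])
      have XY: "?XY \<doteq> sg (p * q) ?YX"
      proof -
        have "(\<lambda>X. \<delta> (x # y # X)) = (\<lambda>X. sg (p * q) (\<delta> (y # x # X)))"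
          using gsym0_swap[OF \<delta> x y, of "[]"] by simp
        then show ?thesis
          using cod_sg[of "a + p + q" "p * q" "\<lambda>X. \<delta> (y # x # X)" ys] by (simp add: ac_simps)
      qed
      have "cod a \<delta> (x # y # ys) \<doteq> sg (a * p + a * q) (pre x (pre y ?Z)) + sg (a * p) (pre x ?Y)
          + (sg (a * q + p * q) (pre y ?X) + ?XY)"
        using two[OF x y] by (simp add: pre_simps sg_add algebra_simps)
      also have "\<dots> \<doteq> sg (a * p + a * q) (sg (p * q) (pre y (pre x ?Z))) + sg (a * p) (pre x ?Y)
          + (sg (a * q + p * q) (pre y ?X) + sg (p * q) ?YX)"
        by (intro eqv_add eqv_sg pre_swap x y XY eqv_refl)
      also have "\<dots> = sg (p * q) (sg (a * q) (pre y (sg (a * p) (pre x ?Z) + ?X))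
          + (sg ((a + q) * p) (pre x ?Y) + ?YX))"
        by (simp add: pre_simps sg_add algebra_simps)
      also have "\<dots> \<doteq> sg (p * q) (cod a \<delta> (y # x # ys))"
        by (intro eqv_sg eqv_sym[OF two[OF y x]])
      finally show ?thesis .
    qed
    then have "ext wscl (cod a \<delta>) (wd (x # y # ys) - sg (p * q) (wd (y # x # ys))) \<doteq> 0" if "gsymV \<delta>" for a \<delta>
      using that by (simp add: ext_diff ext_sg eqv_diff_zero[symmetric])
    from cod_prefix[OF this assms, where a = a and xs = xs] show ?thesis
      by (simp add: ext_diff ext_sg)
  qed
  show ?thesis
    unfolding gsym_def using 1 2 3 by (simp add: eqv_def)
qed

lemma lookup_cod_Nil: "Poly_Mapping.lookup (cod a \<delta> ws) [] = 0"
  by (induction ws arbitrary: a \<delta>) (simp_all add: lookup_add lookup_pre_Nil)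

lemma eqv_ext_cod: "gsymV \<delta> \<Longrightarrow> x \<doteq> y \<Longrightarrow> ext wscl (cod a \<delta>) x \<doteq> ext wscl (cod a \<delta>) y"
  unfolding eqv_def by (rule gsym_ext_words[OF _ _ gsym_cod]) auto

lemma ext_eqv: "module t \<Longrightarrow> gsym0 M 0 t F \<Longrightarrow> x \<doteq> y \<Longrightarrow> ext t F x = ext t F y"
  unfolding eqv_def using gsym0_relmod[of t M 0 F "x - y"] by (simp add: ext_diff)

section \<open>Parities and the commutator of two coderivations\<close>

definition par :: "bit \<Rightarrow> ('v list \<Rightarrow> 'v) \<Rightarrow> bool" where
  "par a \<delta> \<longleftrightarrow> (\<forall>ps vs. homogeneous M ps vs \<longrightarrow> \<delta> vs \<in> deg M (a + sum_list ps))"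

lemma par_shift:
  assumes "par a \<delta>" "w \<in> deg M p"
  shows "par (a + p) (\<lambda>X. \<delta> (w # X))"
  unfolding par_def
proof (intro allI impI)
  fix ps vs assume "homogeneous M ps vs"
  then have "\<delta> (w # vs) \<in> deg M (a + sum_list (p # ps))"
    using assms unfolding par_def by (metis homogeneous_Cons)
  then show "\<delta> (w # vs) \<in> deg M (a + p + sum_list ps)"
    by (simp add: add.assoc)
qed

lemma par_Nil: "par a \<delta> \<Longrightarrow> \<delta> [] \<in> deg M a"
  unfolding par_def by (metis add_0_right homogeneous_Nil(1) sum_list.Nil)

lemma ext_cod_pre:
  assumes "gsymV \<delta>" "w \<in> deg M p"
  shows "ext wscl (cod a \<delta>) (pre w x)
    \<doteq> sg (a * p) (pre w (ext wscl (cod a \<delta>) x)) + ext wscl (cod (a + p) (\<lambda>X. \<delta> (w # X))) x"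
  unfolding ext_pre[OF module_wscl] pre_ext ext_sg_fun[OF module_wscl, symmetric]
    ext_add_fun[OF module_wscl, symmetric]
  by (rule eqv_ext_fun) (rule cod_Cons[OF assms])

text \<open>The corestriction of the graded commutator of two coderivations.\<close>

definition cbr :: "bit \<Rightarrow> ('v list \<Rightarrow> 'v) \<Rightarrow> bit \<Rightarrow> ('v list \<Rightarrow> 'v) \<Rightarrow> 'v list \<Rightarrow> 'v" where
  "cbr a \<alpha> b \<beta> X = ext (scl M) \<alpha> (cod b \<beta> X) - sg (a * b) (ext (scl M) \<beta> (cod a \<alpha> X))"

lemma gsym_ext_cod: "gsymV \<alpha> \<Longrightarrow> gsymV \<beta> \<Longrightarrow> gsymV (\<lambda>X. ext (scl M) \<alpha> (cod b \<beta> X))"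
  by (rule gsym_ext[OF gsym_cod V.module_axioms])

lemma gsym_cbr: "gsymV \<alpha> \<Longrightarrow> gsymV \<beta> \<Longrightarrow> gsymV (cbr a \<alpha> b \<beta>)"
  unfolding cbr_def
  by (intro gsym_diff V.module_axioms V.subspace_single_0 gsym_ext_cod
      gsym_sg[of _ _ _ _ _ "\<lambda>_. a * b"])

text \<open>A graded Jacobi identity with multiplication by the first letter w: its commutator with
  [\<alpha>, \<beta>] consists of the commutators of \<alpha>(w -) with \<beta> and of \<alpha> with
  \<beta>(w -). The right-hand side obeys the same rule. The induction on the word is therefore over
  all \<alpha> and \<beta> at once.\<close>

theorem cod_commutator:
  assumes "gsymV \<alpha>" "gsymV \<beta>" "par a \<alpha>" "par b \<beta>" "homogeneous M ps ws"
  shows "ext wscl (cod a \<alpha>) (cod b \<beta> ws) - sg (a * b) (ext wscl (cod b \<beta>) (cod a \<alpha> ws))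
    \<doteq> cod (a + b) (cbr a \<alpha> b \<beta>) ws"
  using assms
proof (induction ws arbitrary: a \<alpha> b \<beta> ps)
  case Nil
  note \<alpha> = Nil.prems(1,3) and \<beta> = Nil.prems(2,4)
  have c: "cod a' \<alpha>' [v] \<doteq> sg (a' * p) (wd [v, \<alpha>' []]) + wd [\<alpha>' [v]]"
    if "gsymV \<alpha>'" "v \<in> deg M p" for a' \<alpha>' v p
    using cod_Cons[OF that, of a' "[]"] by simp
  \<comment> \<open>Absorbed letters may leave \<alpha> [] and \<beta> [] nonzero. Both composites
    then contain the product of these two letters, and exchanging them makes it cancel.\<close>
  have sw: "wd [\<beta> [], \<alpha> []] \<doteq> sg (a * b) (wd [\<alpha> [], \<beta> []])"
    using gsym_swapD[OF gsym_wd par_Nil[OF \<beta>(2)] par_Nil[OF \<alpha>(2)], of "[]" "[]"]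
    by (simp add: eqv_def mult.commute)
  have "ext wscl (cod a \<alpha>) (cod b \<beta> []) - sg (a * b) (ext wscl (cod b \<beta>) (cod a \<alpha> []))
      \<doteq> (sg (a * b) (wd [\<beta> [], \<alpha> []]) + wd [\<alpha> [\<beta> []]])
        - sg (a * b) (sg (b * a) (wd [\<alpha> [], \<beta> []]) + wd [\<beta> [\<alpha> []]])"
    unfolding cod.simps(1) ext_wd[OF module_wscl]
    by (intro eqv_diff eqv_sg c par_Nil \<alpha> \<beta>)
  also have "\<dots> \<doteq> (sg (a * b) (sg (a * b) (wd [\<alpha> [], \<beta> []])) + wd [\<alpha> [\<beta> []]])
        - sg (a * b) (sg (b * a) (wd [\<alpha> [], \<beta> []]) + wd [\<beta> [\<alpha> []]])"
    by (intro eqv_diff eqv_sg eqv_add sw eqv_refl)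
  also have "\<dots> = wd [\<alpha> [\<beta> []]] - sg (a * b) (wd [\<beta> [\<alpha> []]])"
    by (simp add: sg_add mult.commute)
  also have "\<dots> \<doteq> wd [cbr a \<alpha> b \<beta> []]"
  proof (rule eqv_sym)
    have "wd [cbr a \<alpha> b \<beta> []] \<doteq> wd [\<alpha> [\<beta> []]] + wd [sg (1 + a * b) (\<beta> [\<alpha> []])]"
      using wd_add[of "\<alpha> [\<beta> []]" "sg (1 + a * b) (\<beta> [\<alpha> []])" "[]"]
      by (simp add: cbr_def V.module_axioms sg_one_add)
    also have "\<dots> \<doteq> wd [\<alpha> [\<beta> []]] + sg (1 + a * b) (wd [\<beta> [\<alpha> []]])"
      using pre_sg[of "1 + a * b" "\<beta> [\<alpha> []]" "wd []"] by (intro eqv_add eqv_refl) simp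
    finally show "wd [cbr a \<alpha> b \<beta> []] \<doteq> wd [\<alpha> [\<beta> []]] - sg (a * b) (wd [\<beta> [\<alpha> []]])"
      by (simp add: sg_one_add)
  qed
  finally show ?case by simp
next
  case (Cons w ws)
  note \<alpha> = Cons.prems(1,3) and \<beta> = Cons.prems(2,4)
  obtain p qs where ps: "ps = p # qs" and w: "w \<in> deg M p" and ws: "homogeneous M qs ws"
    using Cons.prems(5) by (cases ps) auto
  let ?\<alpha> = "\<lambda>X. \<alpha> (w # X)" and ?\<beta> = "\<lambda>X. \<beta> (w # X)"
  note s\<alpha> = gsym_shift[OF \<alpha>(1), of w] and s\<beta> = gsym_shift[OF \<beta>(1), of w]
  have step: "ext wscl (cod a \<alpha>) (cod b \<beta> (w # ws)) \<doteq>
      sg (b * p) (sg (a * p) (pre w (ext wscl (cod a \<alpha>) (cod b \<beta> ws)))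
        + ext wscl (cod (a + p) (\<lambda>X. \<alpha> (w # X))) (cod b \<beta> ws))
      + ext wscl (cod a \<alpha>) (cod (b + p) (\<lambda>X. \<beta> (w # X)) ws)"
    if \<alpha>: "gsymV \<alpha>" and \<beta>: "gsymV \<beta>" for a \<alpha> b \<beta>
  proof -
    have "ext wscl (cod a \<alpha>) (cod b \<beta> (w # ws))
        \<doteq> ext wscl (cod a \<alpha>) (sg (b * p) (pre w (cod b \<beta> ws)) + cod (b + p) (\<lambda>X. \<beta> (w # X)) ws)"
      by (intro eqv_ext_cod \<alpha> cod_Cons \<beta> w)
    also have "\<dots> = sg (b * p) (ext wscl (cod a \<alpha>) (pre w (cod b \<beta> ws)))
        + ext wscl (cod a \<alpha>) (cod (b + p) (\<lambda>X. \<beta> (w # X)) ws)"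
      by (simp add: ext_add ext_sg)
    also have "\<dots> \<doteq> sg (b * p) (sg (a * p) (pre w (ext wscl (cod a \<alpha>) (cod b \<beta> ws)))
        + ext wscl (cod (a + p) (\<lambda>X. \<alpha> (w # X))) (cod b \<beta> ws))
      + ext wscl (cod a \<alpha>) (cod (b + p) (\<lambda>X. \<beta> (w # X)) ws)"
      by (intro eqv_add eqv_sg ext_cod_pre \<alpha> w eqv_refl)
    finally show ?thesis .
  qed
  let ?AB = "ext wscl (cod a \<alpha>) (cod b \<beta> ws)" and ?BA = "ext wscl (cod b \<beta>) (cod a \<alpha> ws)"
  let ?A'B = "ext wscl (cod (a + p) ?\<alpha>) (cod b \<beta> ws)" and ?BA' = "ext wscl (cod b \<beta>) (cod (a + p) ?\<alpha> ws)"
  let ?AB' = "ext wscl (cod a \<alpha>) (cod (b + p) ?\<beta> ws)" and ?B'A = "ext wscl (cod (b + p) ?\<beta>) (cod a \<alpha> ws)"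
  have "ext wscl (cod a \<alpha>) (cod b \<beta> (w # ws)) - sg (a * b) (ext wscl (cod b \<beta>) (cod a \<alpha> (w # ws)))
      \<doteq> (sg (b * p) (sg (a * p) (pre w ?AB) + ?A'B) + ?AB')
        - sg (a * b) (sg (a * p) (sg (b * p) (pre w ?BA) + ?B'A) + ?BA')"
    by (intro eqv_diff eqv_sg step \<alpha> \<beta>)
  \<comment> \<open>The six composites pair off into three commutators, each covered by the
    induction hypothesis.\<close>
  also have "\<dots> = sg ((a + b) * p) (pre w (?AB - sg (a * b) ?BA))
      + (sg (b * p) (?A'B - sg ((a + p) * b) ?BA') + (?AB' - sg (a * (b + p)) ?B'A))"
    by (simp add: pre_simps sg_add sg_diff algebra_simps)
  also have "\<dots> \<doteq> sg ((a + b) * p) (pre w (cod (a + b) (cbr a \<alpha> b \<beta>) ws))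
      + (sg (b * p) (cod (a + p + b) (cbr (a + p) ?\<alpha> b \<beta>) ws) + cod (a + (b + p)) (cbr a \<alpha> (b + p) ?\<beta>) ws)"
    by (intro eqv_add eqv_sg eqv_pre Cons.IH[OF \<alpha>(1) \<beta>(1) \<alpha>(2) \<beta>(2) ws]
        Cons.IH[OF s\<alpha> \<beta>(1) par_shift[OF \<alpha>(2) w] \<beta>(2) ws]
        Cons.IH[OF \<alpha>(1) s\<beta> \<alpha>(2) par_shift[OF \<beta>(2) w] ws])
  also have "\<dots> \<doteq> sg ((a + b) * p) (pre w (cod (a + b) (cbr a \<alpha> b \<beta>) ws))
      + cod (a + b + p) (\<lambda>X. cbr a \<alpha> b \<beta> (w # X)) ws"
  proof (rule eqv_add[OF eqv_refl])
    have ext_step: "ext (scl M) \<alpha> (cod b \<beta> (w # X))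
        = sg (b * p) (ext (scl M) (\<lambda>X. \<alpha> (w # X)) (cod b \<beta> X)) + ext (scl M) \<alpha> (cod (b + p) (\<lambda>X. \<beta> (w # X)) X)"
      if \<alpha>: "gsymV \<alpha>" and \<beta>: "gsymV \<beta>" for b \<alpha> \<beta> X
      unfolding ext_eqv[OF V.module_axioms \<alpha> cod_Cons[OF \<beta> w]]
      by (simp add: ext_add ext_sg ext_pre V.module_axioms)
    \<comment> \<open>Fixing the first argument splits the corestriction of the commutator in the
      same way, which identifies the last two terms.\<close>
    have eq: "(\<lambda>X. cbr a \<alpha> b \<beta> (w # X)) = (\<lambda>X. sg (b * p) (cbr (a + p) ?\<alpha> b \<beta> X) + cbr a \<alpha> (b + p) ?\<beta> X)"
      by (rule ext) (simp add: cbr_def ext_step[OF \<alpha>(1) \<beta>(1)] ext_step[OF \<beta>(1) \<alpha>(1)]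
          sg_add sg_diff algebra_simps del: cod.simps)
    have "cod (a + b + p) (\<lambda>X. cbr a \<alpha> b \<beta> (w # X)) ws
        \<doteq> cod (a + b + p) (\<lambda>X. sg (b * p) (cbr (a + p) ?\<alpha> b \<beta> X)) ws + cod (a + b + p) (cbr a \<alpha> (b + p) ?\<beta>) ws"
      unfolding eq by (rule cod_add)
    also have "\<dots> \<doteq> sg (b * p) (cod (a + b + p) (cbr (a + p) ?\<alpha> b \<beta>) ws) + cod (a + b + p) (cbr a \<alpha> (b + p) ?\<beta>) ws"
      by (intro eqv_add cod_sg eqv_refl)
    finally show "sg (b * p) (cod (a + p + b) (cbr (a + p) ?\<alpha> b \<beta>) ws) + cod (a + (b + p)) (cbr a \<alpha> (b + p) ?\<beta>) ws
        \<doteq> cod (a + b + p) (\<lambda>X. cbr a \<alpha> b \<beta> (w # X)) ws"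
      by (simp add: eqv_sym ac_simps)
  qed
  also have "\<dots> \<doteq> cod (a + b) (cbr a \<alpha> b \<beta>) (w # ws)"
    by (rule eqv_sym[OF cod_Cons[OF gsym_cbr[OF \<alpha>(1) \<beta>(1)] w]])
  finally show ?case .
qed

text \<open>
  The square of an odd coderivation needs its own argument, as its commutator with itself only
  determines twice the square.
\<close>

theorem cod_square:
  assumes "gsymV d" "par 1 d" "d [] = 0" "homogeneous M ps ws"
  shows "ext wscl (cod 1 d) (cod 1 d ws) \<doteq> cod 0 (\<lambda>X. ext (scl M) d (cod 1 d X)) ws"
  using assms(4)
proof (induction ws arbitrary: ps)
  case Nil
  \<comment> \<open>Since \<open>d [] = 0\<close>, the empty word is sent to the one-letter word 0.
    The left side is then \<open>cod 1 d [0]\<close> and the right side the letter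
    \<open>d [0]\<close>; both vanish modulo the relations.\<close>
  have "cod 1 d [0] \<doteq> 0"
    using gsym_cod[OF assms(1), of 1] gsym_scaleD[of M 0 wscl "relmod M (psign 0)" "cod 1 d" "[]" 0 0 "[]"]
    by (simp add: eqv_def)
  moreover have "0 \<doteq> wd [d [0]]"
    using gsym0_zero[OF assms(1), of "[]" "[]"] pre_zero[of "wd []"] by (simp add: eqv_sym)
  ultimately show ?case
    by (simp only: cod.simps assms(3) ext_wd[OF module_wscl] ext_wd[OF V.module_axioms]) (rule eqv_trans)
next
  case (Cons w ws)
  obtain p qs where ps: "ps = p # qs" and w: "w \<in> deg M p" and ws: "homogeneous M qs ws"
    using Cons.prems by (cases ps) auto
  let ?d = "\<lambda>X. d (w # X)" and ?\<kappa> = "\<lambda>X. ext (scl M) d (cod 1 d X)"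
  note d = assms(1) and sd = gsym_shift[OF assms(1), of w]
  have "ext wscl (cod 1 d) (cod 1 d (w # ws))
      \<doteq> ext wscl (cod 1 d) (sg (1 * p) (pre w (cod 1 d ws)) + cod (1 + p) ?d ws)"
    by (intro eqv_ext_cod d cod_Cons w)
  also have "\<dots> = sg p (ext wscl (cod 1 d) (pre w (cod 1 d ws))) + ext wscl (cod 1 d) (cod (1 + p) ?d ws)"
    by (simp add: ext_add ext_sg)
  also have "\<dots> \<doteq> sg p (sg (1 * p) (pre w (ext wscl (cod 1 d) (cod 1 d ws)))
        + ext wscl (cod (1 + p) ?d) (cod 1 d ws)) + ext wscl (cod 1 d) (cod (1 + p) ?d ws)"
    by (intro eqv_add eqv_sg ext_cod_pre d w eqv_refl)
  \<comment> \<open>As d is odd, w times the square of d occurs once, and the other two terms form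
    the commutator of d with the different coderivation of d(w -). No factor 2 arises.\<close>
  also have "\<dots> = pre w (ext wscl (cod 1 d) (cod 1 d ws))
      + (ext wscl (cod 1 d) (cod (1 + p) ?d ws) - sg (1 * (1 + p)) (ext wscl (cod (1 + p) ?d) (cod 1 d ws)))"
    by (simp add: sg_add sg_one_add)
  also have "\<dots> \<doteq> pre w (cod 0 ?\<kappa> ws) + cod (1 + (1 + p)) (cbr 1 d (1 + p) ?d) ws"
    by (intro eqv_add eqv_pre Cons.IH[OF ws] cod_commutator[OF d sd assms(2) par_shift[OF assms(2) w] ws])
  also have "cbr 1 d (1 + p) ?d = (\<lambda>X. ?\<kappa> (w # X))"
  proof
    fix X
    have "?\<kappa> (w # X) = ext (scl M) d (sg (1 * p) (pre w (cod 1 d X)) + cod (1 + p) ?d X)"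
      by (rule ext_eqv[OF V.module_axioms d cod_Cons[OF d w]])
    then show "cbr 1 d (1 + p) ?d X = ?\<kappa> (w # X)"
      by (simp add: cbr_def ext_add ext_sg ext_pre V.module_axioms sg_one_add)
  qed
  also have "pre w (cod 0 ?\<kappa> ws) + cod (1 + (1 + p)) (\<lambda>X. ?\<kappa> (w # X)) ws
      = sg (0 * p) (pre w (cod 0 ?\<kappa> ws)) + cod (0 + p) (\<lambda>X. ?\<kappa> (w # X)) ws"
    by simp
  also have "\<dots> \<doteq> cod 0 ?\<kappa> (w # ws)"
    by (rule eqv_sym[OF cod_Cons[OF gsym_ext_cod[OF d d] w]])
  finally show ?case .
qed

section \<open>Comparison with sums over unshuffles\<close>

definition homs :: "(bit \<times> 'v) list \<Rightarrow> bool" where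
  "homs xs \<longleftrightarrow> homogeneous M (map fst xs) (map snd xs)"

lemma homs_iff: "homs xs \<longleftrightarrow> (\<forall>(p, v)\<in>set xs. v \<in> deg M p)"
  by (induction xs) (auto simp: homs_def)

lemma homs_zip: "homogeneous M ps vs \<Longrightarrow> homs (zip ps vs)"
  by (simp add: homs_def homogeneous_length)

text \<open>The first letter is either absorbed by \<delta>, and then belongs to the first block, or
  it stays in front of the output letter \<delta>(A). In the second case exchanging it with
  \<delta>(A), whose parity is \<open>a\<close> plus that of A, leaves exactly the sign of the
  recursion. Applying \<open>G\<close> covers both coderivations themselves and composites of
  corestrictions.\<close>

theorem ext_cod_shuffle:
  assumes t: "module t" "module.subspace t N" and "gsym M 0 t N G" "gsymV \<delta>" "par a \<delta>" "homs xs"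
  shows "ext t G (cod a \<delta> (map snd xs)) - shuffle_sum (*) xs (\<lambda>A B. G (\<delta> (map snd A) # map snd B)) \<in> N"
  using assms(3-)
proof (induction xs arbitrary: G a \<delta>)
  case Nil
  then show ?case using t by (simp add: module.subspace_0)
next
  case (Cons x xs)
  interpret t: module t by fact
  obtain p v where x: "x = (p, v)" by force
  have v: "v \<in> deg M p" and xs: "homs xs"
    using Cons.prems(4) by (auto simp: homs_iff x)
  let ?ws = "map snd xs" and ?\<delta> = "\<lambda>X. \<delta> (v # X)" and ?G = "\<lambda>X. G (v # X)"
  let ?S = "shuffle_sum (*) xs"
  note G = Cons.prems(1) and \<delta> = Cons.prems(2,3)
  have "ext t G (cod a \<delta> (v # ?ws)) - ext t G (sg (a * p) (pre v (cod a \<delta> ?ws)) + cod (a + p) ?\<delta> ?ws) \<in> N"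
    by (rule gsym_ext_words[OF t G]) (use cod_Cons[OF \<delta>(1) v] in \<open>simp add: eqv_def\<close>)
  then have 1: "ext t G (cod a \<delta> (v # ?ws)) - (sg (a * p) (ext t ?G (cod a \<delta> ?ws)) + ext t G (cod (a + p) ?\<delta> ?ws)) \<in> N"
    by (simp add: ext_add ext_sg ext_pre t)
  have 2: "sg (a * p) (ext t ?G (cod a \<delta> ?ws) - ?S (\<lambda>A B. ?G (\<delta> (map snd A) # map snd B))) \<in> N"
    by (intro t.subspace_sg t(2) Cons.IH gsym_shift G \<delta> xs)
  have 3: "ext t G (cod (a + p) ?\<delta> ?ws) - ?S (\<lambda>A B. G (?\<delta> (map snd A) # map snd B)) \<in> N"
    by (intro Cons.IH gsym_shift G \<delta> par_shift v xs)
  have 4: "?S (\<lambda>A B. sg (a * p) (?G (\<delta> (map snd A) # map snd B)))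
      - ?S (\<lambda>A B. sg (\<Sum>b\<leftarrow>A. p * fst b) (G (\<delta> (map snd A) # v # map snd B))) \<in> N"
  proof (rule shuffle_sum_cong_mod[OF t])
    fix A B assume "set A \<union> set B \<subseteq> set xs"
    then have "homogeneous M (map fst A) (map snd A)"
      using xs unfolding homs_def[symmetric] homs_iff by blast
    then have \<delta>A: "\<delta> (map snd A) \<in> deg M (a + sum_list (map fst A))"
      using \<delta>(2) by (simp add: par_def)
    have sum: "(\<Sum>b\<leftarrow>A. p * fst b) = p * sum_list (map fst A)"
      by (simp add: sum_list_const_mult)
    have "sg (a * p) (G (v # \<delta> (map snd A) # map snd B)
        - sg (0 + p * (a + sum_list (map fst A))) (G (\<delta> (map snd A) # v # map snd B))) \<in> N"
      using gsym_swapD[OF G v \<delta>A, of "[]"] by (intro t.subspace_sg t(2)) simp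
    then show "sg (a * p) (?G (\<delta> (map snd A) # map snd B))
        - sg (\<Sum>b\<leftarrow>A. p * fst b) (G (\<delta> (map snd A) # v # map snd B)) \<in> N"
      unfolding sum by (simp add: sg_diff algebra_simps)
  qed
  have "ext t G (cod a \<delta> (map snd (x # xs))) - shuffle_sum (*) (x # xs) (\<lambda>A B. G (\<delta> (map snd A) # map snd B))
      = (ext t G (cod a \<delta> (v # ?ws)) - (sg (a * p) (ext t ?G (cod a \<delta> ?ws)) + ext t G (cod (a + p) ?\<delta> ?ws)))
      + sg (a * p) (ext t ?G (cod a \<delta> ?ws) - ?S (\<lambda>A B. ?G (\<delta> (map snd A) # map snd B)))
      + (ext t G (cod (a + p) ?\<delta> ?ws) - ?S (\<lambda>A B. G (?\<delta> (map snd A) # map snd B)))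
      + (?S (\<lambda>A B. sg (a * p) (?G (\<delta> (map snd A) # map snd B)))
      - ?S (\<lambda>A B. sg (\<Sum>b\<leftarrow>A. p * fst b) (G (\<delta> (map snd A) # v # map snd B))))"
    by (simp add: x shuffle_sum_sg sg_diff)
  also have "\<dots> \<in> N"
    by (intro t.subspace_add t(2) 1 2 3 4)
  finally show ?case .
qed

lemma ext_cod_shuffle0:
  assumes "module t" "gsym0 M 0 t G" "gsymV \<delta>" "par a \<delta>" "homs xs"
  shows "ext t G (cod a \<delta> (map snd xs)) = shuffle_sum (*) xs (\<lambda>A B. G (\<delta> (map snd A) # map snd B))"
  using ext_cod_shuffle[of t "{0}" G \<delta> a xs] assms by (simp add: module.subspace_single_0)

lemma cod_shuffle:
  assumes "gsymV \<delta>" "par a \<delta>" "homs xs"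
  shows "cod a \<delta> (map snd xs) \<doteq> shuffle_sum (*) xs (\<lambda>A B. wd (\<delta> (map snd A) # map snd B))"
proof -
  have "ext wscl wd x = x" for x :: "('k, 'v) words"
    using module_hom_on_words[of wscl "\<lambda>x. x" x] by (simp add: words.module_hom_ident)
  then show ?thesis
    using ext_cod_shuffle[OF module_wscl subspace_relmod gsym_wd assms] by (simp add: eqv_def)
qed

text \<open>The projection of the symmetric coalgebra onto its part of degree one. It recovers the
  corestriction of a coderivation.\<close>

definition letter :: "'v list \<Rightarrow> 'v" where
  "letter ws = (case ws of [w] \<Rightarrow> w | _ \<Rightarrow> 0)"

lemma letter_simps [simp]: "letter [w] = w" "letter [] = 0" "letter (v # w # ws) = 0"
  by (simp_all add: letter_def)

lemma gsym_letter: "gsymV letter"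
proof -
  have "letter (xs @ a # ys) = (if xs = [] \<and> ys = [] then a else 0)" for xs ys a
    by (cases xs; cases ys; cases "tl xs") (auto simp: letter_def split: list.splits)
  moreover have "letter (xs @ a # b # ys) = 0" for xs ys a b
    by (cases xs; cases "tl xs") (auto simp: letter_def split: list.splits)
  ultimately show ?thesis
    by (auto simp: gsym_def)
qed

lemma letter_cod: "gsymV \<delta> \<Longrightarrow> ext (scl M) letter (cod a \<delta> ws) = \<delta> ws"
proof (induction ws arbitrary: a \<delta>)
  case Nil
  then show ?case by (simp add: V.module_axioms)
next
  case (Cons w ws)
  \<comment> \<open>All words in a coderivation are nonempty, so with a letter in front they have
    length at least two and project to 0.\<close>
  have "ext (scl M) (\<lambda>u. letter (twist a w # u)) (cod a \<delta> ws) = ext (scl M) (\<lambda>u. 0) (cod a \<delta> ws)"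
  proof (rule ext_cong)
    fix u assume "u \<in> Poly_Mapping.keys (cod a \<delta> ws)"
    then have "u \<noteq> []"
      using lookup_cod_Nil[of a \<delta> ws] by (auto simp: in_keys_iff)
    then show "letter (twist a w # u) = 0" by (cases u) auto
  qed
  then have "ext (scl M) letter (cod a \<delta> (w # ws)) = \<delta> (hproj M 0 w # ws) + \<delta> (hproj M 1 w # ws)"
    using gsym_shift[OF Cons.prems] by (simp add: ext_add ext_pre V.module_axioms Cons.IH)
  also have "\<dots> = \<delta> (w # ws)"
    using gsym0_add[OF Cons.prems, of "[]" "hproj M 0 w" "hproj M 1 w" ws] by (simp add: hproj_split)
  finally show ?case .
qed

lemma cod_inject:
  assumes "gsymV \<delta>" "gsymV \<delta>'" "cod a \<delta> ws \<doteq> cod a' \<delta>' ws"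
  shows "\<delta> ws = \<delta>' ws"
  using ext_eqv[OF V.module_axioms gsym_letter assms(3)] by (simp add: letter_cod assms(1,2))

end

section \<open>Unshuffle sums in the definitions\<close>

text \<open>The recursion also counts the unshuffle with empty first block, which the sums in the
  definitions leave out; the assumption on \<open>H []\<close> disposes of this term.\<close>

lemma sum_Sh_mod:
  assumes t: "module t" "module.subspace t N" and len: "length ps = length ws" and H: "\<And>B. H [] B \<in> N"
  shows "shuffle_sum c (zip ps ws) (\<lambda>A B. H (map snd A) (map snd B))
    - (\<Sum>k = 1..length ws. \<Sum>\<sigma>\<in>Sh k (length ws - k).
        sg (invsum c \<sigma> ps) (H (take k (permute_list \<sigma> ws)) (drop k (permute_list \<sigma> ws)))) \<in> N"
proof -
  interpret t: module t by fact
  let ?n = "length ws" and ?xs = "zip ps ws"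
  let ?T = "\<lambda>k. \<Sum>\<sigma>\<in>unshuffles k ?n.
        sg (invsum c \<sigma> ps) (H (take k (permute_list \<sigma> ws)) (drop k (permute_list \<sigma> ws)))"
  have "shuffle_sum c ?xs (\<lambda>A B. H (map snd A) (map snd B)) = (\<Sum>k\<le>?n. ?T k)"
    unfolding sum_unshuffles[symmetric]
  proof (rule sum.cong)
    fix k assume "k \<in> {..?n}"
    have "map snd (permute_list \<sigma> ?xs) = permute_list \<sigma> ws" if "\<sigma> \<in> unshuffles k ?n" for \<sigma>
      using that permute_list_map[of \<sigma> ?xs snd] len by (simp add: unshuffles_def)
    then show "(\<Sum>\<sigma>\<in>unshuffles k (length ?xs). sg (invsum c \<sigma> (map fst ?xs))
        (H (map snd (take k (permute_list \<sigma> ?xs))) (map snd (drop k (permute_list \<sigma> ?xs))))) = ?T k"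
      using len by (intro sum.cong) (simp_all flip: take_map drop_map)
  qed (use len in simp)
  also have "\<dots> = ?T 0 + (\<Sum>k = 1..?n. ?T k)"
    by (simp add: atMost_atLeast0 sum.atLeast_Suc_atMost)
  also have "(\<Sum>k = 1..?n. ?T k) = (\<Sum>k = 1..length ws. \<Sum>\<sigma>\<in>Sh k (length ws - k).
        sg (invsum c \<sigma> ps) (H (take k (permute_list \<sigma> ws)) (drop k (permute_list \<sigma> ws))))"
    by (rule sum.cong) (simp_all add: Sh_eq_unshuffles)
  finally show ?thesis
    using H by (simp add: t.subspace_sum t.subspace_sg t(2))
qed

lemma sum_Sh:
  fixes t :: "'k::comm_ring_1 \<Rightarrow> 'x::ab_group_add \<Rightarrow> 'x" and H :: "'v list \<Rightarrow> 'v list \<Rightarrow> 'x"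
  assumes "module t" "length ps = length ws" "\<And>B. H [] B = 0"
  shows "(\<Sum>k = 1..length ws. \<Sum>\<sigma>\<in>Sh k (length ws - k).
        sg (invsum c \<sigma> ps) (H (take k (permute_list \<sigma> ws)) (drop k (permute_list \<sigma> ws))))
    = shuffle_sum c (zip ps ws) (\<lambda>A B. H (map snd A) (map snd B))"
  using sum_Sh_mod[of t "{0}" ps ws H c] assms by (simp add: module.subspace_single_0)


section \<open>Coderivations of the symmetric coalgebra\<close>

context graded
begin

lemma CW_def': "CW M = Hom M (psign 0) (scl M)"
  by (simp add: CW_def psign_simps)

lemma CV_def': "CV M = Hom M (psign 1) (scl M)"
  by (simp add: CV_def psign_simps)

lemma gsym_vals_CW: "\<delta> \<in> CW M \<Longrightarrow> gsymV (vals 0 \<delta>)"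
  unfolding CW_def' by (rule gsym_vals[OF V.module_axioms])

lemma par_vals: "has_parity M a \<delta> \<Longrightarrow> par a (vals 0 \<delta>)"
  by (auto simp: has_parity_def par_def vals_def psign_simps)

text \<open>The map induced by \<open>cod\<close> fits the description in \<open>coder\<close>, and
  homogeneous words span, so it is the only one. The unshuffle sum puts \<delta> in front and so
  shows no parity of \<delta>; the recursion moves letters past \<delta> and has to know it.\<close>

lemma coder_cls:
  assumes \<delta>: "\<delta> \<in> CW M" "has_parity M a \<delta>" and x: "Poly_Mapping.lookup x [] = 0"
  shows "coder M \<delta> (cls M (psign 0) x) = cls M (psign 0) (ext wscl (cod a (vals 0 \<delta>)) x)"
proof -
  let ?\<delta> = "vals 0 \<delta>"
  let ?D = "qhom_of 0 M 0 (cod a ?\<delta>)"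
  let ?r = "\<lambda>ps ws. \<Sum>k = 1..length ws. \<Sum>\<sigma>\<in>Sh k (length ws - k).
      Poly_Mapping.single (\<delta> (mon M (psign 0) (take k (permute_list \<sigma> ws))) # drop k (permute_list \<sigma> ws))
        (of_int (koszul \<sigma> ps))"
  note g = gsym_vals_CW[OF \<delta>(1)] and p = par_vals[OF \<delta>(2)]
  note D = qhom_of_in_QHom[OF graded_axioms gsym_cod[OF g] lookup_cod_Nil]
    and Dmon = qhom_of_mon[OF graded_axioms gsym_cod[OF g] lookup_cod_Nil]
  have *: "cls M (psign 0) (cod a ?\<delta> ws) = cls M (psign 0) (?r ps ws)"
    if ws: "homogeneous M ps ws" for ps ws
  proof -
    let ?H = "\<lambda>A B. wd (?\<delta> A # B)"
    have len: "length ps = length ws" by (rule homogeneous_length[OF ws])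
    have "cod a ?\<delta> ws \<doteq> shuffle_sum (*) (zip ps ws) (\<lambda>A B. ?H (map snd A) (map snd B))"
      using cod_shuffle[OF g p homs_zip[OF ws]] len by simp
    also have "\<dots> \<doteq> (\<Sum>k = 1..length ws. \<Sum>\<sigma>\<in>Sh k (length ws - k).
        sg (invsum (*) \<sigma> ps) (?H (take k (permute_list \<sigma> ws)) (drop k (permute_list \<sigma> ws))))"
      unfolding eqv_def
      by (rule sum_Sh_mod[OF module_wscl subspace_relmod len])
        (use pre_zero[of "wd _"] in \<open>simp add: eqv_def\<close>)
    also have "\<dots> = ?r ps ws"
    proof (intro sum.cong refl)
      fix k \<sigma> assume k: "k \<in> {1..length ws}" "\<sigma> \<in> Sh k (length ws - k)"
      then have "length (take k (permute_list \<sigma> ws)) = k" "k > 0" by auto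
      then have "take k (permute_list \<sigma> ws) \<noteq> []" by force
      then show "sg (invsum (*) \<sigma> ps) (?H (take k (permute_list \<sigma> ws)) (drop k (permute_list \<sigma> ws)))
        = Poly_Mapping.single (\<delta> (mon M (psign 0) (take k (permute_list \<sigma> ws))) # drop k (permute_list \<sigma> ws))
        (of_int (koszul \<sigma> ps))"
        by (simp add: vals_def koszul_eq_psign single_eq_wscl[of _ "of_int _"] module_psign)
    qed
    finally show ?thesis by (simp add: cls_eqv)
  qed
  have "coder M \<delta> = ?D"
    unfolding coder_def psign_simps(1)[symmetric]
  proof (rule the_equality)
    show "?D \<in> QHom M (psign 0) M (psign 0) \<and> (\<forall>ps ws. ws \<noteq> [] \<and> homogeneous M ps ws \<longrightarrow>
        ?D (mon M (psign 0) ws) = cls M (psign 0) (?r ps ws))"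
      using D Dmon * by simp
    fix D' assume "D' \<in> QHom M (psign 0) M (psign 0) \<and> (\<forall>ps ws. ws \<noteq> [] \<and> homogeneous M ps ws \<longrightarrow>
        D' (mon M (psign 0) ws) = cls M (psign 0) (?r ps ws))"
    then show "D' = ?D"
      by (intro QHom_eqI[of _ 0 M "psign 0"]) (use D Dmon * in simp_all)
  qed
  then show ?thesis
    using qhom_of_cls[OF graded_axioms gsym_cod[OF g] lookup_cod_Nil x] by simp
qed

lemma qpow_add: "X \<in> qpow M (psign e) \<Longrightarrow> Y \<in> qpow M (psign e) \<Longrightarrow> X + Y \<in> qpow M (psign e)"
  by (auto elim!: qpow_cases simp: cls_add lookup_add)

lemma qpow_scale: "X \<in> qpow M (psign e) \<Longrightarrow> qscl M (psign e) c X \<in> qpow M (psign e)"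
  by (auto elim!: qpow_cases simp: qscl_cls)

lemma cochain_of_eq:
  assumes "\<chi> \<in> CV M" "\<And>ps vs. vs \<noteq> [] \<Longrightarrow> homogeneous M ps vs \<Longrightarrow> \<chi> (wedge M vs) = f ps vs"
  shows "cochain_of M f = \<chi>"
  unfolding cochain_of_def
proof (rule the_equality)
  fix \<chi>' assume "\<chi>' \<in> CV M \<and> (\<forall>ps vs. vs \<noteq> [] \<and> homogeneous M ps vs \<longrightarrow> \<chi>' (wedge M vs) = f ps vs)"
  then show "\<chi>' = \<chi>"
    using assms unfolding CV_def' psign_simps(2)[symmetric] by (intro Hom_eqI[of _ 1]) auto
qed (use assms in auto)

lemma CV_eqI:
  assumes "f \<in> CV M" "g \<in> CV M"
    "\<And>ps vs. vs \<noteq> [] \<Longrightarrow> homogeneous M ps vs \<Longrightarrow> f (wedge M vs) = g (wedge M vs)"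
  shows "f = g"
  using assms unfolding CV_def' psign_simps(2)[symmetric] by (intro Hom_eqI[of _ 1]) auto

lemma wedge_vals: "vs \<noteq> [] \<Longrightarrow> f (wedge M vs) = vals 1 f vs"
  by (simp add: vals_def psign_simps)

lemma sprod_vals: "vs \<noteq> [] \<Longrightarrow> f (sprod M vs) = vals 0 f vs"
  by (simp add: vals_def psign_simps)

lemma vals_eqI:
  assumes "f \<in> Hom M (psign e) t" "g \<in> Hom M (psign e) t" "vals e f = vals e g"
  shows "f = g"
  using assms(1,2)
proof (rule Hom_eqI)
  fix ps vs assume "vs \<noteq> ([] :: 'v list)"
  then show "f (mon M (psign e) vs) = g (mon M (psign e) vs)"
    using fun_cong[OF assms(3), of vs] by (simp add: vals_def)
qed


section \<open>The passage between exterior and symmetric powers\<close>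

text \<open>
  \<open>\<eta>\<close> on words, with its signs put on the individual letters: this makes sense for inhomogeneous
  letters as well, and it is an involution. The offset \<open>k\<close> counts the letters further to the right.
\<close>

fun etal :: "nat \<Rightarrow> 'v list \<Rightarrow> 'v list" where
  "etal k [] = []"
| "etal k (v # vs) = twist (of_nat (k + length vs)) v # etal k vs"

lemma length_etal [simp]: "length (etal k vs) = length vs"
  by (induction vs) simp_all

lemma etal_eq_Nil [simp]: "etal k vs = [] \<longleftrightarrow> vs = []"
  by (cases vs) simp_all

lemma etal_append: "etal k (xs @ ys) = etal (k + length ys) xs @ etal k ys"
  by (induction xs) (simp_all add: ac_simps)

lemma twist_twist: "twist a (twist a v) = v"
proof -
  have "twist a (hproj M 0 v) = hproj M 0 v" "twist a (hproj M 1 v) = sg a (hproj M 1 v)"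
    using twist_homogeneous[OF hproj_deg, of a 0 v] twist_homogeneous[OF hproj_deg, of a 1 v] by simp_all
  moreover have "twist a (sg a x) = sg a (twist a x)" for x
    using twist_scale[of a "of_int (psign a)" x] by (simp add: module_psign V.module_axioms)
  ultimately show ?thesis
    by (simp add: twist_def[of a v] twist_add hproj_split)
qed

lemma etal_etal: "etal k (etal k vs) = vs"
  by (induction vs) (simp_all add: twist_twist)

lemma gsym_sg_mod:
  assumes "gsym M' e t N F" "module t" "scl M' = scl M"
  shows "F (xs @ sg a x # ys) - sg a (F (xs @ x # ys)) \<in> N"
  using gsym_scaleD[OF assms(1), of xs "of_int (psign a)" x ys] assms(2,3)
  by (simp add: module_psign V.module_axioms)

text \<open>The offset \<open>i\<close> selects which of the two modules is the source, so this
  serves both directions. Exchanging neighbours shifts each by one place, which changes the letter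
  signs by p + q; and (p+1)(q+1) + p + q = pq + 1, so the exterior and the symmetric rule are
  interchanged.\<close>

lemma gsym_etal:
  assumes F: "gsym M\<^sub>1 e t N F" and t: "module t" "module.subspace t N"
    and M1: "scl M\<^sub>1 = scl M" "deg M\<^sub>1 = (\<lambda>p. deg M (p + i))"
    and M2: "scl M\<^sub>2 = scl M" "deg M\<^sub>2 = (\<lambda>p. deg M (p + i + 1))"
  shows "gsym M\<^sub>2 (e + 1) t N (\<lambda>vs. F (etal 0 vs))"
  unfolding gsym_def
proof (intro conjI allI impI)
  interpret t: module t by fact
  show "F (etal 0 (xs @ (a + b) # ys)) - F (etal 0 (xs @ a # ys)) - F (etal 0 (xs @ b # ys)) \<in> N" for xs ys a b
    using gsym_addD[OF F] by (simp add: etal_append twist_add)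
  show "F (etal 0 (xs @ scl M\<^sub>2 c a # ys)) - t c (F (etal 0 (xs @ a # ys))) \<in> N" for xs ys c a
    using gsym_scaleD[OF F] by (simp add: etal_append twist_scale M1 M2)
  fix xs ys :: "'v list" and x y p q
  assume "x \<in> deg M\<^sub>2 p" "y \<in> deg M\<^sub>2 q"
  then have x: "x \<in> deg M (p + i + 1)" and y: "y \<in> deg M (q + i + 1)"
    by (simp_all add: M2)
  have sw: "F (E @ x # y # Z) - sg (e + (p + 1) * (q + 1)) (F (E @ y # x # Z)) \<in> N" for E Z
    using x y by (intro gsym_swapD[OF F]) (simp_all add: M1 ac_simps)
  have two: "F (E @ sg a v # sg b w # Z) - sg (a + b) (F (E @ v # w # Z)) \<in> N" for E v w Z a b
  proof -
    have "F (E @ sg a v # sg b w # Z) - sg (a + b) (F (E @ v # w # Z))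
      = (F (E @ sg a v # sg b w # Z) - sg a (F (E @ v # sg b w # Z)))
        + sg a (F ((E @ [v]) @ sg b w # Z) - sg b (F ((E @ [v]) @ w # Z)))"
      by (simp add: sg_diff)
    also have "\<dots> \<in> N"
      by (intro t.subspace_add t.subspace_sg t(2) gsym_sg_mod[OF F t(1) M1(1)])
    finally show ?thesis .
  qed
  define m where "m = (of_nat (length ys) :: bit)"
  let ?E = "etal (Suc (Suc (length ys))) xs" and ?Z = "etal 0 ys"
  let ?P = "p + i + 1" and ?Q = "q + i + 1"
  let ?a = "(1 + m) * ?P" and ?b = "m * ?Q" and ?a' = "(1 + m) * ?Q" and ?b' = "m * ?P"
  have xy: "etal 0 (xs @ x # y # ys) = ?E @ sg ?a x # sg ?b y # ?Z"
    "etal 0 (xs @ y # x # ys) = ?E @ sg ?a' y # sg ?b' x # ?Z"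
    by (simp_all add: etal_append twist_homogeneous[OF x] twist_homogeneous[OF y] m_def)
  let ?s = "e + (p + 1) * (q + 1)" and ?s' = "e + 1 + p * q"
  have sign: "?a + ?b + ?s = ?s' + (?a' + ?b')"
    by (cases p; cases q; cases i; cases m; cases e) simp_all
  have "F (etal 0 (xs @ x # y # ys)) - sg ?s' (F (etal 0 (xs @ y # x # ys)))
    = (F (?E @ sg ?a x # sg ?b y # ?Z) - sg (?a + ?b) (F (?E @ x # y # ?Z)))
    + sg (?a + ?b) (F (?E @ x # y # ?Z) - sg ?s (F (?E @ y # x # ?Z)))
    - sg ?s' (F (?E @ sg ?a' y # sg ?b' x # ?Z) - sg (?a' + ?b') (F (?E @ y # x # ?Z)))"
    unfolding xy sg_diff sg_sg sign by simp
  also have "\<dots> \<in> N"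
    by (intro t.subspace_add t.subspace_diff t.subspace_sg t(2) two sw)
  finally show "F (etal 0 (xs @ x # y # ys)) - sg ?s' (F (etal 0 (xs @ y # x # ys))) \<in> N" .
qed

text \<open>On homogeneous letters the individual signs can be collected in front; the result is the
  sign in the definition of \<eta>.\<close>

lemma gsym_etal_homogeneous:
  assumes F: "gsym M' e t N F" and t: "module t" "module.subspace t N" and M': "scl M' = scl M"
    and "homogeneous M ps vs"
  shows "F (xs @ etal 0 vs) - sg (etasign ps) (F (xs @ vs)) \<in> N"
  using assms(5)
proof (induction vs arbitrary: ps xs)
  case Nil
  then show ?case using t by (simp add: module.subspace_0)
next
  case (Cons v vs)
  interpret t: module t by fact
  obtain p qs where ps: "ps = p # qs" and v: "v \<in> deg M p" and vs: "homogeneous M qs vs"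
    using Cons.prems by (cases ps) auto
  let ?a = "of_nat (length vs) * p"
  have "F (xs @ etal 0 (v # vs)) - sg (etasign ps) (F (xs @ v # vs))
    = (F (xs @ sg ?a v # etal 0 vs) - sg ?a (F (xs @ v # etal 0 vs)))
      + sg ?a (F ((xs @ [v]) @ etal 0 vs) - sg (etasign qs) (F ((xs @ [v]) @ vs)))"
    by (simp add: ps twist_homogeneous[OF v] sg_diff homogeneous_length[OF vs])
  also have "\<dots> \<in> N"
    by (intro t.subspace_add t.subspace_sg t(2) gsym_sg_mod[OF F t(1) M'] Cons.IH vs)
  finally show ?case .
qed

lemma gsym0_etal_homogeneous:
  assumes "gsym0 M' e t F" "module t" "scl M' = scl M" "homogeneous M ps vs"
  shows "F (etal 0 vs) = sg (etasign ps) (F vs)"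
  using gsym_etal_homogeneous[OF assms(1,2) _ assms(3,4), of "[]"] assms(2)
  by (simp add: module.subspace_single_0)

end

lemma shift_simps [simp]: "scl (\<Pi> M) = scl M" "deg (\<Pi> M) = (\<lambda>p. deg M (p + 1))"
  by (simp_all add: parity_shift_def)

locale shifted = graded M for M :: "('k::comm_ring_1, 'v::ab_group_add) smodule"

sublocale shifted \<subseteq> W: graded "\<Pi> M"
proof
  have "deg M 1 \<inter> deg M 0 = deg M 0 \<inter> deg M 1" by (rule Int_commute)
  moreover have "\<exists>x\<in>deg M 1. \<exists>y\<in>deg M 0. v = x + y" for v
    using graded unfolding graded_module_def by (metis add.commute)
  ultimately show "graded_module (\<Pi> M)"
    using graded unfolding graded_module_def by simp
qed

context shifted
begin

lemma gsym_etal_V: "gsym (\<Pi> M) e t N F \<Longrightarrow> module t \<Longrightarrow> module.subspace t N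
    \<Longrightarrow> gsym M (e + 1) t N (\<lambda>vs. F (etal 0 vs))"
  by (rule gsym_etal[where i = 1 and M\<^sub>1 = "\<Pi> M"]) (auto simp: add.assoc)

lemma gsym_etal_W: "gsym M e t N F \<Longrightarrow> module t \<Longrightarrow> module.subspace t N
    \<Longrightarrow> gsym (\<Pi> M) (e + 1) t N (\<lambda>vs. F (etal 0 vs))"
  by (rule gsym_etal[where i = 0 and M\<^sub>1 = M]) auto

lemma homogeneous_shift: "homogeneous (\<Pi> M) ps vs \<longleftrightarrow> homogeneous M (map (\<lambda>p. p + 1) ps) vs"
  by (simp add: homogeneous_def list_all2_map1)

lemma homogeneous_shift': "homogeneous M ps vs \<longleftrightarrow> homogeneous (\<Pi> M) (map (\<lambda>p. p + 1) ps) vs"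
  by (simp add: homogeneous_def list_all2_map1 add.assoc)

text \<open>Existence and uniqueness for the description in \<open>eta\<close>. The formula holds
  for inhomogeneous letters too, so conjugation by \<eta> becomes precomposition with
  \<open>etal 0\<close>.\<close>

lemma
  shows eta_mon: "vs \<noteq> [] \<Longrightarrow> eta M (mon M (psign 1) vs) = mon (\<Pi> M) (psign 0) (etal 0 vs)"
    and eta_QHom: "eta M \<in> QHom M (psign 1) (\<Pi> M) (psign 0)"
proof -
  let ?G = "\<lambda>vs. wd (etal 0 vs)"
  let ?h = "qhom_of 1 (\<Pi> M) 0 ?G"
  have g: "gsym M 1 wscl (relmod (\<Pi> M) (psign 0)) ?G"
    using gsym_etal_V[OF W.gsym_wd] by simp
  note h = qhom_of_in_QHom[OF W.graded_axioms g] and hmon = qhom_of_mon[OF W.graded_axioms g]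
  have *: "cls (\<Pi> M) (psign 0) (?G vs)
      = qscl (\<Pi> M) (psign 0) (of_int (psign (\<Sum>i<length vs. of_nat (length vs - 1 - i) * ps ! i)))
          (mon (\<Pi> M) (psign 0) vs)" if vs: "homogeneous M ps vs" for ps vs
    using gsym_etal_homogeneous[OF W.gsym_wd module_wscl W.subspace_relmod _ vs, of "[]"]
    by (simp add: mon_def W.qscl_cls W.cls_eq_iff module_psign etasign_eq homogeneous_length[OF vs])
  have "eta M = ?h"
    unfolding eta_def
  proof (rule the_equality)
    show "?h \<in> QHom M (- 1) (\<Pi> M) 1 \<and> (\<forall>ps vs. vs \<noteq> [] \<and> homogeneous M ps vs \<longrightarrow>
       ?h (mon M (- 1) vs) = qscl (\<Pi> M) 1 (of_int (psign (\<Sum>i<length vs. of_nat (length vs - 1 - i) * ps ! i)))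
          (mon (\<Pi> M) 1 vs))"
      using h hmon * by (simp add: psign_simps)
    fix h' assume "h' \<in> QHom M (- 1) (\<Pi> M) 1 \<and> (\<forall>ps vs. vs \<noteq> [] \<and> homogeneous M ps vs \<longrightarrow>
       h' (mon M (- 1) vs) = qscl (\<Pi> M) 1 (of_int (psign (\<Sum>i<length vs. of_nat (length vs - 1 - i) * ps ! i)))
          (mon (\<Pi> M) 1 vs))"
    then show "h' = ?h"
      by (intro QHom_eqI[of _ 1 "\<Pi> M" "psign 0"]) (use h hmon * in \<open>simp_all add: psign_simps\<close>)
  qed
  then show "vs \<noteq> [] \<Longrightarrow> eta M (mon M (psign 1) vs) = mon (\<Pi> M) (psign 0) (etal 0 vs)"
    and "eta M \<in> QHom M (psign 1) (\<Pi> M) (psign 0)"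
    using h hmon by (simp_all add: mon_def)
qed

lemma conj_eta_CV: "\<delta> \<in> CW (\<Pi> M) \<Longrightarrow> conj_eta M \<delta> \<in> CV M"
  unfolding CV_def' W.CW_def' using eta_QHom qpow_add[of _ 1] qpow_scale[of _ 1]
  by (auto simp: Hom_def QHom_def conj_eta_def psign_simps)

lemma vals_conj_eta: "vals 1 (conj_eta M \<delta>) vs = W.vals 0 \<delta> (etal 0 vs)"
  using mon_in_qpow[of vs 1] eta_mon[of vs]
  by (simp add: vals_def W.vals_def conj_eta_def psign_simps)

end

section \<open>Parity components\<close>

context graded
begin

fun gproj :: "(bit \<Rightarrow> 'x \<Rightarrow> 'x) \<Rightarrow> bit \<Rightarrow> ('v list \<Rightarrow> 'x) \<Rightarrow> 'v list \<Rightarrow> 'x::ab_group_add" where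
  "gproj pr a F [] = pr a (F [])"
| "gproj pr a F (v # vs) = gproj pr a (\<lambda>X. F (hproj M 0 v # X)) vs + gproj pr (a + 1) (\<lambda>X. F (hproj M 1 v # X)) vs"

context
  fixes t :: "'k \<Rightarrow> 'x \<Rightarrow> 'x::ab_group_add" and pr :: "bit \<Rightarrow> 'x \<Rightarrow> 'x"
  assumes t: "module t" and pr: "\<And>a. module_hom t t (pr a)"
begin

interpretation t: module t by (rule t)

interpretation pr: module_hom t t "pr a" for a by (rule pr)

lemma gproj_add: "gproj pr a (\<lambda>X. F X + G X) vs = gproj pr a F vs + gproj pr a G vs"
  by (induction vs arbitrary: a F G) (simp_all add: pr.add algebra_simps)

lemma gproj_scale: "gproj pr a (\<lambda>X. t c (F X)) vs = t c (gproj pr a F vs)"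
  by (induction vs arbitrary: a F) (simp_all add: pr.scale t.scale_right_distrib)

lemma gproj_sg: "gproj pr a (\<lambda>X. sg b (F X)) vs = sg b (gproj pr a F vs)"
  using gproj_scale[of a "of_int (psign b)" F vs] by (simp add: module_psign t)

lemma gproj_zero: "gproj pr a (\<lambda>X. 0) vs = 0"
  by (induction vs arbitrary: a) simp_all

lemma gproj_Cons:
  assumes "gsym0 M e t F" "v \<in> deg M p"
  shows "gproj pr a F (v # vs) = gproj pr (a + p) (\<lambda>X. F (v # X)) vs"
  using gsym0_zero[OF assms(1), of "[]"]
  by (cases p) (simp_all add: hproj_homogeneous[OF assms(2)] gproj_zero)

lemma gproj_homogeneous:
  assumes "gsym0 M e t F" "homogeneous M ps vs"
  shows "gproj pr a F vs = pr (a + sum_list ps) (F vs)"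
  using assms
proof (induction vs arbitrary: a F ps)
  case (Cons v vs)
  obtain p qs where ps: "ps = p # qs" and v: "v \<in> deg M p" and vs: "homogeneous M qs vs"
    using Cons.prems(2) by (cases ps) auto
  show ?case
    using Cons.IH[OF gsym_shift[OF Cons.prems(1)] vs]
    by (simp only: gproj_Cons[OF Cons.prems(1) v]) (simp add: ps add.assoc)
qed simp

lemma gsym_gproj:
  assumes "gsym0 M e t F"
  shows "gsym0 M e t (gproj pr a F)"
proof -
  have 1: "gproj pr a F (xs @ (v + w) # ys) = gproj pr a F (xs @ v # ys) + gproj pr a F (xs @ w # ys)"
    if "gsym0 M e t F" for xs v w ys F a
    using that
  proof (induction xs arbitrary: a F)
    case Nil
    show ?case
      using gsym0_add[OF Nil, of "[]"] by (simp add: hproj_add gproj_add)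
  next
    case (Cons x xs)
    show ?case
      by (simp add: Cons.IH gsym_shift[OF Cons.prems])
  qed
  have 2: "gproj pr a F (xs @ scl M c v # ys) = t c (gproj pr a F (xs @ v # ys))"
    if "gsym0 M e t F" for xs v c ys F a
    using that
  proof (induction xs arbitrary: a F)
    case Nil
    show ?case
      using gsym0_scale[OF Nil, of "[]"] by (simp add: hproj_scale gproj_scale t.scale_right_distrib)
  next
    case (Cons x xs)
    show ?case
      by (simp add: Cons.IH gsym_shift[OF Cons.prems] t.scale_right_distrib)
  qed
  have 3: "gproj pr a F (xs @ x # y # ys) = sg (e + p * q) (gproj pr a F (xs @ y # x # ys))"
    if "gsym0 M e t F" and x: "x \<in> deg M p" and y: "y \<in> deg M q" for xs x y p q ys F a
    using that(1)
  proof (induction xs arbitrary: a F)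
    case Nil
    have "(\<lambda>X. F (x # y # X)) = (\<lambda>X. sg (e + p * q) (F (y # x # X)))"
      using gsym0_swap[OF Nil x y, of "[]"] by simp
    then show ?case
      by (simp only: append_Nil gproj_Cons[OF Nil x] gproj_Cons[OF Nil y]
          gproj_Cons[OF gsym_shift[OF Nil] x] gproj_Cons[OF gsym_shift[OF Nil] y])
        (simp add: gproj_sg ac_simps)
  next
    case (Cons z xs)
    show ?case
      by (simp add: Cons.IH gsym_shift[OF Cons.prems] sg_add)
  qed
  show ?thesis
    unfolding gsym_def singleton_iff diff_diff_eq right_minus_eq
    using 1[OF assms] 2[OF assms] 3[OF assms] by blast
qed

end

section \<open>Parity components of cochains\<close>

abbreviation vproj :: "bit \<Rightarrow> ('v list \<Rightarrow> 'v) \<Rightarrow> 'v list \<Rightarrow> 'v" where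
  "vproj \<equiv> gproj (hproj M)"

abbreviation asymV :: "('v list \<Rightarrow> 'v) \<Rightarrow> bool" where
  "asymV \<equiv> gsym0 M 1 (scl M)"

lemmas gsym_vproj = gsym_gproj[OF V.module_axioms module_hom_hproj]
lemmas vproj_homogeneous = gproj_homogeneous[OF V.module_axioms module_hom_hproj]

lemma gsym_vals_CV: "\<phi> \<in> CV M \<Longrightarrow> asymV (vals 1 \<phi>)"
  unfolding CV_def' by (rule gsym_vals[OF V.module_axioms])

lemma CV_of:
  assumes "asymV F" "F [] = 0"
  shows "hom_of 1 (scl M) F \<in> CV M" "vals 1 (hom_of 1 (scl M) F) = F"
  using assms unfolding CV_def' by (simp_all add: hom_of_in_Hom vals_hom_of V.module_axioms)

lemma cochain_of_list:
  assumes "asymV F" "F [] = 0" "\<And>ps vs. vs \<noteq> [] \<Longrightarrow> homogeneous M ps vs \<Longrightarrow> F vs = f ps vs"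
  shows "cochain_of M f \<in> CV M" "vals 1 (cochain_of M f) = F"
proof -
  have "cochain_of M f = hom_of 1 (scl M) F"
    by (rule cochain_of_eq[OF CV_of(1)[OF assms(1,2)]])
      (simp add: wedge_vals CV_of[OF assms(1,2)] assms(3))
  then show "cochain_of M f \<in> CV M" "vals 1 (cochain_of M f) = F"
    using CV_of[OF assms(1,2)] by simp_all
qed

lemma vproj_sum: "vproj 0 F vs + vproj 1 F vs = F vs" if "asymV F" for F
proof (cases "vs = []")
  case False
  have g: "asymV (\<lambda>vs. vproj 0 F vs + vproj 1 F vs)"
    by (intro gsym_add gsym_vproj that V.module_axioms V.subspace_single_0)
  show ?thesis
  proof (rule gsym0_eqI[OF g that _ False])
    fix ps vs assume vs: "homogeneous M ps vs"
    show "vproj 0 F vs + vproj 1 F vs = F vs"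
      using hproj_split[of "F vs"]
      by (cases "sum_list ps") (simp_all add: vproj_homogeneous[OF that vs] add.commute)
  qed
qed (simp add: hproj_split)

lemma
  assumes "\<phi> \<in> CV M"
  shows hpart_CV: "hpart M k a \<phi> \<in> CV M"
    and vals_hpart: "vals 1 (hpart M k a \<phi>) = (\<lambda>vs. if length vs = k then vproj a (vals 1 \<phi>) vs else 0)"
proof -
  let ?F = "\<lambda>vs. if length vs = k then vproj a (vals 1 \<phi>) vs else 0"
  have F: "asymV ?F"
    by (intro gsym_if_length[where P = "\<lambda>n. n = k"] gsym_vproj gsym_vals_CV assms
        V.module_axioms V.subspace_single_0)
  have "?F vs = (if length vs = k then hproj M (a + sum_list ps) (\<phi> (wedge M vs)) else 0)"
    if "vs \<noteq> []" "homogeneous M ps vs" for ps vs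
    using that by (simp add: vproj_homogeneous[OF gsym_vals_CV[OF assms]] wedge_vals)
  from cochain_of_list[OF F _ this] show "hpart M k a \<phi> \<in> CV M" "vals 1 (hpart M k a \<phi>) = ?F"
    unfolding hpart_def by simp_all
qed

text \<open>Modulo 2, \<open>of_nat (length vs) + 1\<close> is the shift k-1 in the total parity; in
  this form it is meaningful for the empty list as well.\<close>

definition tpar :: "bit \<Rightarrow> ('v list \<Rightarrow> 'v) \<Rightarrow> bool" where
  "tpar t F \<longleftrightarrow> (\<forall>ps vs. homogeneous M ps vs \<longrightarrow> F vs \<in> deg M (t + of_nat (length vs) + 1 + sum_list ps))"

lemma total_parity_iff: "total_parity M t \<phi> \<longleftrightarrow> tpar t (vals 1 \<phi>)"
proof -
  have n: "t - of_nat (length vs - 1) + s = t + of_nat (length vs) + 1 + s"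
    if "vs \<noteq> []" for vs :: "'v list" and s
    using that by (cases vs) (simp_all add: ac_simps)
  show ?thesis
    unfolding total_parity_def tpar_def
  proof (intro iffI allI impI)
    fix ps vs
    assume "\<forall>ps vs. vs \<noteq> [] \<and> homogeneous M ps vs \<longrightarrow> \<phi> (wedge M vs) \<in> deg M (t - of_nat (length vs - 1) + sum_list ps)"
      "homogeneous M ps vs"
    then show "vals 1 \<phi> vs \<in> deg M (t + of_nat (length vs) + 1 + sum_list ps)"
      using n[of vs "sum_list ps"] wedge_vals[of vs \<phi>] by (cases "vs = []") (simp, metis)
  next
    fix ps vs
    assume "\<forall>ps vs. homogeneous M ps vs \<longrightarrow> vals 1 \<phi> vs \<in> deg M (t + of_nat (length vs) + 1 + sum_list ps)"
      "vs \<noteq> [] \<and> homogeneous M ps vs"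
    then show "\<phi> (wedge M vs) \<in> deg M (t - of_nat (length vs - 1) + sum_list ps)"
      using n[of vs "sum_list ps"] wedge_vals[of vs \<phi>] by metis
  qed
qed

lemma tpar_hpart: "\<phi> \<in> CV M \<Longrightarrow> tpar (a + of_nat k + 1) (vals 1 (hpart M k a \<phi>))"
  unfolding tpar_def
proof (intro allI impI)
  fix ps vs assume "\<phi> \<in> CV M" and vs: "homogeneous M ps vs"
  have "a + of_nat (length vs) + 1 + of_nat (length vs) + 1 + sum_list ps = a + sum_list ps"
    by (cases "of_nat (length vs) :: bit") simp_all
  then show "vals 1 (hpart M k a \<phi>) vs \<in> deg M (a + of_nat k + 1 + of_nat (length vs) + 1 + sum_list ps)"
    using vproj_homogeneous[OF gsym_vals_CV[OF \<open>\<phi> \<in> CV M\<close>] vs]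
    by (auto simp: vals_hpart \<open>\<phi> \<in> CV M\<close>)
qed

abbreviation ext_sum :: "(bit \<times> 'v) list \<Rightarrow> ((bit \<times> 'v) list \<Rightarrow> (bit \<times> 'v) list \<Rightarrow> 'v) \<Rightarrow> 'v" where
  "ext_sum \<equiv> shuffle_sum (\<lambda>a b. 1 + a * b)"

lemma circ_sum:
  assumes "\<phi> \<in> CV M" "\<psi> \<in> CV M" "homogeneous M ps vs"
  shows "(\<Sum>j = 1..length vs. \<Sum>\<sigma>\<in>Sh j (length vs - j).
         scl M (of_int (sign \<sigma> * koszul \<sigma> ps))
           (\<phi> (wedge M (\<psi> (wedge M (take j (permute_list \<sigma> vs))) # drop j (permute_list \<sigma> vs)))))
    = ext_sum (zip ps vs) (\<lambda>A B. vals 1 \<phi> (vals 1 \<psi> (map snd A) # map snd B))"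
proof -
  have len: "length ps = length vs" by (rule homogeneous_length[OF assms(3)])
  have z: "vals 1 \<phi> (vals 1 \<psi> [] # B) = 0" for B
    using gsym0_zero[OF gsym_vals_CV[OF assms(1)], of "[]"] by simp
  show ?thesis
    unfolding sum_Sh[where H = "\<lambda>A B. vals 1 \<phi> (vals 1 \<psi> A # B)", OF V.module_axioms len z, symmetric]
  proof (intro sum.cong refl)
    fix j \<sigma> assume j: "j \<in> {1..length vs}" "\<sigma> \<in> Sh j (length vs - j)"
    then have "length (take j (permute_list \<sigma> vs)) = j" "j > 0" by auto
    then have ne: "take j (permute_list \<sigma> vs) \<noteq> []" by force
    have "sign \<sigma> * koszul \<sigma> ps = psign (invsum (\<lambda>a b. 1 + a * b) \<sigma> ps)"
      using j by (intro sign_koszul[of _ j "length vs"]) (simp_all add: Sh_eq_unshuffles len)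
    then show "scl M (of_int (sign \<sigma> * koszul \<sigma> ps))
           (\<phi> (wedge M (\<psi> (wedge M (take j (permute_list \<sigma> vs))) # drop j (permute_list \<sigma> vs))))
        = sg (invsum (\<lambda>a b. 1 + a * b) \<sigma> ps)
            (vals 1 \<phi> (vals 1 \<psi> (take j (permute_list \<sigma> vs)) # drop j (permute_list \<sigma> vs)))"
      using ne by (simp add: wedge_vals module_psign V.module_axioms)
  qed
qed

end


section \<open>The bracket\<close>

lemma shuffle_sum_map:
  "shuffle_sum c (map (map_prod h id) xs) F
    = shuffle_sum (\<lambda>a b. c (h a) (h b)) xs (\<lambda>A B. F (map (map_prod h id) A) (map (map_prod h id) B))"
  by (induction xs arbitrary: F) (simp_all add: comp_def)

context shifted
begin

text \<open>The circle product on the exterior side is, up to sign, a composite of corestrictions on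
  the symmetric side. With n arguments, t + j + 1 is the parity of \<psi>_j itself and n + j is
  modulo 2 the number k-1 of further arguments of \<phi>, so the sign is the factor
  (-1)^((k-1)|\<psi>_j|) of {\<phi>, \<psi>}. The support condition makes \<open>j\<close> a
  constant; it can come from \<psi> or from \<phi>.\<close>

lemma ext_sum_cod:
  assumes \<phi>: "asymV \<phi>" and \<psi>: "asymV \<psi>" and t: "tpar t \<psi>" and vs: "homogeneous M ps vs"
    and supp: "\<And>A B. length A \<noteq> j \<Longrightarrow> length A + length B = length vs \<Longrightarrow> \<phi> (\<psi> A # B) = 0"
  shows "ext_sum (zip ps vs) (\<lambda>A B. \<phi> (\<psi> (map snd A) # map snd B))
    = sg ((t + of_nat j + 1) * (of_nat (length vs) + of_nat j))
        (ext (scl M) (\<lambda>vs. \<phi> (etal 0 vs)) (W.cod t (\<lambda>vs. \<psi> (etal 0 vs)) (etal 0 vs)))"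
proof -
  let ?\<phi> = "\<lambda>vs. \<phi> (etal 0 vs)" and ?\<psi> = "\<lambda>vs. \<psi> (etal 0 vs)"
  let ?xs = "zip ps vs" and ?f = "map_prod (\<lambda>p. p + 1) id :: bit \<times> 'v \<Rightarrow> bit \<times> 'v"
  have len: "length ps = length vs" by (rule homogeneous_length[OF vs])
  have \<phi>W: "W.gsymV ?\<phi>" and \<psi>W: "W.gsymV ?\<psi>"
    using gsym_etal_W[OF \<phi> V.module_axioms V.subspace_single_0]
      gsym_etal_W[OF \<psi> V.module_axioms V.subspace_single_0] by simp_all
  note ev = gsym0_etal_homogeneous[OF _ V.module_axioms]
  have parW: "W.par t ?\<psi>"
    unfolding W.par_def
  proof (intro allI impI)
    fix qs ws assume "homogeneous (\<Pi> M) qs ws"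
    then have ws: "homogeneous M (map (\<lambda>p. p + 1) qs) ws"
      by (simp add: homogeneous_shift)
    have len: "length ws = length qs"
      using homogeneous_length[OF ws] by simp
    have sum: "sum_list (map (\<lambda>p. p + 1) qs) = sum_list qs + of_nat (length qs)" for qs :: "bit list"
      by (induction qs) (simp_all add: ac_simps)
    have "\<psi> ws \<in> deg M (t + of_nat (length ws) + 1 + sum_list (map (\<lambda>p. p + 1) qs))"
      using t ws by (simp add: tpar_def)
    also have "t + of_nat (length ws) + 1 + sum_list (map (\<lambda>p. p + 1) qs) = t + sum_list qs + 1"
      unfolding sum len by (cases "of_nat (length qs) :: bit") (simp_all add: ac_simps)
    finally show "?\<psi> ws \<in> deg (\<Pi> M) (t + sum_list qs)"
      using ev[OF \<psi> refl ws] by (simp add: deg_sg)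
  qed
  let ?G = "\<lambda>ws. ext (scl M) ?\<phi> (W.cod t ?\<psi> ws)"
  have "v \<in> deg M p" if "(p, v) \<in> set ?xs" for p v
    using homs_zip[OF vs] that unfolding homs_iff by blast
  then have "W.homs (map ?f ?xs)"
    unfolding W.homs_iff by (auto simp: add.assoc)
  from W.ext_cod_shuffle0[OF _ \<phi>W \<psi>W parW this]
  have "?G vs = shuffle_sum (*) (map ?f ?xs) (\<lambda>A B. ?\<phi> (?\<psi> (map snd A) # map snd B))"
    using len by (simp add: V.module_axioms comp_def)
  also have "\<dots> = shuffle_sum (\<lambda>a b. (a + 1) * (b + 1)) ?xs (\<lambda>A B. ?\<phi> (?\<psi> (map snd A) # map snd B))"
    unfolding shuffle_sum_map by (simp add: comp_def)
  also have "\<dots> = shuffle_sum (\<lambda>a b. (a + 1) * (b + 1)) ?xs (\<lambda>A B.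
      sg ((t + of_nat j + 1) * (of_nat (length vs) + of_nat j))
        (sg (etasign (map fst (A @ B))) (\<phi> (\<psi> (map snd A) # map snd B))))"
  proof (rule shuffle_sum_cong)
    fix A B assume AB: "set A \<union> set B \<subseteq> set ?xs" "length A + length B = length ?xs"
    have A: "homogeneous M (map fst A) (map snd A)" and B: "homogeneous M (map fst B) (map snd B)"
      using homs_zip[OF vs] AB(1) unfolding homs_def[symmetric] homs_iff by blast+
    let ?v = "\<psi> (map snd A)" and ?b = "t + of_nat (length A) + 1 + sum_list (map fst A)"
    have v: "?v \<in> deg M ?b"
      using t A unfolding tpar_def by (metis length_map)
    have e1: "?\<psi> (map snd A) = sg (etasign (map fst A)) ?v"
      by (rule ev[OF \<psi> refl A])
    then have "?\<psi> (map snd A) \<in> deg M ?b"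
      using v by (simp add: deg_sg)
    then have "homogeneous M (?b # map fst B) (?\<psi> (map snd A) # map snd B)"
      using B by simp
    from ev[OF \<phi> refl this]
    have "?\<phi> (?\<psi> (map snd A) # map snd B)
        = sg (of_nat (length B) * ?b + etasign (map fst B)) (\<phi> (sg (etasign (map fst A)) ?v # map snd B))"
      by (simp add: e1)
    also have "\<phi> (sg (etasign (map fst A)) ?v # map snd B) = sg (etasign (map fst A)) (\<phi> (?v # map snd B))"
      using gsym_sg_mod[OF \<phi> V.module_axioms refl, of "[]"] by simp
    finally have eq: "?\<phi> (?\<psi> (map snd A) # map snd B)
        = sg (of_nat (length B) * ?b + etasign (map fst B) + etasign (map fst A)) (\<phi> (?v # map snd B))"
      by simp
    show "?\<phi> (?\<psi> (map snd A) # map snd B) = sg ((t + of_nat j + 1) * (of_nat (length vs) + of_nat j))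
        (sg (etasign (map fst (A @ B))) (\<phi> (\<psi> (map snd A) # map snd B)))"
    proof (cases "length A = j")
      case True
      have "of_nat (length vs) = (of_nat (length A + length B) :: bit)"
        using AB(2) len by simp
      then have n: "of_nat (length B) = of_nat (length vs) + (of_nat j :: bit)"
        unfolding True[symmetric] by simp
      show ?thesis
        unfolding eq True n[symmetric] sg_sg
        by (simp add: etasign_append algebra_simps)
    next
      case False
      then have "\<phi> (?v # map snd B) = 0"
        using AB(2) len by (intro supp) simp_all
      then show ?thesis
        unfolding eq by simp
    qed
  qed
  also have "\<dots> = sg ((t + of_nat j + 1) * (of_nat (length vs) + of_nat j))
      (sg (etasign ps) (ext_sum ?xs (\<lambda>A B. \<phi> (\<psi> (map snd A) # map snd B))))"
    unfolding shuffle_sum_shift shuffle_sum_sg using len by simp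
  finally have "?G vs = sg ((t + of_nat j + 1) * (of_nat (length vs) + of_nat j))
      (sg (etasign ps) (ext_sum ?xs (\<lambda>A B. \<phi> (\<psi> (map snd A) # map snd B))))" .
  moreover have "?G (etal 0 vs) = sg (etasign ps) (?G vs)"
  proof (rule ev[OF _ _ vs])
    show "gsym0 (\<Pi> M) 0 (scl M) ?G"
      using W.gsym_ext_cod[OF \<phi>W \<psi>W] by simp
  qed simp
  ultimately show ?thesis
    by (simp add: ac_simps)
qed

text \<open>What has to be shown is that the unshuffle sum is graded antisymmetric, so that the
  description in \<open>circ\<close> has a solution. The solution is written through
  \<open>etal\<close> as a composite on the symmetric side, whose symmetry is known.\<close>

lemma
  assumes \<phi>: "\<phi> \<in> CV M" and \<psi>: "\<psi> \<in> CV M" and t: "tpar t (vals 1 \<psi>)"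
    and supp: "\<And>vs. length vs \<noteq> j \<Longrightarrow> vals 1 \<psi> vs = 0"
  shows circ_CV: "circ M \<phi> \<psi> \<in> CV M"
    and vals_circ: "vs \<noteq> [] \<Longrightarrow> homogeneous M ps vs \<Longrightarrow> vals 1 (circ M \<phi> \<psi>) vs
      = ext_sum (zip ps vs) (\<lambda>A B. vals 1 \<phi> (vals 1 \<psi> (map snd A) # map snd B))"
proof -
  let ?\<phi> = "vals 1 \<phi>" and ?\<psi> = "vals 1 \<psi>"
  note g\<phi> = gsym_vals_CV[OF \<phi>] and g\<psi> = gsym_vals_CV[OF \<psi>]
  let ?G = "\<lambda>vs. ext (scl M) (\<lambda>vs. ?\<phi> (etal 0 vs)) (W.cod t (\<lambda>vs. ?\<psi> (etal 0 vs)) (etal 0 vs))"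
  let ?F = "\<lambda>vs. if length vs \<noteq> 0 then sg ((t + of_nat j + 1) * (of_nat (length vs) + of_nat j)) (?G vs) else 0"
  have "W.gsymV (\<lambda>vs. ?\<phi> (etal 0 vs))" "W.gsymV (\<lambda>vs. ?\<psi> (etal 0 vs))"
    using gsym_etal_W[OF g\<phi> V.module_axioms V.subspace_single_0]
      gsym_etal_W[OF g\<psi> V.module_axioms V.subspace_single_0] by simp_all
  from gsym_etal_V[OF W.gsym_ext_cod[OF this]] have "asymV ?G"
    by (simp add: V.module_axioms)
  then have F: "asymV ?F"
    by (intro gsym_if_length[where P = "\<lambda>n. n \<noteq> 0"] V.module_axioms V.subspace_single_0
        gsym_sg[where a = "\<lambda>n. (t + of_nat j + 1) * (of_nat n + of_nat j)"])
  have val: "?F vs = ext_sum (zip ps vs) (\<lambda>A B. ?\<phi> (?\<psi> (map snd A) # map snd B))"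
    if "vs \<noteq> []" "homogeneous M ps vs" for ps vs
    using that
    by (subst ext_sum_cod[OF g\<phi> g\<psi> t, where j = j])
      (simp_all add: supp gsym0_zero[OF g\<phi>, of "[]", simplified])
  have nil: "?F [] = 0" by simp
  have eq: "?F vs = (\<Sum>j = 1..length vs. \<Sum>\<sigma>\<in>Sh j (length vs - j).
         scl M (of_int (sign \<sigma> * koszul \<sigma> ps))
           (\<phi> (wedge M (\<psi> (wedge M (take j (permute_list \<sigma> vs))) # drop j (permute_list \<sigma> vs)))))"
    if "vs \<noteq> []" "homogeneous M ps vs" for ps vs
    unfolding circ_sum[OF \<phi> \<psi> that(2)] by (rule val[OF that])
  have c: "circ M \<phi> \<psi> \<in> CV M" "vals 1 (circ M \<phi> \<psi>) = ?F"
    unfolding circ_def by (rule cochain_of_list[OF F nil], erule (1) eq)+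
  show "circ M \<phi> \<psi> \<in> CV M" by (rule c(1))
  show "vals 1 (circ M \<phi> \<psi>) vs
      = ext_sum (zip ps vs) (\<lambda>A B. vals 1 \<phi> (vals 1 \<psi> (map snd A) # map snd B))"
    if "vs \<noteq> []" "homogeneous M ps vs"
    unfolding c(2) by (rule val[OF that])
qed

lemma
  assumes \<phi>: "\<phi> \<in> CV M" and \<psi>: "\<psi> \<in> CV M"
  defines "\<phi>' k a \<equiv> hpart M k a \<phi>" and "\<psi>' j b \<equiv> hpart M j b \<psi>"
  shows hbracket_CV: "hbracket M k a j b (\<phi>' k a) (\<psi>' j b) \<in> CV M"
    and vals_hbracket: "vs \<noteq> [] \<Longrightarrow> homogeneous M ps vs \<Longrightarrow> vals 1 (hbracket M k a j b (\<phi>' k a) (\<psi>' j b)) vs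
      = sg (of_nat (k - 1) * b)
        (ext_sum (zip ps vs) (\<lambda>A B. vals 1 (\<phi>' k a) (vals 1 (\<psi>' j b) (map snd A) # map snd B))
         - sg (a * b + of_nat (k - 1) * of_nat (j - 1))
           (ext_sum (zip ps vs) (\<lambda>A B. vals 1 (\<psi>' j b) (vals 1 (\<phi>' k a) (map snd A) # map snd B))))"
proof -
  have \<phi>': "\<phi>' k a \<in> CV M" "tpar (a + of_nat k + 1) (vals 1 (\<phi>' k a))"
    "\<And>vs. length vs \<noteq> k \<Longrightarrow> vals 1 (\<phi>' k a) vs = 0"
    unfolding \<phi>'_def by (rule hpart_CV[OF \<phi>], rule tpar_hpart[OF \<phi>], simp add: vals_hpart[OF \<phi>])
  have \<psi>': "\<psi>' j b \<in> CV M" "tpar (b + of_nat j + 1) (vals 1 (\<psi>' j b))"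
    "\<And>vs. length vs \<noteq> j \<Longrightarrow> vals 1 (\<psi>' j b) vs = 0"
    unfolding \<psi>'_def by (rule hpart_CV[OF \<psi>], rule tpar_hpart[OF \<psi>], simp add: vals_hpart[OF \<psi>])
  have eq: "hbracket M k a j b (\<phi>' k a) (\<psi>' j b) = (\<lambda>X. sg (of_nat (k - 1) * b)
      (circ M (\<phi>' k a) (\<psi>' j b) X - sg (a * b + of_nat (k - 1) * of_nat (j - 1)) (circ M (\<psi>' j b) (\<phi>' k a) X)))"
    by (simp add: hbracket_def hcomm_def module_psign V.module_axioms)
  note c1 = circ_CV[OF \<phi>'(1) \<psi>'] and c2 = circ_CV[OF \<psi>'(1) \<phi>']
  show "hbracket M k a j b (\<phi>' k a) (\<psi>' j b) \<in> CV M"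
    unfolding eq using c1 c2 unfolding CV_def' by (intro Hom_sg Hom_diff V.module_axioms)
  show "vals 1 (hbracket M k a j b (\<phi>' k a) (\<psi>' j b)) vs
      = sg (of_nat (k - 1) * b)
        (ext_sum (zip ps vs) (\<lambda>A B. vals 1 (\<phi>' k a) (vals 1 (\<psi>' j b) (map snd A) # map snd B))
         - sg (a * b + of_nat (k - 1) * of_nat (j - 1))
           (ext_sum (zip ps vs) (\<lambda>A B. vals 1 (\<psi>' j b) (vals 1 (\<phi>' k a) (map snd A) # map snd B))))"
    if "vs \<noteq> []" "homogeneous M ps vs"
    using vals_circ[OF \<phi>'(1) \<psi>' that] vals_circ[OF \<psi>'(1) \<phi>' that] that(1)
    unfolding eq by (simp add: vals_def)
qed

lemma
  assumes \<phi>: "\<phi> \<in> CV M" and \<psi>: "\<psi> \<in> CV M"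
  shows bracket_CV: "bracket M \<phi> \<psi> \<in> CV M"
    and vals_bracket: "vals 1 (bracket M \<phi> \<psi>) vs = (\<Sum>k = 1..length vs. \<Sum>a\<in>{0, 1}. \<Sum>b\<in>{0, 1}.
        vals 1 (hbracket M k a (length vs + 1 - k) b (hpart M k a \<phi>) (hpart M (length vs + 1 - k) b \<psi>)) vs)"
proof -
  let ?F = "\<lambda>n vs. \<Sum>k = 1..n. \<Sum>a\<in>{0, 1}. \<Sum>b\<in>{0, 1}.
        vals 1 (hbracket M k a (n + 1 - k) b (hpart M k a \<phi>) (hpart M (n + 1 - k) b \<psi>)) vs"
  \<comment> \<open>For fixed \<open>n\<close> this is a finite sum of cochains; only afterwards is
    \<open>n\<close> set to the length of the argument.\<close>
  have "asymV (?F n)" for n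
    by (intro gsym_sum gsym_vals_CV hbracket_CV \<phi> \<psi> V.module_axioms V.subspace_single_0)
  then have "asymV (\<lambda>vs. ?F (length vs) vs)"
    by (rule gsym_cong_length)
  note c = cochain_of_list[OF this]
  have "bracket M \<phi> \<psi> \<in> CV M \<and> vals 1 (bracket M \<phi> \<psi>) = (\<lambda>vs. ?F (length vs) vs)"
    unfolding bracket_def by (intro conjI c) (simp_all add: wedge_vals Let_def)
  then show "bracket M \<phi> \<psi> \<in> CV M" "vals 1 (bracket M \<phi> \<psi>) vs = ?F (length vs) vs"
    by simp_all
qed

end

section \<open>The differential of a Lie algebra\<close>

text \<open>The blocks are tracked as multisets, so that their lengths and parities add up to those
  of the whole word.\<close>

lemma shuffle_sum_mem:
  assumes t: "module t" "module.subspace t N"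
    and "\<And>A B. mset A + mset B = mset xs \<Longrightarrow> F A B \<in> N"
  shows "shuffle_sum c xs F \<in> N"
  using assms(3)
proof (induction xs arbitrary: F)
  case (Cons x xs)
  interpret module t by fact
  show ?case
    unfolding shuffle_sum.simps
    by (intro subspace_add subspace_sg t(2) Cons.IH Cons.prems) simp_all
qed simp

lemma (in graded) twist_zero [simp]: "twist a 0 = 0"
  by (simp add: twist_def)

locale lie_algebra = shifted M for M :: "('k::comm_ring_1, 'v::ab_group_add) smodule" +
  fixes l :: "('k, 'v) cochain"
  assumes lie: "lie_structure M l"
begin

section \<open>The bracket with the Lie structure\<close>

lemma l_CV: "l \<in> CV M"
  using lie by (simp add: lie_structure_def)

abbreviation L :: "'v list \<Rightarrow> 'v" where
  "L \<equiv> vals 1 l"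

lemmas asym_L = gsym_vals_CV[OF l_CV]

lemma L_zero: "length vs \<noteq> 2 \<Longrightarrow> L vs = 0"
  using lie by (cases "vs = []") (simp_all add: lie_structure_def flip: wedge_vals)

lemma L_deg: "homogeneous M ps vs \<Longrightarrow> L vs \<in> deg M (sum_list ps)"
proof (cases "length vs = 2")
  case True
  assume vs: "homogeneous M ps vs"
  then obtain v w p q where "vs = [v, w]" "ps = [p, q]" "v \<in> deg M p" "w \<in> deg M q"
    using True homogeneous_length[OF vs]
    by (auto simp: numeral_2_eq_2 length_Suc_conv)
  then show ?thesis
    using lie by (simp add: lie_structure_def flip: wedge_vals)
qed (simp add: L_zero)

lemma tpar_L: "tpar 1 L"
  unfolding tpar_def
proof (intro allI impI)
  fix ps vs assume "homogeneous M ps vs"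
  then show "L vs \<in> deg M (1 + of_nat (length vs) + 1 + sum_list ps)"
    using L_deg by (cases "length vs = 2") (simp_all add: L_zero)
qed

lemma vals_hpart_L: "vals 1 (hpart M j b l) = (if j = 2 \<and> b = 0 then L else (\<lambda>_. 0))"
proof
  fix vs :: "'v list"
  let ?R = "if j = 2 \<and> b = 0 then L else (\<lambda>_. 0)"
  have g: "asymV ?R"
    using asym_L gsym_zero[OF V.module_axioms V.subspace_single_0, of M 1] by simp
  have "vals 1 (hpart M j b l) vs = ?R vs" if "vs \<noteq> []"
  proof (rule gsym0_eqI[OF gsym_vals_CV[OF hpart_CV[OF l_CV]] g _ that])
    fix ps vs assume vs: "homogeneous M ps vs"
    show "vals 1 (hpart M j b l) vs = ?R vs"
      using L_deg[OF vs] L_zero[of vs]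
      by (auto simp: vals_hpart[OF l_CV] vproj_homogeneous[OF asym_L vs] hproj_homogeneous)
  qed
  then show "vals 1 (hpart M j b l) vs = ?R vs"
    by (cases "vs = []") (auto simp: vals_def)
qed

lemma vals_zero_front: "\<phi> \<in> CV M \<Longrightarrow> vals 1 \<phi> (0 # vs) = 0"
  using gsym0_zero[OF gsym_vals_CV, of \<phi> "[]"] by simp

text \<open>As \<open>l\<close> is even and of arity 2, only b = 0, j = 2 and k = n-1 contribute.
  The outer sign is then trivial, the inner exponent (k-1)(j-1) = n-2 is n modulo 2, and the two
  parity parts of \<phi> add up to \<phi>.\<close>

lemma vals_bracket_l:
  assumes \<phi>: "\<phi> \<in> CV M" and ne: "vs \<noteq> []" and vs: "homogeneous M ps vs"
  shows "vals 1 (bracket M \<phi> l) vs = ext_sum (zip ps vs) (\<lambda>A B. vals 1 \<phi> (L (map snd A) # map snd B))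
    - sg (of_nat (length vs)) (ext_sum (zip ps vs) (\<lambda>A B. L (vals 1 \<phi> (map snd A) # map snd B)))"
proof -
  define n where "n = length vs"
  let ?xs = "zip ps vs"
  have len: "length ?xs = n"
    using homogeneous_length[OF vs] by (simp add: n_def)
  have "n > 0" using ne by (simp add: n_def)
  let ?\<phi> = "\<lambda>k a. vals 1 (hpart M k a \<phi>)"
  let ?S1 = "\<lambda>\<phi>. ext_sum ?xs (\<lambda>A B. \<phi> (L (map snd A) # map snd B))"
  let ?S2 = "\<lambda>\<phi>. ext_sum ?xs (\<lambda>A B. L (\<phi> (map snd A) # map snd B))"
  let ?r = "\<lambda>k vs. if length vs = k then vals 1 \<phi> vs else 0"
  let ?T = "\<lambda>k a b. vals 1 (hbracket M k a (n + 1 - k) b (hpart M k a \<phi>) (hpart M (n + 1 - k) b l)) vs"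
  have L0: "L (0 # B) = 0" for B by (rule vals_zero_front[OF l_CV])
  have T: "?T k a b = (if k + 1 = n \<and> b = 0 then ?S1 (?\<phi> k a) - sg (of_nat n) (?S2 (?\<phi> k a)) else 0)"
    if "k \<in> {1..n}" for k a b
  proof -
    have iff: "n + 1 - k = 2 \<longleftrightarrow> k + 1 = n" using that by auto
    show ?thesis
    proof (cases "k + 1 = n \<and> b = 0")
      case True
      then have "of_nat (k - 1) = (of_nat n :: bit)"
        using that by (cases k) auto
      with True show ?thesis
        using iff by (simp add: vals_hbracket[OF \<phi> l_CV ne vs] vals_hpart_L)
    next
      case False
      then have z: "vals 1 (hpart M (n + 1 - k) b l) = (\<lambda>_. 0)"
        using iff by (auto simp: vals_hpart_L)
      show ?thesis
        using False unfolding vals_hbracket[OF \<phi> l_CV ne vs] z vals_zero_front[OF hpart_CV[OF \<phi>]]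
        by auto
    qed
  qed
  \<comment> \<open>The surviving sign does not involve the parity a, so both parts of \<phi> can be
    recombined.\<close>
  have sum_a: "?S1 (?\<phi> k 0) + ?S1 (?\<phi> k 1) = ?S1 (?r k)" "?S2 (?\<phi> k 0) + ?S2 (?\<phi> k 1) = ?S2 (?r k)" for k
  proof -
    have r: "?r k us = ?\<phi> k 0 us + ?\<phi> k 1 us" for us
      using vproj_sum[OF gsym_vals_CV[OF \<phi>], of us] by (simp add: vals_hpart[OF \<phi>])
    then show "?S1 (?\<phi> k 0) + ?S1 (?\<phi> k 1) = ?S1 (?r k)"
      unfolding shuffle_sum_add[symmetric] by (simp only:)
    have "L ((x + y) # B) = L (x # B) + L (y # B)" for x y B
      using gsym0_add[OF asym_L, of "[]"] by simp
    then show "?S2 (?\<phi> k 0) + ?S2 (?\<phi> k 1) = ?S2 (?r k)"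
      unfolding r shuffle_sum_add[symmetric] by simp
  qed
  have "vals 1 (bracket M \<phi> l) vs = (\<Sum>k = 1..n. \<Sum>a\<in>{0, 1}. \<Sum>b\<in>{0, 1}. ?T k a b)"
    unfolding vals_bracket[OF \<phi> l_CV] n_def ..
  also have "\<dots> = (\<Sum>k = 1..n. if k + 1 = n then ?S1 (?r k) - sg (of_nat n) (?S2 (?r k)) else 0)"
  proof (rule sum.cong)
    fix k assume k: "k \<in> {1..n}"
    show "(\<Sum>a\<in>{0, 1}. \<Sum>b\<in>{0, 1}. ?T k a b) = (if k + 1 = n then ?S1 (?r k) - sg (of_nat n) (?S2 (?r k)) else 0)"
      unfolding T[OF k] sum_a[symmetric] by (simp add: sg_add)
  qed simp
  also have "\<dots> = (if n = 1 then 0 else ?S1 (?r (n - 1)) - sg (of_nat n) (?S2 (?r (n - 1))))"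
  proof (cases "n = 1")
    case False
    have "(\<Sum>k = 1..n. if k + 1 = n then ?S1 (?r k) - sg (of_nat n) (?S2 (?r k)) else 0)
      = (\<Sum>k = 1..n. if k = n - 1 then ?S1 (?r (n - 1)) - sg (of_nat n) (?S2 (?r (n - 1))) else 0)"
      using \<open>n > 0\<close> by (intro sum.cong) auto
    moreover have "Suc 0 \<le> n - Suc 0" using False \<open>n > 0\<close> by simp
    ultimately show ?thesis
      using False by simp
  qed simp
  also have "\<dots> = ?S1 (vals 1 \<phi>) - sg (of_nat n) (?S2 (vals 1 \<phi>))"
  proof (cases "n = 1")
    \<comment> \<open>For a single argument the sum over k has no term with k = n-1; on the
      right-hand side every term meets \<open>L\<close> with a wrong number of arguments or with a
      zero argument.\<close>
    case True
    have "?S1 (vals 1 \<phi>) = ext_sum ?xs (\<lambda>A B. 0)"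
      by (rule shuffle_sum_cong) (use len True in \<open>simp add: L_zero vals_zero_front[OF \<phi>]\<close>)
    moreover have "?S2 (vals 1 \<phi>) = ext_sum ?xs (\<lambda>A B. 0)"
    proof (rule shuffle_sum_cong)
      fix A B :: "(bit \<times> 'v) list" assume "length A + length B = length ?xs"
      then show "L (vals 1 \<phi> (map snd A) # map snd B) = 0"
        using len True by (cases A) (simp_all add: L0 L_zero)
    qed
    ultimately show ?thesis using True by simp
  next
    case False
    have "?S1 (?r (n - 1)) = ?S1 (vals 1 \<phi>)"
    proof (rule shuffle_sum_cong)
      fix A B :: "(bit \<times> 'v) list" assume AB: "length A + length B = length ?xs"
      show "?r (n - 1) (L (map snd A) # map snd B) = vals 1 \<phi> (L (map snd A) # map snd B)"
        using AB len by (cases "length A = 2") (auto simp: L_zero vals_zero_front[OF \<phi>])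
    qed
    moreover have "?S2 (?r (n - 1)) = ?S2 (vals 1 \<phi>)"
    proof (rule shuffle_sum_cong)
      fix A B :: "(bit \<times> 'v) list" assume AB: "length A + length B = length ?xs"
      show "L (?r (n - 1) (map snd A) # map snd B) = L (vals 1 \<phi> (map snd A) # map snd B)"
        using AB len by (cases "length B = 1") (auto simp: L_zero)
    qed
    ultimately show ?thesis using False by simp
  qed
  finally show ?thesis by (simp only: n_def)
qed

lemma bracket_l_CV: "\<phi> \<in> CV M \<Longrightarrow> bracket M \<phi> l \<in> CV M"
  by (rule bracket_CV[OF _ l_CV])

lemma bracket_l_add:
  assumes "\<phi> \<in> CV M" "\<psi> \<in> CV M"
  shows "bracket M (\<lambda>X. \<phi> X + \<psi> X) l X = bracket M \<phi> l X + bracket M \<psi> l X"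
proof -
  have s: "(\<lambda>X. \<phi> X + \<psi> X) \<in> CV M"
    using assms unfolding CV_def' by (intro Hom_add V.module_axioms)
  have v: "vals 1 (\<lambda>X. \<phi> X + \<psi> X) vs = vals 1 \<phi> vs + vals 1 \<psi> vs" for vs
    by (simp add: vals_def)
  have L: "L ((x + y) # B) = L (x # B) + L (y # B)" for x y B
    using gsym0_add[OF asym_L, of "[]"] by simp
  have "bracket M (\<lambda>X. \<phi> X + \<psi> X) l = (\<lambda>X. bracket M \<phi> l X + bracket M \<psi> l X)"
  proof (rule CV_eqI[OF bracket_l_CV[OF s]])
    show "(\<lambda>X. bracket M \<phi> l X + bracket M \<psi> l X) \<in> CV M"
      using assms[THEN bracket_l_CV] unfolding CV_def' by (intro Hom_add V.module_axioms)
    fix ps vs assume "vs \<noteq> []" "homogeneous M ps vs"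
    then show "bracket M (\<lambda>X. \<phi> X + \<psi> X) l (wedge M vs) = bracket M \<phi> l (wedge M vs) + bracket M \<psi> l (wedge M vs)"
      by (simp add: wedge_vals vals_bracket_l s assms v L shuffle_sum_add sg_add)
  qed
  then show ?thesis by simp
qed

lemma bracket_l_uminus:
  assumes "\<phi> \<in> CV M"
  shows "bracket M (\<lambda>X. - \<phi> X) l X = - bracket M \<phi> l X"
proof -
  have s: "(\<lambda>X. - \<phi> X) \<in> CV M"
    using assms unfolding CV_def' by (intro Hom_uminus V.module_axioms)
  have v: "vals 1 (\<lambda>X. - \<phi> X) vs = - vals 1 \<phi> vs" for vs
    by (simp add: vals_def)
  have L: "L (- x # B) = - L (x # B)" for x B
    using gsym_sg_mod[OF asym_L V.module_axioms refl, of "[]" 1 x B]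
    by (simp only: append_Nil singleton_iff right_minus_eq sg_1)
  have S: "ext_sum xs (\<lambda>A B. - F A B) = - ext_sum xs F" for xs F
    using shuffle_sum_sg[of _ xs 1 F] by simp
  have "bracket M (\<lambda>X. - \<phi> X) l = (\<lambda>X. - bracket M \<phi> l X)"
  proof (rule CV_eqI[OF bracket_l_CV[OF s]])
    show "(\<lambda>X. - bracket M \<phi> l X) \<in> CV M"
      using bracket_l_CV[OF assms] unfolding CV_def' by (intro Hom_uminus V.module_axioms)
    fix ps vs assume "vs \<noteq> []" "homogeneous M ps vs"
    then show "bracket M (\<lambda>X. - \<phi> X) l (wedge M vs) = - bracket M \<phi> l (wedge M vs)"
      by (simp add: wedge_vals vals_bracket_l s assms v L S sg_uminus)
  qed
  then show ?thesis by simp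
qed

lemma bracket_l_zero: "bracket M (\<lambda>X. 0) l X = 0"
proof -
  have "(\<lambda>X. 0) \<in> CV M"
    unfolding CV_def' by (rule Hom_zero[OF V.module_axioms])
  from bracket_l_add[OF this this, of X] show ?thesis by simp
qed

text \<open>An even cochain of arity 2 has total parity 1. Each term vanishes unless its blocks have
  the lengths that \<open>L\<close> demands, and for those the parities are counted.\<close>

lemma tpar_bracket_l:
  assumes \<phi>: "\<phi> \<in> CV M" and t: "tpar t (vals 1 \<phi>)"
  shows "tpar (t + 1) (vals 1 (bracket M \<phi> l))"
  unfolding tpar_def
proof (intro allI impI)
  fix ps vs assume vs: "homogeneous M ps vs"
  let ?xs = "zip ps vs" and ?n = "length vs"
  let ?D = "deg M (t + 1 + of_nat ?n + 1 + sum_list ps)"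
  have len: "length ?xs = ?n"
    using homogeneous_length[OF vs] by simp
  have AB: "homogeneous M (map fst A) (map snd A) \<and> homogeneous M (map fst B) (map snd B)
      \<and> length A + length B = ?n \<and> sum_list (map fst A) + sum_list (map fst B) = sum_list ps"
    if "mset A + mset B = mset ?xs" for A B
  proof -
    have "set A \<union> set B = set ?xs"
      using that by (metis set_mset_mset set_mset_union)
    then have "homogeneous M (map fst A) (map snd A)" "homogeneous M (map fst B) (map snd B)"
      using homs_zip[OF vs] unfolding homs_def[symmetric] homs_iff by blast+
    moreover have "length A + length B = ?n"
      using arg_cong[OF that, of size] len by simp
    moreover have "sum_list (map fst A) + sum_list (map fst B) = sum_list (map fst ?xs)"
      using arg_cong[OF that, of "\<lambda>m. sum_mset (image_mset fst m)"]
      by (simp flip: mset_map sum_mset_sum_list)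
    ultimately show ?thesis
      using homogeneous_length[OF vs] by simp
  qed
  show "vals 1 (bracket M \<phi> l) vs \<in> ?D"
  proof (cases "vs = []")
    case False
    have "ext_sum ?xs (\<lambda>A B. vals 1 \<phi> (L (map snd A) # map snd B)) \<in> ?D"
    proof (rule shuffle_sum_mem[OF V.module_axioms subspace_deg])
      fix A B assume "mset A + mset B = mset ?xs"
      note * = AB[OF this]
      show "vals 1 \<phi> (L (map snd A) # map snd B) \<in> ?D"
      proof (cases "length A = 2")
        case True
        have n: "of_nat (length B) = (of_nat ?n :: bit)"
          using * True by (metis of_nat_add of_nat_numeral bit_2_eq_0 add_0)
        have "homogeneous M (sum_list (map fst A) # map fst B) (L (map snd A) # map snd B)"
          using * L_deg by simp
        then have "vals 1 \<phi> (L (map snd A) # map snd B) \<in> deg M (t + of_nat (length (L (map snd A) # map snd B)) + 1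
            + sum_list (sum_list (map fst A) # map fst B))"
          using t unfolding tpar_def by blast
        then show ?thesis using * n by (simp add: ac_simps)
      qed (simp add: L_zero vals_zero_front[OF \<phi>])
    qed
    moreover have "ext_sum ?xs (\<lambda>A B. L (vals 1 \<phi> (map snd A) # map snd B)) \<in> ?D"
    proof (rule shuffle_sum_mem[OF V.module_axioms subspace_deg])
      fix A B assume "mset A + mset B = mset ?xs"
      note * = AB[OF this]
      show "L (vals 1 \<phi> (map snd A) # map snd B) \<in> ?D"
      proof (cases "length B = 1")
        case True
        have n: "of_nat (length A) + 1 = (of_nat ?n :: bit)"
          using * True by (metis of_nat_add of_nat_1)
        have "vals 1 \<phi> (map snd A) \<in> deg M (t + of_nat (length (map snd A)) + 1 + sum_list (map fst A))"
          using t * unfolding tpar_def by blast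
        then have "homogeneous M ((t + of_nat (length A) + 1 + sum_list (map fst A)) # map fst B)
            (vals 1 \<phi> (map snd A) # map snd B)"
          using * by simp
        from L_deg[OF this] show ?thesis using * unfolding n[symmetric] by (simp add: ac_simps)
      qed (simp add: L_zero)
    qed
    ultimately show ?thesis
      unfolding vals_bracket_l[OF \<phi> False vs] by (intro deg_diff deg_sg)
  qed simp
qed

abbreviation dL :: "'v list \<Rightarrow> 'v" where
  "dL vs \<equiv> L (etal 0 vs)"

lemma dL_sym: "W.gsymV dL"
  using gsym_etal_W[OF asym_L V.module_axioms V.subspace_single_0] by simp

text \<open>In \<open>ext_sum_cod\<close> the composite with \<open>l\<close> inside has trivial
  sign, as \<open>l\<close> is even. With \<open>l\<close> outside there is one further argument, so
  the sign is t + n; combined with the n of \<open>vals_bracket_l\<close> this leaves t, the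
  exponent in the graded commutator of parities t and 1.\<close>

lemma vals_bracket_cbr:
  assumes \<phi>: "\<phi> \<in> CV M" and t: "tpar t (vals 1 \<phi>)"
  shows "vals 1 (bracket M \<phi> l) vs = W.cbr t (\<lambda>vs. vals 1 \<phi> (etal 0 vs)) 1 dL (etal 0 vs)"
proof (cases "vs = []")
  case True
  then show ?thesis
    by (simp add: W.cbr_def V.module_axioms vals_zero_front \<phi> l_CV)
next
  case False
  let ?\<phi> = "\<lambda>vs. vals 1 \<phi> (etal 0 vs)"
  have g: "W.gsymV ?\<phi>"
    using gsym_etal_W[OF gsym_vals_CV[OF \<phi>] V.module_axioms V.subspace_single_0] by simp
  have cb: "asymV (\<lambda>vs. W.cbr t ?\<phi> 1 dL (etal 0 vs))"
    using gsym_etal_V[OF W.gsym_cbr[OF g dL_sym] W.V.module_axioms W.V.subspace_single_0] by simp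
  show ?thesis
  proof (rule gsym0_eqI[OF gsym_vals_CV[OF bracket_l_CV[OF \<phi>]] cb _ False])
    fix ps vs assume vs: "homogeneous M ps vs" and ne: "vs \<noteq> ([] :: 'v list)"
    let ?n = "length vs"
    have n: "of_nat (?n - 1) = of_nat ?n + (1 :: bit)"
      using ne by (cases vs) simp_all
    have 1: "ext_sum (zip ps vs) (\<lambda>A B. vals 1 \<phi> (L (map snd A) # map snd B))
        = ext (scl M) ?\<phi> (W.cod 1 dL (etal 0 vs))"
      by (subst ext_sum_cod[OF gsym_vals_CV[OF \<phi>] asym_L tpar_L vs, where j = 2])
        (simp_all add: L_zero vals_zero_front[OF \<phi>])
    have 2: "ext_sum (zip ps vs) (\<lambda>A B. L (vals 1 \<phi> (map snd A) # map snd B))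
        = sg (t + of_nat ?n) (ext (scl M) dL (W.cod t ?\<phi> (etal 0 vs)))"
      using ne
      by (subst ext_sum_cod[OF asym_L gsym_vals_CV[OF \<phi>] t vs, where j = "?n - 1"])
        (simp_all add: L_zero n[simplified] add.assoc)
    show "vals 1 (bracket M \<phi> l) vs = W.cbr t ?\<phi> 1 dL (etal 0 vs)"
      unfolding vals_bracket_l[OF \<phi> ne vs] 1 2 W.cbr_def by (simp add: ac_simps)
  qed
qed

text \<open>On three letters this is the Jacobi identity carried over by \<eta>; for other lengths
  one of the two occurrences of \<open>L\<close> has a wrong number of arguments.\<close>

lemma jacobi: "ext (scl M) dL (W.cod 1 dL ws) = 0"
proof (cases "ws = []")
  case True
  then show ?thesis
    by (simp add: V.module_axioms vals_zero_front l_CV)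
next
  case False
  let ?K = "\<lambda>ws. ext (scl M) dL (W.cod 1 dL ws)"
  have g: "W.gsymV ?K" "W.gsymV (\<lambda>_. 0)"
    using W.gsym_ext_cod[OF dL_sym dL_sym] gsym_zero[OF V.module_axioms V.subspace_single_0, of "\<Pi> M" 0]
    by simp_all
  show ?thesis
  proof (rule W.gsym0_eqI[OF g _ False])
    fix qs vs assume "homogeneous (\<Pi> M) qs vs" and ne: "vs \<noteq> ([] :: 'v list)"
    define ps where "ps = map (\<lambda>p. p + 1) qs"
    then have vs: "homogeneous M ps vs"
      using \<open>homogeneous (\<Pi> M) qs vs\<close> by (simp add: homogeneous_shift)
    let ?S = "ext_sum (zip ps vs) (\<lambda>A B. L (L (map snd A) # map snd B))"
    have "?S = ?K (etal 0 vs)"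
      by (subst ext_sum_cod[OF asym_L asym_L tpar_L vs, where j = 2])
        (simp_all add: L_zero vals_zero_front[OF l_CV])
    also have "\<dots> = sg (etasign ps) (?K vs)"
      using gsym0_etal_homogeneous[OF g(1) _ _ vs] by (simp add: V.module_axioms)
    finally have K: "sg (etasign ps) (?K vs) = ?S" by simp
    have "?S = 0"
    proof (cases "length vs = 3")
      case True
      let ?f = "\<lambda>\<sigma>. scl M (of_int (sign \<sigma> * koszul \<sigma> ps))
           (l (wedge M [l (wedge M [vs ! \<sigma> 0, vs ! \<sigma> 1]), vs ! \<sigma> 2]))"
      have pl: "permute_list \<sigma> vs = [vs ! \<sigma> 0, vs ! \<sigma> 1, vs ! \<sigma> 2]" for \<sigma>
        using True by (simp add: permute_list_def numeral_eq_Suc)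
      have "?S = (\<Sum>j = 1..3. \<Sum>\<sigma>\<in>Sh j (3 - j). scl M (of_int (sign \<sigma> * koszul \<sigma> ps))
           (l (wedge M (l (wedge M (take j (permute_list \<sigma> vs))) # drop j (permute_list \<sigma> vs)))))"
        unfolding circ_sum[OF l_CV l_CV vs, symmetric] True ..
      \<comment> \<open>Block lengths 1 and 3 give the inner \<open>L\<close> a wrong number of
        arguments.\<close>
      also have "\<dots> = (\<Sum>j = 1..3::nat. if j = 2 then (\<Sum>\<sigma>\<in>Sh 2 1. ?f \<sigma>) else 0)"
      proof (rule sum.cong)
        fix j :: nat assume j: "j \<in> {1..3}"
        show "(\<Sum>\<sigma>\<in>Sh j (3 - j). scl M (of_int (sign \<sigma> * koszul \<sigma> ps))
           (l (wedge M (l (wedge M (take j (permute_list \<sigma> vs))) # drop j (permute_list \<sigma> vs)))))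
          = (if j = 2 then (\<Sum>\<sigma>\<in>Sh 2 1. ?f \<sigma>) else 0)"
        proof (cases "j = 2")
          case True
          then show ?thesis by (simp add: pl numeral_2_eq_2)
        next
          case False
          have "l (wedge M (take j (permute_list \<sigma> vs))) = 0" for \<sigma>
            using j False \<open>length vs = 3\<close> by (subst wedge_vals) (auto simp: L_zero pl)
          then show ?thesis
            using False by (simp add: wedge_vals vals_zero_front[OF l_CV])
        qed
      qed simp
      also have "\<dots> = 0"
        using lie True vs by (simp add: lie_structure_def)
      finally show ?thesis .
    next
      case False
      have "?S = ext_sum (zip ps vs) (\<lambda>A B. 0)"
      proof (rule shuffle_sum_cong)
        fix A B :: "(bit \<times> 'v) list" assume "length A + length B = length (zip ps vs)"
        then show "L (L (map snd A) # map snd B) = 0"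
          using False homogeneous_length[OF vs]
          by (cases "length A = 2") (simp_all add: L_zero vals_zero_front[OF l_CV])
      qed
      then show ?thesis by simp
    qed
    then show "?K vs = 0"
      using K by (metis sg_zero sg_sg bit_add_self(1) sg_0)
  qed
qed

end

section \<open>Cyclic cochains\<close>

context graded
begin

lemma eqv_words_homogeneous:
  assumes F: "gsym M 0 wscl (relmod M (psign 0)) F" and hom: "\<And>ps ws. homogeneous M ps ws \<Longrightarrow> F ws \<doteq> 0"
  shows "ext wscl F x \<doteq> 0"
proof -
  have "F ws \<doteq> 0" for ws
  proof (induction ws rule: multilinear_induct)
    case (add xs a b ys)
    have "F (xs @ (a + b) # ys) \<doteq> F (xs @ a # ys) + F (xs @ b # ys)"
      using gsym_addD[OF F, of xs a b ys] by (simp add: eqv_def diff_diff_eq)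
    also have "\<dots> \<doteq> 0"
      by (intro eqv_zeroI add)
    finally show ?case .
  qed (rule hom)
  then have "ext wscl F x \<doteq> ext wscl (\<lambda>_. 0) x"
    by (rule eqv_ext_fun)
  then show ?thesis by simp
qed

lemma gsym_ext_cod_words: "gsymV \<alpha> \<Longrightarrow> gsymV \<beta>
    \<Longrightarrow> gsym M 0 wscl (relmod M (psign 0)) (\<lambda>ws. ext wscl (cod a \<alpha>) (cod b \<beta> ws))"
  by (rule gsym_comp_const[OF gsym_cod module_hom_ext])
    (auto intro: relmod_gsym gsym_cod)

lemma commutator_words:
  assumes "gsymV \<alpha>" "gsymV \<beta>" "par a \<alpha>" "par b \<beta>"
  shows "ext wscl (cod a \<alpha>) (ext wscl (cod b \<beta>) x) - sg (a * b) (ext wscl (cod b \<beta>) (ext wscl (cod a \<alpha>) x))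
    \<doteq> ext wscl (cod (a + b) (cbr a \<alpha> b \<beta>)) x"
proof -
  let ?F = "\<lambda>ws. ext wscl (cod a \<alpha>) (cod b \<beta> ws) - sg (a * b) (ext wscl (cod b \<beta>) (cod a \<alpha> ws))
    - cod (a + b) (cbr a \<alpha> b \<beta>) ws"
  have "gsym M 0 wscl (relmod M (psign 0)) ?F"
    by (intro gsym_diff module_wscl subspace_relmod gsym_ext_cod_words gsym_cod gsym_cbr assms
        gsym_sg[where a = "\<lambda>_. a * b"])
  then have "ext wscl ?F x \<doteq> 0"
    by (rule eqv_words_homogeneous) (subst eqv_diff_zero[symmetric], rule cod_commutator[OF assms])
  moreover have "ext wscl (\<lambda>ws. F ws - G ws) x = ext wscl F x - ext wscl G x" for F G :: "'v list \<Rightarrow> ('k, 'v) words"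
    by (simp add: ext_def words.scale_right_diff_distrib sum_subtractf)
  ultimately show ?thesis
    by (simp add: ext_ext ext_sg_fun eqv_diff_zero[symmetric])
qed

lemma cod_zero_words: "ext wscl (cod a (\<lambda>_. 0)) x \<doteq> 0"
  using eqv_ext_fun[of "cod a (\<lambda>_. 0)" "\<lambda>_. 0" x] cod_zero by simp

end

text \<open>The ground ring is concentrated in even degree, so its parity \<open>a\<close> component
  is everything or 0.\<close>

definition kproj :: "bit \<Rightarrow> 'k \<Rightarrow> 'k::comm_ring_1" where
  "kproj a x = (if a = 0 then x else 0)"

lemma module_hom_kproj: "module_hom (*) (*) (kproj a)"
  by (simp add: module_hom_iff kproj_def)

locale deformation = lie_algebra M l for M :: "('k::comm_ring_1, 'v::ab_group_add) smodule" and l +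
  fixes B :: "'v \<Rightarrow> 'v \<Rightarrow> 'k" and d :: "('k, 'v) cochain"
  assumes inner: "inner_product M B"
    and d_CW: "d \<in> CW (\<Pi> M)" and d_l: "conj_eta M d = l"
begin

lemma inner_add_left: "B (x + y) v = B x v + B y v"
  and inner_add_right: "B v (x + y) = B v x + B v y"
  and inner_zero [simp]: "B 0 v = 0" "B v 0 = 0"
  and inner_uminus_left: "B (- x) v = - B x v"
proof -
  interpret l: module_hom "scl M" "(*)" "\<lambda>v. B v w" for w
    using inner by (simp add: inner_product_def)
  interpret r: module_hom "scl M" "(*)" "B v" for v
    using inner by (simp add: inner_product_def)
  show "B (x + y) v = B x v + B y v" "B v (x + y) = B v x + B v y" "B 0 v = 0" "B v 0 = 0" "B (- x) v = - B x v"
    by (simp_all add: l.add r.add l.neg)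
qed

lemma inner_even: "v \<in> deg M p \<Longrightarrow> w \<in> deg M q \<Longrightarrow> p \<noteq> q \<Longrightarrow> B v w = 0"
  using inner by (simp add: inner_product_def)

text \<open>The even inner product makes V_0 and V_1 orthogonal, so the projections are
  self-adjoint.\<close>

lemma inner_hproj: "B (hproj M a u) v = B u (hproj M a v)"
proof -
  have o: "B (hproj M a u) (hproj M (a + 1) v) = 0" "B (hproj M (a + 1) u) (hproj M a v) = 0"
    by (rule inner_even[OF hproj_deg hproj_deg]; cases a; simp)+
  have "v = hproj M a v + hproj M (a + 1) v" "u = hproj M a u + hproj M (a + 1) u"
    by (simp_all flip: hproj_compl)
  then show ?thesis
    using o by (metis inner_add_left inner_add_right add.right_neutral)
qed

text \<open>The projection can be moved across the inner product to the last argument. So the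
  functional attached to a parity component of a cochain is a parity component of the functional
  attached to the cochain, which is why components of cyclic cochains are cyclic.\<close>

lemma gproj_inner:
  assumes "\<And>vs v. length vs = n \<Longrightarrow> G (vs @ [v]) = B (F vs) v" "length vs = n"
  shows "gproj kproj a G (vs @ [v]) = B (vproj a F vs) v"
  using assms
proof (induction vs arbitrary: n a F G)
  case Nil
  then have G: "G [v] = B (F []) v" for v
    using Nil(1)[of "[]"] by simp
  show ?case
    by (cases a) (simp_all add: kproj_def G inner_hproj)
next
  case (Cons w vs)
  have "gproj kproj b (\<lambda>X. G (w' # X)) (vs @ [v]) = B (vproj b (\<lambda>X. F (w' # X)) vs) v" for b w'
    using Cons.IH[of "length vs" "\<lambda>X. G (w' # X)" "\<lambda>X. F (w' # X)" b] Cons.prems(1)[of "w' # _"] Cons.prems(2)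
    by simp
  then show ?case
    by (simp add: inner_add_left)
qed

section \<open>Cyclic cochains and their cohomology relation\<close>

lemma cyclic_zero: "cyclic M B (\<lambda>X. 0)"
  unfolding cyclic_def using Hom_zero[of "(*)" 1] by (auto simp: psign_simps intro!: bexI)

lemma cyclic_add: "cyclic M B \<phi> \<Longrightarrow> cyclic M B \<psi> \<Longrightarrow> cyclic M B (\<lambda>X. \<phi> X + \<psi> X)"
  unfolding cyclic_def
proof (intro allI impI)
  fix n :: nat
  assume "\<forall>n\<ge>1. \<exists>g\<in>Hom M (- 1) (*). \<forall>vs v. length vs = n \<longrightarrow> g (wedge M (vs @ [v])) = B (\<phi> (wedge M vs)) v"
    "\<forall>n\<ge>1. \<exists>g\<in>Hom M (- 1) (*). \<forall>vs v. length vs = n \<longrightarrow> g (wedge M (vs @ [v])) = B (\<psi> (wedge M vs)) v"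
    "n \<ge> 1"
  then obtain g h where g: "g \<in> Hom M (- 1) (*)" "\<forall>vs v. length vs = n \<longrightarrow> g (wedge M (vs @ [v])) = B (\<phi> (wedge M vs)) v"
    and h: "h \<in> Hom M (- 1) (*)" "\<forall>vs v. length vs = n \<longrightarrow> h (wedge M (vs @ [v])) = B (\<psi> (wedge M vs)) v"
    by meson
  have "(\<lambda>X. g X + h X) \<in> Hom M (- 1) (*)"
    using Hom_add[of "(*)" g 1 h] g(1) h(1) by (simp add: psign_simps)
  then show "\<exists>g\<in>Hom M (- 1) (*). \<forall>vs v. length vs = n \<longrightarrow> g (wedge M (vs @ [v])) = B (\<phi> (wedge M vs) + \<psi> (wedge M vs)) v"
    by (rule bexI[rotated]) (simp add: g(2) h(2) inner_add_left)
qed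

lemma cyclic_uminus: "cyclic M B \<phi> \<Longrightarrow> cyclic M B (\<lambda>X. - \<phi> X)"
  unfolding cyclic_def
proof (intro allI impI)
  fix n :: nat
  assume "\<forall>n\<ge>1. \<exists>g\<in>Hom M (- 1) (*). \<forall>vs v. length vs = n \<longrightarrow> g (wedge M (vs @ [v])) = B (\<phi> (wedge M vs)) v"
    "n \<ge> 1"
  then obtain g where g: "g \<in> Hom M (- 1) (*)" "\<forall>vs v. length vs = n \<longrightarrow> g (wedge M (vs @ [v])) = B (\<phi> (wedge M vs)) v"
    by meson
  have "(\<lambda>X. - g X) \<in> Hom M (- 1) (*)"
    using Hom_uminus[of "(*)" g 1] g(1) by (simp add: psign_simps)
  then show "\<exists>g\<in>Hom M (- 1) (*). \<forall>vs v. length vs = n \<longrightarrow> g (wedge M (vs @ [v])) = B (- \<phi> (wedge M vs)) v"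
    by (rule bexI[rotated]) (simp add: g(2) inner_uminus_left)
qed

lemma CC_zero: "(\<lambda>X. 0) \<in> CC M B"
  using Hom_zero[OF V.module_axioms, of 1] by (simp add: CC_def CV_def' cyclic_zero)

lemma CC_add: "\<phi> \<in> CC M B \<Longrightarrow> \<psi> \<in> CC M B \<Longrightarrow> (\<lambda>X. \<phi> X + \<psi> X) \<in> CC M B"
  using Hom_add[OF V.module_axioms, of _ 1] by (simp add: CC_def CV_def' cyclic_add)

lemma CC_uminus: "\<phi> \<in> CC M B \<Longrightarrow> (\<lambda>X. - \<phi> X) \<in> CC M B"
  using Hom_uminus[OF V.module_axioms, of _ 1] by (simp add: CC_def CV_def' cyclic_uminus)

lemma equiv_cohomologous: "equiv (cocycles M B l) (cohomologous M B l)"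
proof (rule equivI)
  show "cohomologous M B l \<subseteq> cocycles M B l \<times> cocycles M B l"
    by (auto simp: cohomologous_def)
  show "refl_on (cocycles M B l) (cohomologous M B l)"
    unfolding refl_on_def cohomologous_def using CC_zero by (auto simp: bracket_l_zero intro!: bexI)
  have CV: "\<chi> \<in> CV M" if "\<chi> \<in> CC M B" for \<chi>
    using that by (simp add: CC_def)
  show "sym (cohomologous M B l)"
  proof (rule symI)
    fix \<phi> \<psi> assume "(\<phi>, \<psi>) \<in> cohomologous M B l"
    then obtain \<chi> where *: "\<phi> \<in> cocycles M B l" "\<psi> \<in> cocycles M B l" "\<chi> \<in> CC M B"
      "\<And>X. \<psi> X - \<phi> X = bracket M \<chi> l X"
      by (auto simp: cohomologous_def)
    have "\<phi> X - \<psi> X = bracket M (\<lambda>X. - \<chi> X) l X" for X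
      unfolding bracket_l_uminus[OF CV[OF *(3)]] *(4)[symmetric] by simp
    then show "(\<psi>, \<phi>) \<in> cohomologous M B l"
      using * CC_uminus[OF *(3)] by (auto simp: cohomologous_def)
  qed
  show "trans (cohomologous M B l)"
  proof (rule transI)
    fix \<phi> \<psi> \<rho> assume "(\<phi>, \<psi>) \<in> cohomologous M B l" "(\<psi>, \<rho>) \<in> cohomologous M B l"
    then obtain \<chi> \<chi>' where *: "\<phi> \<in> cocycles M B l" "\<rho> \<in> cocycles M B l" "\<chi> \<in> CC M B" "\<chi>' \<in> CC M B"
      "\<And>X. \<psi> X - \<phi> X = bracket M \<chi> l X" "\<And>X. \<rho> X - \<psi> X = bracket M \<chi>' l X"
      by (auto simp: cohomologous_def)
    have "\<rho> X - \<phi> X = bracket M (\<lambda>X. \<chi> X + \<chi>' X) l X" for X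
      unfolding bracket_l_add[OF CV[OF *(3)] CV[OF *(4)]] *(5,6)[symmetric] by simp
    then show "(\<phi>, \<rho>) \<in> cohomologous M B l"
      using * CC_add[OF *(3,4)] by (auto simp: cohomologous_def)
  qed
qed

text \<open>The component of total parity \<open>t\<close>; the parity to project to changes with
  the arity.\<close>

definition tproj :: "bit \<Rightarrow> ('k, 'v) cochain \<Rightarrow> ('k, 'v) cochain" where
  "tproj t \<chi> = hom_of 1 (scl M) (\<lambda>vs. vproj (t + of_nat (length vs) + 1) (vals 1 \<chi>) vs)"

lemma
  assumes \<chi>: "\<chi> \<in> CV M"
  shows tproj_CV: "tproj t \<chi> \<in> CV M"
    and vals_tproj: "vals 1 (tproj t \<chi>) = (\<lambda>vs. vproj (t + of_nat (length vs) + 1) (vals 1 \<chi>) vs)"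
    and tpar_tproj: "tpar t (vals 1 (tproj t \<chi>))"
proof -
  note g = gsym_vals_CV[OF \<chi>]
  have "asymV (\<lambda>vs. vproj (t + of_nat (length vs) + 1) (vals 1 \<chi>) vs)"
    using gsym_vproj[OF g] by (rule gsym_cong_length[of _ _ _ _ "\<lambda>n. vproj (t + of_nat n + 1) (vals 1 \<chi>)"])
  note * = CV_of[OF this]
  show "tproj t \<chi> \<in> CV M" and v: "vals 1 (tproj t \<chi>) = (\<lambda>vs. vproj (t + of_nat (length vs) + 1) (vals 1 \<chi>) vs)"
    unfolding tproj_def using * by simp_all
  show "tpar t (vals 1 (tproj t \<chi>))"
    unfolding v tpar_def by (simp add: vproj_homogeneous[OF g])
qed

lemma cyclic_tproj:
  assumes \<chi>: "\<chi> \<in> CC M B"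
  shows "tproj t \<chi> \<in> CC M B"
proof -
  have CV: "\<chi> \<in> CV M" and cyc: "cyclic M B \<chi>"
    using \<chi> by (auto simp: CC_def)
  have "cyclic M B (tproj t \<chi>)"
    unfolding cyclic_def
  proof (intro allI impI)
    fix n :: nat assume n: "n \<ge> 1"
    then obtain g where g: "g \<in> Hom M (psign 1) (*)"
      and val: "\<And>vs v. length vs = n \<Longrightarrow> g (wedge M (vs @ [v])) = B (\<chi> (wedge M vs)) v"
      using cyc unfolding cyclic_def psign_simps by meson
    \<comment> \<open>Cyclicity is tested in one arity at a time, so the parity to project to is
      constant here.\<close>
    let ?G = "gproj kproj (t + of_nat n + 1) (vals 1 g)"
    have G: "gsym0 M 1 (*) ?G"
      by (intro gsym_gproj[OF module_ring module_hom_kproj] gsym_vals[OF module_ring g])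
    have "hom_of 1 (*) ?G (wedge M (vs @ [v])) = B (tproj t \<chi> (wedge M vs)) v" if "length vs = n" for vs v
    proof -
      have "hom_of 1 (*) ?G (wedge M (vs @ [v])) = ?G (vs @ [v])"
        using hom_of_mon[OF module_ring G, of "vs @ [v]"] by (simp add: psign_simps)
      also have "\<dots> = B (vproj (t + of_nat n + 1) (vals 1 \<chi>) vs) v"
      proof (rule gproj_inner[OF _ that])
        fix us :: "'v list" and u assume "length us = n"
        then show "vals 1 g (us @ [u]) = B (vals 1 \<chi> us) u"
          using val[of us u] n wedge_vals[of us \<chi>] wedge_vals[of "us @ [u]" g] by (cases us) auto
      qed
      also have "vproj (t + of_nat n + 1) (vals 1 \<chi>) vs = tproj t \<chi> (wedge M vs)"
        using that n vals_tproj[OF CV, of t] by (subst wedge_vals) auto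
      finally show ?thesis .
    qed
    then show "\<exists>g\<in>Hom M (- 1) (*). \<forall>vs v. length vs = n \<longrightarrow> g (wedge M (vs @ [v])) = B (tproj t \<chi> (wedge M vs)) v"
      using hom_of_in_Hom[OF module_ring G] unfolding psign_simps by blast
  qed
  then show ?thesis
    using tproj_CV[OF CV] by (simp add: CC_def)
qed

text \<open>Split \<chi> by total parity. The bracket with \<open>l\<close> raises total parity by
  1, so the unwanted part contributes in parity t; being also the difference of two cochains of
  parity t + 1, its contribution vanishes.\<close>

lemma coboundary_homogeneous:
  assumes \<chi>: "\<chi> \<in> CC M B" and \<rho>: "tpar (t + 1) (vals 1 \<rho>)" and eq: "\<And>X. \<rho> X = bracket M \<chi> l X"
  shows "\<rho> X = bracket M (tproj t \<chi>) l X"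
proof -
  have CV: "\<chi> \<in> CV M" using \<chi> by (simp add: CC_def)
  note p = tproj_CV[OF CV, of t] and q = tproj_CV[OF CV, of "t + 1"]
  have "\<chi> = (\<lambda>X. tproj t \<chi> X + tproj (t + 1) \<chi> X)"
  proof (rule vals_eqI[of _ 1 "scl M"])
    show "\<chi> \<in> Hom M (psign 1) (scl M)" "(\<lambda>X. tproj t \<chi> X + tproj (t + 1) \<chi> X) \<in> Hom M (psign 1) (scl M)"
      using CV p q Hom_add[OF V.module_axioms] unfolding CV_def' by blast+
    show "vals 1 \<chi> = vals 1 (\<lambda>X. tproj t \<chi> X + tproj (t + 1) \<chi> X)"
    proof
      fix vs
      have "vals 1 (\<lambda>X. tproj t \<chi> X + tproj (t + 1) \<chi> X) vs = vals 1 (tproj t \<chi>) vs + vals 1 (tproj (t + 1) \<chi>) vs"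
        by (simp add: vals_def)
      also have "\<dots> = vals 1 \<chi> vs"
        unfolding vals_tproj[OF CV] using vproj_sum[OF gsym_vals_CV[OF CV], of vs]
        by (cases "t + of_nat (length vs)") (simp_all add: ac_simps)
      finally show "vals 1 \<chi> vs = vals 1 (\<lambda>X. tproj t \<chi> X + tproj (t + 1) \<chi> X) vs" ..
    qed
  qed
  then have sum: "bracket M \<chi> l X = bracket M (tproj t \<chi>) l X + bracket M (tproj (t + 1) \<chi>) l X" for X
    using bracket_l_add[OF p q, of X] by simp
  have "bracket M (tproj (t + 1) \<chi>) l = (\<lambda>X. 0)"
  proof (rule CV_eqI[OF bracket_l_CV[OF q]])
    show "(\<lambda>X. 0) \<in> CV M"
      unfolding CV_def' by (rule Hom_zero[OF V.module_axioms])
    fix ps vs assume ne: "vs \<noteq> []" and vs: "homogeneous M ps vs"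
    let ?a = "t + of_nat (length vs) + 1 + sum_list ps"
    have eq': "vals 1 (bracket M (tproj (t + 1) \<chi>) l) vs = vals 1 \<rho> vs - vals 1 (bracket M (tproj t \<chi>) l) vs"
      using sum eq by (simp add: vals_def)
    have "vals 1 (bracket M (tproj t \<chi>) l) vs \<in> deg M (?a + 1)" "vals 1 \<rho> vs \<in> deg M (?a + 1)"
      using tpar_bracket_l[OF p tpar_tproj[OF CV]] \<rho> vs by (auto simp: tpar_def ac_simps)
    then have "vals 1 (bracket M (tproj (t + 1) \<chi>) l) vs \<in> deg M (?a + 1)"
      unfolding eq' by (intro deg_diff)
    moreover have "vals 1 (bracket M (tproj (t + 1) \<chi>) l) vs \<in> deg M ?a"
      using tpar_bracket_l[OF q tpar_tproj[OF CV]] vs by (auto simp: tpar_def ac_simps)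
    ultimately show "bracket M (tproj (t + 1) \<chi>) l (wedge M vs) = 0"
      using deg_disjoint by (simp add: wedge_vals ne)
  qed
  then show ?thesis by (simp add: eq sum)
qed


section \<open>Deformations and cocycles\<close>

abbreviation dv :: "('k, 'v) cochain \<Rightarrow> 'v list \<Rightarrow> 'v" where
  "dv \<equiv> W.vals 0"

abbreviation Dw :: "bit \<Rightarrow> ('v list \<Rightarrow> 'v) \<Rightarrow> ('k, 'v) words \<Rightarrow> ('k, 'v) words" where
  "Dw a \<delta> \<equiv> ext wscl (W.cod a \<delta>)"

abbreviation cl :: "('k, 'v) words \<Rightarrow> ('k, 'v) qelem" where
  "cl \<equiv> cls (\<Pi> M) 1"

lemma dv_d: "dv d = dL"
proof
  fix vs
  show "dv d vs = dL vs"
    using vals_conj_eta[of d "etal 0 vs"] by (simp add: d_l etal_etal)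
qed

text \<open>Each of the n arguments and the value change their parity, which adds n + 1; modulo 2
  this is the shift in the total parity.\<close>

lemma par_iff_tpar:
  assumes G: "W.gsymV G"
  shows "W.par a G \<longleftrightarrow> tpar a (\<lambda>vs. G (etal 0 vs))"
proof -
  have sg_iff: "sg b x \<in> deg M q \<longleftrightarrow> x \<in> deg M q" for b x q
    using deg_sg[of x q b] deg_sg[of "sg b x" q b] by auto
  have e: "G vs \<in> deg (\<Pi> M) (a + sum_list (map (\<lambda>p. p + 1) ps))
      \<longleftrightarrow> G (etal 0 vs) \<in> deg M (a + of_nat (length vs) + 1 + sum_list ps)" if vs: "homogeneous M ps vs" for ps vs
  proof -
    have s: "sum_list (map (\<lambda>p. p + 1) ps) = sum_list ps + of_nat (length ps)" for ps :: "bit list"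
      by (induction ps) (simp_all add: ac_simps)
    have "G (etal 0 vs) = sg (etasign ps) (G vs)"
      using gsym0_etal_homogeneous[of "\<Pi> M" 0 "scl M" G, OF _ V.module_axioms _ vs] G by simp
    then show ?thesis
      using homogeneous_length[OF vs] by (simp add: sg_iff s ac_simps)
  qed
  show ?thesis
    unfolding W.par_def tpar_def
  proof (intro iffI allI impI)
    fix ps vs assume *: "\<forall>ps vs. homogeneous (\<Pi> M) ps vs \<longrightarrow> G vs \<in> deg (\<Pi> M) (a + sum_list ps)"
      and vs: "homogeneous M ps vs"
    then show "G (etal 0 vs) \<in> deg M (a + of_nat (length vs) + 1 + sum_list ps)"
      using e[OF vs] homogeneous_shift'[of ps vs] by blast
  next
    fix qs vs assume *: "\<forall>ps vs. homogeneous M ps vs \<longrightarrow> G (etal 0 vs) \<in> deg M (a + of_nat (length vs) + 1 + sum_list ps)"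
      and vs: "homogeneous (\<Pi> M) qs vs"
    have "map (\<lambda>p. p + 1) (map (\<lambda>p. p + 1) qs) = qs"
      by (induction qs) (simp_all add: add.assoc)
    then show "G vs \<in> deg (\<Pi> M) (a + sum_list qs)"
      using e[of "map (\<lambda>p. p + 1) qs" vs] * vs homogeneous_shift[of qs vs] by metis
  qed
qed

lemma vals_conj: "vals 1 (conj_eta M \<delta>) = (\<lambda>vs. dv \<delta> (etal 0 vs))"
  by (rule ext) (rule vals_conj_eta)

lemma has_parity_iff:
  assumes "\<delta> \<in> CW (\<Pi> M)"
  shows "has_parity (\<Pi> M) a \<delta> \<longleftrightarrow> total_parity M a (conj_eta M \<delta>)"
proof -
  have "has_parity (\<Pi> M) a \<delta> \<longleftrightarrow> W.par a (dv \<delta>)"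
  proof
    assume "W.par a (dv \<delta>)"
    then show "has_parity (\<Pi> M) a \<delta>"
      by (auto simp: has_parity_def W.par_def W.sprod_vals)
  qed (rule W.par_vals)
  then show ?thesis
    by (simp only: par_iff_tpar[OF W.gsym_vals_CW[OF assms]] total_parity_iff vals_conj)
qed

lemma conj_eta_surj:
  assumes \<phi>: "\<phi> \<in> CV M"
  obtains \<delta> where "\<delta> \<in> CW (\<Pi> M)" "conj_eta M \<delta> = \<phi>"
proof
  let ?F = "\<lambda>vs. vals 1 \<phi> (etal 0 vs)"
  let ?\<delta> = "W.hom_of 0 (scl M) ?F"
  have F: "gsym0 (\<Pi> M) 0 (scl M) ?F"
    using gsym_etal_W[OF gsym_vals_CV[OF \<phi>] V.module_axioms V.subspace_single_0] by simp
  show CW: "?\<delta> \<in> CW (\<Pi> M)"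
    unfolding W.CW_def' using W.hom_of_in_Hom[OF V.module_axioms F] by simp
  show "conj_eta M ?\<delta> = \<phi>"
  proof (rule vals_eqI[of _ 1 "scl M"])
    show "conj_eta M ?\<delta> \<in> Hom M (psign 1) (scl M)" "\<phi> \<in> Hom M (psign 1) (scl M)"
      using conj_eta_CV[OF CW] \<phi> by (simp_all add: CV_def')
    show "vals 1 (conj_eta M ?\<delta>) = vals 1 \<phi>"
      unfolding vals_conj using W.vals_hom_of[OF V.module_axioms F] by (simp add: etal_etal)
  qed
qed

lemma d_parity: "has_parity (\<Pi> M) 1 d"
  unfolding has_parity_iff[OF d_CW] d_l total_parity_iff by (rule tpar_L)

lemma dL_par: "W.par 1 dL"
  using W.par_vals[OF d_parity] by (simp add: dv_d)

lemma square_zero: "W.eqv (Dw 1 dL (Dw 1 dL x)) 0"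
  unfolding ext_ext[OF module_wscl]
proof (rule W.eqv_words_homogeneous[OF W.gsym_ext_cod_words[OF dL_sym dL_sym]])
  fix ps ws assume "homogeneous (\<Pi> M) ps ws"
  then have "W.eqv (Dw 1 dL (W.cod 1 dL ws)) (W.cod 0 (\<lambda>X. ext (scl (\<Pi> M)) dL (W.cod 1 dL X)) ws)"
    by (intro W.cod_square dL_sym dL_par) simp_all
  also have "W.eqv \<dots> 0"
    using W.cod_zero by (simp add: jacobi)
  finally show "W.eqv (Dw 1 dL (W.cod 1 dL ws)) 0" .
qed

lemma cl_eq_iff: "cl x = cl y \<longleftrightarrow> W.eqv x y"
  using W.cls_eqv by (simp add: psign_simps)

lemma cl_add: "cl x + cl y = cl (x + y)"
  by (rule W.cls_add)

lemma cl_sg: "qscl (\<Pi> M) 1 (of_int (psign a)) (cl x) = cl (sg a x)"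
  by (simp add: W.qscl_cls module_psign)

lemma uSym_iff: "(cl a, cl b) \<in> uSym (\<Pi> M) \<longleftrightarrow> Poly_Mapping.lookup a [] = 0 \<and> Poly_Mapping.lookup b [] = 0"
  using W.cls_in_qpow[of 0] by (simp add: uSym_def psign_simps)

lemma uSym_cases:
  assumes "x \<in> uSym (\<Pi> M)"
  obtains a b where "x = (cl a, cl b)" "Poly_Mapping.lookup a [] = 0" "Poly_Mapping.lookup b [] = 0"
  using assms W.qpow_cases[of _ 0] unfolding uSym_def psign_simps by (metis mem_Sigma_iff surj_pair)

lemma coder_cl: "\<delta> \<in> CW (\<Pi> M) \<Longrightarrow> has_parity (\<Pi> M) a \<delta> \<Longrightarrow> Poly_Mapping.lookup x [] = 0
    \<Longrightarrow> coder (\<Pi> M) \<delta> (cl x) = cl (Dw a (dv \<delta>) x)"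
  using W.coder_cls by (simp add: psign_simps)

lemma lookup_Dw: "Poly_Mapping.lookup (Dw a \<delta> x) [] = 0"
  by (simp add: ext_def lookup_sum W.lookup_cod_Nil)

lemma lookup_sg: "Poly_Mapping.lookup (sg a x) w = sg a (Poly_Mapping.lookup x w)"
  by (simp add: sg_def)

section \<open>Deformations and automorphisms on representatives\<close>

lemma udef_cl:
  assumes "\<delta> \<in> CW (\<Pi> M)" "has_parity (\<Pi> M) q \<delta>"
    and "Poly_Mapping.lookup a [] = 0" "Poly_Mapping.lookup b [] = 0"
  shows "udef (\<Pi> M) p d \<delta> (cl a, cl b) = (cl (Dw 1 dL a), cl (Dw q (dv \<delta>) a + sg p (Dw 1 dL b)))"
  using assms by (simp add: udef_def uSym_iff coder_cl[OF d_CW d_parity] coder_cl dv_d cl_sg cl_add)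

lemma uaut_cl:
  assumes "\<alpha> \<in> CW (\<Pi> M)" "has_parity (\<Pi> M) q \<alpha>"
    and "Poly_Mapping.lookup a [] = 0" "Poly_Mapping.lookup b [] = 0"
  shows "uaut (\<Pi> M) \<alpha> (cl a, cl b) = (cl a, cl (Dw q (dv \<alpha>) a + b))"
  using assms by (simp add: uaut_def uSym_iff coder_cl cl_add)

text \<open>Since u squares to 0, the inverse of id + u\<alpha> is id - u\<alpha>.\<close>

lemma inv_uaut_cl:
  assumes \<alpha>: "\<alpha> \<in> CW (\<Pi> M)" "has_parity (\<Pi> M) q \<alpha>"
    and ab: "Poly_Mapping.lookup a [] = 0" "Poly_Mapping.lookup b [] = 0"
  shows "inv_into (uSym (\<Pi> M)) (uaut (\<Pi> M) \<alpha>) (cl a, cl b) = (cl a, cl (b - Dw q (dv \<alpha>) a))"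
proof (rule inv_into_f_eq)
  show "inj_on (uaut (\<Pi> M) \<alpha>) (uSym (\<Pi> M))"
  proof (rule inj_onI)
    fix x y assume xy: "x \<in> uSym (\<Pi> M)" "y \<in> uSym (\<Pi> M)" "uaut (\<Pi> M) \<alpha> x = uaut (\<Pi> M) \<alpha> y"
    obtain a b where x: "x = (cl a, cl b)" "Poly_Mapping.lookup a [] = 0" "Poly_Mapping.lookup b [] = 0"
      using uSym_cases[OF xy(1)] .
    obtain a' b' where y: "y = (cl a', cl b')" "Poly_Mapping.lookup a' [] = 0" "Poly_Mapping.lookup b' [] = 0"
      using uSym_cases[OF xy(2)] .
    let ?D = "Dw q (dv \<alpha>)"
    have aa: "W.eqv a a'" and bb: "W.eqv (?D a + b) (?D a' + b')"
      using xy(3) unfolding x(1) y(1) uaut_cl[OF \<alpha> x(2,3)] uaut_cl[OF \<alpha> y(2,3)] by (simp_all add: cl_eq_iff)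
    have "W.eqv (?D a + b - ?D a) (?D a' + b' - ?D a')"
      by (intro W.eqv_diff bb W.eqv_ext_cod W.gsym_vals_CW \<alpha> aa)
    then show "x = y"
      using aa by (simp add: x y cl_eq_iff)
  qed
  show "(cl a, cl (b - Dw q (dv \<alpha>) a)) \<in> uSym (\<Pi> M)"
    using ab by (simp add: uSym_iff lookup_minus lookup_Dw)
  show "uaut (\<Pi> M) \<alpha> (cl a, cl (b - Dw q (dv \<alpha>) a)) = (cl a, cl b)"
    using ab by (simp add: uaut_cl[OF \<alpha>] lookup_minus lookup_Dw)
qed

lemma vals_bracket_conj:
  assumes "\<delta> \<in> CW (\<Pi> M)" "has_parity (\<Pi> M) q \<delta>"
  shows "vals 1 (bracket M (conj_eta M \<delta>) l) vs = W.cbr q (dv \<delta>) 1 dL (etal 0 vs)"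
  using vals_bracket_cbr[OF conj_eta_CV[OF assms(1)], of q] assms
  unfolding has_parity_iff[OF assms(1)] total_parity_iff by (simp add: vals_conj etal_etal)

lemma commutator_d:
  assumes "\<delta> \<in> CW (\<Pi> M)" "has_parity (\<Pi> M) q \<delta>"
  shows "W.eqv (Dw q (dv \<delta>) (Dw 1 dL x) - sg q (Dw 1 dL (Dw q (dv \<delta>) x)))
    (Dw (q + 1) (W.cbr q (dv \<delta>) 1 dL) x)"
  using W.commutator_words[OF W.gsym_vals_CW[OF assms(1)] dL_sym W.par_vals[OF assms(2)] dL_par] by simp

lemma gsym_cbr_dL: "\<delta> \<in> CW (\<Pi> M) \<Longrightarrow> W.gsymV (W.cbr q (dv \<delta>) 1 dL)"
  by (rule W.gsym_cbr[OF W.gsym_vals_CW dL_sym])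

lemma cbr_dL_Nil: "\<delta> \<in> CW (\<Pi> M) \<Longrightarrow> W.cbr q (dv \<delta>) 1 dL [] = 0"
  using gsym0_zero[OF W.gsym_vals_CW, of \<delta> "[]" "[]"] gsym0_zero[OF dL_sym, of "[]" "[]"]
  by (simp add: W.cbr_def V.module_axioms)

section \<open>Integrability and equivalence as conditions on cochains\<close>

lemma bracket_eq_iff:
  assumes \<alpha>: "\<alpha> \<in> CW (\<Pi> M)" "has_parity (\<Pi> M) q \<alpha>" and \<rho>: "\<rho> \<in> CV M"
  shows "(\<forall>X. \<rho> X = bracket M (conj_eta M \<alpha>) l X) \<longleftrightarrow> (\<forall>ws. vals 1 \<rho> (etal 0 ws) = W.cbr q (dv \<alpha>) 1 dL ws)"
proof
  assume "\<forall>X. \<rho> X = bracket M (conj_eta M \<alpha>) l X"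
  then have "\<rho> = bracket M (conj_eta M \<alpha>) l" by auto
  then show "\<forall>ws. vals 1 \<rho> (etal 0 ws) = W.cbr q (dv \<alpha>) 1 dL ws"
    by (simp add: vals_bracket_conj[OF \<alpha>] etal_etal)
next
  assume *: "\<forall>ws. vals 1 \<rho> (etal 0 ws) = W.cbr q (dv \<alpha>) 1 dL ws"
  have "\<rho> = bracket M (conj_eta M \<alpha>) l"
  proof (rule vals_eqI[of _ 1 "scl M"])
    show "\<rho> \<in> Hom M (psign 1) (scl M)" "bracket M (conj_eta M \<alpha>) l \<in> Hom M (psign 1) (scl M)"
      using \<rho> bracket_l_CV[OF conj_eta_CV[OF \<alpha>(1)]] by (simp_all add: CV_def')
    show "vals 1 \<rho> = vals 1 (bracket M (conj_eta M \<alpha>) l)"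
      using *[rule_format, of "etal 0 _"] by (simp add: fun_eq_iff vals_bracket_conj[OF \<alpha>] etal_etal)
  qed
  then show "\<forall>X. \<rho> X = bracket M (conj_eta M \<alpha>) l X" by simp
qed

lemma square_zero_iff_cocycle:
  assumes \<delta>: "\<delta> \<in> CW (\<Pi> M)" "has_parity (\<Pi> M) (1 - p) \<delta>"
  shows "(\<forall>x\<in>uSym (\<Pi> M). udef (\<Pi> M) p d \<delta> (udef (\<Pi> M) p d \<delta> x) = (cl 0, cl 0))
    \<longleftrightarrow> (\<forall>X. bracket M (conj_eta M \<delta>) l X = 0)" (is "?square \<longleftrightarrow> _")
proof -
  let ?q = "1 - p" and ?D = "Dw 1 dL"
  let ?\<gamma> = "W.cbr ?q (dv \<delta>) 1 dL"
  have twice: "udef (\<Pi> M) p d \<delta> (udef (\<Pi> M) p d \<delta> (cl a, cl b)) = (cl 0, cl (Dw (?q + 1) ?\<gamma> a))"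
    if ab: "Poly_Mapping.lookup a [] = 0" "Poly_Mapping.lookup b [] = 0" for a b
  proof -
    have l2: "Poly_Mapping.lookup (Dw ?q (dv \<delta>) a + sg p (?D b)) [] = 0"
      by (simp add: lookup_add lookup_Dw lookup_sg)
    have 1: "udef (\<Pi> M) p d \<delta> (udef (\<Pi> M) p d \<delta> (cl a, cl b))
      = (cl (?D (?D a)), cl (Dw ?q (dv \<delta>) (?D a) + sg p (?D (Dw ?q (dv \<delta>) a + sg p (?D b)))))"
      by (simp only: udef_cl[OF \<delta> ab] udef_cl[OF \<delta> lookup_Dw l2])
    \<comment> \<open>The exponents p and 1-p give opposite signs, so the sum becomes a graded
      commutator; the two signs in front of the square of d cancel.\<close>
    have 2: "Dw ?q (dv \<delta>) (?D a) + sg p (?D (Dw ?q (dv \<delta>) a + sg p (?D b)))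
      = (Dw ?q (dv \<delta>) (?D a) - sg ?q (?D (Dw ?q (dv \<delta>) a))) + ?D (?D b)"
      by (cases p) (simp_all add: ext_add ext_sg sg_add ext_diff)
    have "W.eqv (Dw ?q (dv \<delta>) (?D a) - sg ?q (?D (Dw ?q (dv \<delta>) a)) + ?D (?D b)) (Dw (?q + 1) ?\<gamma> a + 0)"
      by (intro W.eqv_add commutator_d \<delta> square_zero)
    then show ?thesis
      unfolding 1 2 prod.inject cl_eq_iff using square_zero[of a] by (simp only: add_0_right)
  qed
  have zero: "(\<lambda>X. 0) \<in> CV M"
    unfolding CV_def' by (rule Hom_zero[OF V.module_axioms])
  have "?square \<longleftrightarrow> (\<forall>ws. 0 = ?\<gamma> ws)"
  proof
    assume *: ?square
    show "\<forall>ws. 0 = ?\<gamma> ws"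
    proof
      fix ws
      show "0 = ?\<gamma> ws"
      proof (cases "ws = []")
        case False
        \<comment> \<open>Evaluated at a word without u-part, the square leaves just the commutator
          of \<delta> and d, whose corestriction is then read off.\<close>
        then have "(cl (wd ws), cl 0) \<in> uSym (\<Pi> M)"
          by (simp add: uSym_iff)
        moreover have "Poly_Mapping.lookup (wd ws :: ('k, 'v) words) [] = 0"
          using False by simp
        ultimately have "(cl 0, cl (Dw (?q + 1) ?\<gamma> (wd ws))) = (cl 0, cl 0)"
          using twice[of "wd ws" 0, OF _ lookup_zero] bspec[OF *] by (simp only:)
        then have "W.eqv (Dw (?q + 1) ?\<gamma> (wd ws)) 0"
          by (simp only: prod.inject cl_eq_iff)
        then have "W.eqv (W.cod (?q + 1) ?\<gamma> ws) (W.cod 0 (\<lambda>_. 0) ws)"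
          using W.eqv_trans[OF _ W.eqv_sym[OF W.cod_zero]] by simp
        from W.cod_inject[OF gsym_cbr_dL[OF \<delta>(1)] gsym_zero[OF W.V.module_axioms W.V.subspace_single_0] this]
        show ?thesis by simp
      qed (simp add: cbr_dL_Nil[OF \<delta>(1)])
    qed
  next
    assume "\<forall>ws. 0 = ?\<gamma> ws"
    then have \<gamma>: "?\<gamma> = (\<lambda>_. 0)" by (simp add: fun_eq_iff)
    show ?square
      using twice W.cod_zero_words unfolding \<gamma> by (auto elim!: uSym_cases simp: cl_eq_iff)
  qed
  also have "\<dots> \<longleftrightarrow> (\<forall>X. 0 = bracket M (conj_eta M \<delta>) l X)"
    using bracket_eq_iff[OF \<delta> zero] by (simp add: vals_def)
  also have "\<dots> \<longleftrightarrow> (\<forall>X. bracket M (conj_eta M \<delta>) l X = 0)"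
    by (simp only: eq_commute[of 0])
  finally show ?thesis .
qed

lemma is_deformation_iff:
  "is_deformation M B p d \<delta> \<longleftrightarrow>
    \<delta> \<in> CW (\<Pi> M) \<and> has_parity (\<Pi> M) (1 - p) \<delta> \<and> conj_eta M \<delta> \<in> cocycles M B l"
  using square_zero_iff_cocycle[of \<delta> p] conj_eta_CV[of \<delta>]
  by (auto simp only: is_deformation_def cocycles_def CC_def mem_Collect_eq)

lemma conjugate_iff:
  assumes \<delta>: "\<delta> \<in> CW (\<Pi> M)" "has_parity (\<Pi> M) (1 - p) \<delta>" and \<delta>': "\<delta>' \<in> CW (\<Pi> M)" "has_parity (\<Pi> M) (1 - p) \<delta>'"
    and \<alpha>: "\<alpha> \<in> CW (\<Pi> M)" "has_parity (\<Pi> M) p \<alpha>"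
  shows "(\<forall>x\<in>uSym (\<Pi> M). uaut (\<Pi> M) \<alpha> (udef (\<Pi> M) p d \<delta> (inv_into (uSym (\<Pi> M)) (uaut (\<Pi> M) \<alpha>) x))
      = udef (\<Pi> M) p d \<delta>' x)
    \<longleftrightarrow> (\<forall>X. conj_eta M \<delta>' X - conj_eta M \<delta> X = bracket M (conj_eta M \<alpha>) l X)" (is "?conj \<longleftrightarrow> _")
proof -
  let ?q = "1 - p" and ?D = "Dw 1 dL"
  let ?\<gamma> = "W.cbr p (dv \<alpha>) 1 dL"
  have q: "p + 1 = ?q" by (simp add: add.commute)
  note g\<gamma> = gsym_cbr_dL[OF \<alpha>(1), of p] and g\<delta> = W.gsym_vals_CW[OF \<delta>(1)] and g\<delta>' = W.gsym_vals_CW[OF \<delta>'(1)]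
  have key: "uaut (\<Pi> M) \<alpha> (udef (\<Pi> M) p d \<delta> (inv_into (uSym (\<Pi> M)) (uaut (\<Pi> M) \<alpha>) (cl a, cl b))) = udef (\<Pi> M) p d \<delta>' (cl a, cl b)
      \<longleftrightarrow> W.eqv (Dw ?q ?\<gamma> a + Dw ?q (dv \<delta>) a) (Dw ?q (dv \<delta>') a)"
    if ab: "Poly_Mapping.lookup a [] = 0" "Poly_Mapping.lookup b [] = 0" for a b
  proof -
    let ?A = "Dw p (dv \<alpha>)" and ?E = "Dw ?q (dv \<delta>)"
    have l1: "Poly_Mapping.lookup (b - ?A a) [] = 0"
      using ab by (simp add: lookup_minus lookup_Dw)
    have l2: "Poly_Mapping.lookup (?E a + sg p (?D (b - ?A a))) [] = 0"
      by (simp add: lookup_add lookup_Dw lookup_sg)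
    have lhs: "uaut (\<Pi> M) \<alpha> (udef (\<Pi> M) p d \<delta> (inv_into (uSym (\<Pi> M)) (uaut (\<Pi> M) \<alpha>) (cl a, cl b)))
      = (cl (?D a), cl (?A (?D a) + (?E a + sg p (?D (b - ?A a)))))"
      by (simp only: inv_uaut_cl[OF \<alpha> ab] udef_cl[OF \<delta> ab(1) l1] uaut_cl[OF \<alpha> lookup_Dw l2])
    let ?C = "?A (?D a) - sg p (?D (?A a))"
    have e1: "?A (?D a) + (?E a + sg p (?D (b - ?A a))) = ?C + ?E a + sg p (?D b)"
      by (simp add: ext_diff sg_diff)
    have C: "W.eqv ?C (Dw ?q ?\<gamma> a)"
      using commutator_d[OF \<alpha>, of a] by (simp only: q)
    \<comment> \<open>The given u-part b enters both deformations through d alone and cancels; what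
      remains depends only on a.\<close>
    have "W.eqv (?C + ?E a + sg p (?D b)) (Dw ?q (dv \<delta>') a + sg p (?D b))
      \<longleftrightarrow> W.eqv (?C + ?E a) (Dw ?q (dv \<delta>') a)"
      by (simp add: W.eqv_def)
    also have "\<dots> \<longleftrightarrow> W.eqv (Dw ?q ?\<gamma> a + ?E a) (Dw ?q (dv \<delta>') a)"
      using W.eqv_add[OF C W.eqv_refl[of "?E a"]] by (meson W.eqv_sym W.eqv_trans)
    finally show ?thesis
      unfolding lhs e1 udef_cl[OF \<delta>' ab] by (simp add: cl_eq_iff)
  qed
  let ?\<rho> = "\<lambda>X. conj_eta M \<delta>' X - conj_eta M \<delta> X"
  have \<rho>: "?\<rho> \<in> CV M"
    using conj_eta_CV[OF \<delta>(1)] conj_eta_CV[OF \<delta>'(1)] unfolding CV_def'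
    by (intro Hom_diff V.module_axioms)
  have v\<rho>: "vals 1 ?\<rho> (etal 0 ws) = dv \<delta>' ws - dv \<delta> ws" for ws
  proof -
    have "vals 1 ?\<rho> vs = vals 1 (conj_eta M \<delta>') vs - vals 1 (conj_eta M \<delta>) vs" for vs
      by (simp add: vals_def)
    then show ?thesis by (simp add: vals_conj etal_etal)
  qed
  have "?conj
    \<longleftrightarrow> (\<forall>ws. dv \<delta>' ws - dv \<delta> ws = ?\<gamma> ws)"
  proof
    assume *: ?conj
    show "\<forall>ws. dv \<delta>' ws - dv \<delta> ws = ?\<gamma> ws"
    proof
      fix ws
      show "dv \<delta>' ws - dv \<delta> ws = ?\<gamma> ws"
      proof (cases "ws = []")
        case False
        then have "Poly_Mapping.lookup (wd ws :: ('k, 'v) words) [] = 0" by simp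
        moreover from this have "(cl (wd ws), cl 0) \<in> uSym (\<Pi> M)"
          by (simp add: uSym_iff)
        ultimately have "W.eqv (Dw ?q ?\<gamma> (wd ws) + Dw ?q (dv \<delta>) (wd ws)) (Dw ?q (dv \<delta>') (wd ws))"
          using * key[of "wd ws" 0] by simp
        from W.ext_eqv[OF W.V.module_axioms W.gsym_letter this]
        have "?\<gamma> ws + dv \<delta> ws = dv \<delta>' ws"
          using W.letter_cod[OF g\<gamma>] W.letter_cod[OF g\<delta>] W.letter_cod[OF g\<delta>']
          by (simp add: ext_add V.module_axioms)
        then show ?thesis by (simp add: algebra_simps)
      qed (simp add: cbr_dL_Nil[OF \<alpha>(1)])
    qed
  next
    assume "\<forall>ws. dv \<delta>' ws - dv \<delta> ws = ?\<gamma> ws"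
    then have "dv \<delta>' = (\<lambda>X. ?\<gamma> X + dv \<delta> X)"
      by (metis diff_add_cancel)
    then have "W.eqv (Dw ?q (dv \<delta>') x) (Dw ?q ?\<gamma> x + Dw ?q (dv \<delta>) x)" for x
      using W.eqv_ext_fun[of "W.cod ?q (dv \<delta>')" "\<lambda>w. W.cod ?q ?\<gamma> w + W.cod ?q (dv \<delta>) w" x] W.cod_add
      by (simp add: ext_add_fun)
    then show ?conj
      using key W.eqv_sym by (metis uSym_cases)
  qed
  also have "\<dots> \<longleftrightarrow> (\<forall>X. ?\<rho> X = bracket M (conj_eta M \<alpha>) l X)"
    using bracket_eq_iff[OF \<alpha> \<rho>] by (simp add: v\<rho>)
  finally show ?thesis .
qed

text \<open>A deformation is recorded as a map, and \<delta> is recovered from its u-part on single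
  words. So the cochain attached to a deformation is well defined.\<close>

lemma udef_inject:
  assumes \<delta>: "\<delta> \<in> CW (\<Pi> M)" "has_parity (\<Pi> M) q \<delta>" and \<delta>': "\<delta>' \<in> CW (\<Pi> M)" "has_parity (\<Pi> M) q \<delta>'"
    and eq: "udef (\<Pi> M) p d \<delta> = udef (\<Pi> M) p d \<delta>'"
  shows "\<delta> = \<delta>'"
proof (rule W.vals_eqI[of _ 0 "scl M"])
  show "\<delta> \<in> Hom (\<Pi> M) (psign 0) (scl M)" "\<delta>' \<in> Hom (\<Pi> M) (psign 0) (scl M)"
    using \<delta>(1) \<delta>'(1) by (simp_all add: W.CW_def')
  show "dv \<delta> = dv \<delta>'"
  proof
    fix ws
    show "dv \<delta> ws = dv \<delta>' ws"
    proof (cases "ws = []")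
      case False
      then have l: "Poly_Mapping.lookup (wd ws :: ('k, 'v) words) [] = 0" by simp
      have "W.eqv (Dw q (dv \<delta>) (wd ws) + sg p (Dw 1 dL 0)) (Dw q (dv \<delta>') (wd ws) + sg p (Dw 1 dL 0))"
        using fun_cong[OF eq, of "(cl (wd ws), cl 0)"]
        unfolding udef_cl[OF \<delta> l lookup_zero] udef_cl[OF \<delta>' l lookup_zero] by (simp only: cl_eq_iff prod.inject)
      then show ?thesis
        by (intro W.cod_inject[OF W.gsym_vals_CW[OF \<delta>(1)] W.gsym_vals_CW[OF \<delta>'(1)]]) simp
    qed simp
  qed
qed

lemma deformation_equiv_iff:
  assumes "is_deformation M B p d \<delta>" "is_deformation M B p d \<delta>'"
  shows "(udef (\<Pi> M) p d \<delta>, udef (\<Pi> M) p d \<delta>') \<in> deformation_equiv M B p d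
    \<longleftrightarrow> (conj_eta M \<delta>, conj_eta M \<delta>') \<in> cohomologous M B l"
proof -
  have \<delta>: "\<delta> \<in> CW (\<Pi> M)" "has_parity (\<Pi> M) (1 - p) \<delta>" and c: "conj_eta M \<delta> \<in> cocycles M B l"
    and \<delta>': "\<delta>' \<in> CW (\<Pi> M)" "has_parity (\<Pi> M) (1 - p) \<delta>'" and c': "conj_eta M \<delta>' \<in> cocycles M B l"
    using assms unfolding is_deformation_iff by auto
  let ?\<rho> = "\<lambda>X. conj_eta M \<delta>' X - conj_eta M \<delta> X"
  have D: "udef (\<Pi> M) p d \<delta> \<in> deformations M B p d" "udef (\<Pi> M) p d \<delta>' \<in> deformations M B p d"
    using assms by (auto simp: deformations_def)
  have "(udef (\<Pi> M) p d \<delta>, udef (\<Pi> M) p d \<delta>') \<in> deformation_equiv M B p d \<longleftrightarrow>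
    (\<exists>\<alpha>\<in>CW (\<Pi> M). has_parity (\<Pi> M) p \<alpha> \<and> cyclic M B (conj_eta M \<alpha>)
      \<and> (\<forall>X. ?\<rho> X = bracket M (conj_eta M \<alpha>) l X))" (is "_ \<longleftrightarrow> ?E")
    using D conjugate_iff[OF \<delta> \<delta>'] by (auto simp: deformation_equiv_def)
  also have "\<dots> \<longleftrightarrow> (\<exists>\<chi>\<in>CC M B. \<forall>X. ?\<rho> X = bracket M \<chi> l X)"
  proof
    assume ?E
    then show "\<exists>\<chi>\<in>CC M B. \<forall>X. ?\<rho> X = bracket M \<chi> l X"
      using conj_eta_CV by (auto simp: CC_def)
  next
    assume "\<exists>\<chi>\<in>CC M B. \<forall>X. ?\<rho> X = bracket M \<chi> l X"
    then obtain \<chi> where \<chi>: "\<chi> \<in> CC M B" "\<And>X. ?\<rho> X = bracket M \<chi> l X" by auto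
    have "tpar (p + 1) (vals 1 ?\<rho>)"
    proof -
      have "tpar (p + 1) (vals 1 (conj_eta M \<delta>))" "tpar (p + 1) (vals 1 (conj_eta M \<delta>'))"
        using \<delta> \<delta>' by (simp_all add: has_parity_iff total_parity_iff add.commute)
      moreover have "vals 1 ?\<rho> vs = vals 1 (conj_eta M \<delta>') vs - vals 1 (conj_eta M \<delta>) vs" for vs
        by (simp add: vals_def)
      ultimately show ?thesis
        unfolding tpar_def by (metis deg_diff)
    qed
    note eq = coboundary_homogeneous[OF \<chi>(1) this \<chi>(2)]
    have \<chi>CV: "\<chi> \<in> CV M" using \<chi>(1) by (simp add: CC_def)
    obtain \<alpha> where \<alpha>: "\<alpha> \<in> CW (\<Pi> M)" "conj_eta M \<alpha> = tproj p \<chi>"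
      using conj_eta_surj[OF tproj_CV[OF \<chi>CV]] .
    have "has_parity (\<Pi> M) p \<alpha>"
      unfolding has_parity_iff[OF \<alpha>(1)] \<alpha>(2) total_parity_iff by (rule tpar_tproj[OF \<chi>CV])
    moreover have "cyclic M B (conj_eta M \<alpha>)"
      using cyclic_tproj[OF \<chi>(1)] by (simp add: \<alpha>(2) CC_def)
    ultimately show ?E
      using \<alpha> eq by metis
  qed
  also have "\<dots> \<longleftrightarrow> (conj_eta M \<delta>, conj_eta M \<delta>') \<in> cohomologous M B l"
    using c c' by (simp add: cohomologous_def)
  finally show ?thesis .
qed

end

text \<open>A map that preserves and reflects the relations is injective on classes, and its image
  consists of the classes meeting the image of \<open>A\<close>. That \<open>r\<close> is an
  equivalence is pulled back from \<open>s\<close>.\<close>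

lemma quotient_bij:
  assumes s: "equiv C s" and f: "\<And>x. x \<in> A \<Longrightarrow> f x \<in> C"
    and r: "r \<subseteq> A \<times> A" "\<And>x y. x \<in> A \<Longrightarrow> y \<in> A \<Longrightarrow> (x, y) \<in> r \<longleftrightarrow> (f x, f y) \<in> s"
  shows "equiv A r \<and> (\<exists>\<Phi>. bij_betw \<Phi> (A // r) {c \<in> C // s. \<exists>x\<in>A. f x \<in> c} \<and>
    (\<forall>x\<in>A. \<Phi> (r `` {x}) = s `` {f x}))"
proof
  have s_refl: "(x, x) \<in> s" if "x \<in> C" for x
    using s that by (simp add: equiv_def refl_on_def)
  have s_sym: "(y, x) \<in> s" if "(x, y) \<in> s" for x y
    using s that by (meson equiv_def symE)
  have s_trans: "(x, z) \<in> s" if "(x, y) \<in> s" "(y, z) \<in> s" for x y z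
    using s that by (meson equiv_def transE)
  show er: "equiv A r"
  proof (rule equivI)
    show "refl_on A r" using r f s_refl by (simp add: refl_on_def)
    show "sym r"
      using r s_sym by (intro symI) blast
    show "trans r"
    proof (rule transI)
      fix x y z assume "(x, y) \<in> r" "(y, z) \<in> r"
      moreover from this have "x \<in> A" "y \<in> A" "z \<in> A" using r(1) by auto
      ultimately show "(x, z) \<in> r" using r(2) s_trans by meson
    qed
  qed (rule r(1))
  \<comment> \<open>Saturating the image of a class with respect to \<open>s\<close> avoids choosing
    a representative.\<close>
  let ?\<Phi> = "\<lambda>c. s `` (f ` c)"
  have val: "?\<Phi> (r `` {x}) = s `` {f x}" if "x \<in> A" for x
  proof
    show "?\<Phi> (r `` {x}) \<subseteq> s `` {f x}"
    proof
      fix z assume "z \<in> ?\<Phi> (r `` {x})"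
      then obtain y where "(x, y) \<in> r" "(f y, z) \<in> s" by auto
      moreover from this have "(f x, f y) \<in> s" using r that by auto
      ultimately show "z \<in> s `` {f x}" using s_trans by auto
    qed
    show "s `` {f x} \<subseteq> ?\<Phi> (r `` {x})"
      using that er by (auto simp: equiv_def refl_on_def)
  qed
  have "bij_betw ?\<Phi> (A // r) {c \<in> C // s. \<exists>x\<in>A. f x \<in> c}"
  proof (rule bij_betw_imageI)
    show "inj_on ?\<Phi> (A // r)"
    proof (rule inj_onI)
      fix c c' assume "c \<in> A // r" "c' \<in> A // r" and eq: "?\<Phi> c = ?\<Phi> c'"
      then obtain x y where xy: "x \<in> A" "c = r `` {x}" "y \<in> A" "c' = r `` {y}"
        by (auto elim!: quotientE)
      then have "s `` {f x} = s `` {f y}"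
        using eq val by simp
      then have "(f x, f y) \<in> s"
        using eq_equiv_class[OF _ s f[OF xy(3)]] by blast
      then have "(x, y) \<in> r" using r xy by blast
      then show "c = c'" using xy equiv_class_eq[OF er] by simp
    qed
    show "?\<Phi> ` (A // r) = {c \<in> C // s. \<exists>x\<in>A. f x \<in> c}"
    proof (intro equalityI subsetI)
      fix c assume "c \<in> ?\<Phi> ` (A // r)"
      then obtain x where x: "x \<in> A" "c = s `` {f x}"
        using val by (auto elim!: quotientE)
      then show "c \<in> {c \<in> C // s. \<exists>x\<in>A. f x \<in> c}"
        using f s_refl by (auto intro!: quotientI)
    next
      fix c assume "c \<in> {c \<in> C // s. \<exists>x\<in>A. f x \<in> c}"
      then obtain x y where x: "x \<in> A" "f x \<in> c" and y: "c = s `` {y}"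
        by (auto elim!: quotientE)
      then have "(y, f x) \<in> s" by simp
      then have "c = s `` {f x}"
        using equiv_class_eq[OF s] y by simp
      then have "c = ?\<Phi> (r `` {x})" using val x by simp
      then show "c \<in> ?\<Phi> ` (A // r)"
        using x by (auto intro: quotientI)
    qed
  qed
  then show "\<exists>\<Phi>. bij_betw \<Phi> (A // r) {c \<in> C // s. \<exists>x\<in>A. f x \<in> c} \<and> (\<forall>x\<in>A. \<Phi> (r `` {x}) = s `` {f x})"
    using val by (intro exI[of _ ?\<Phi>]) simp
qed

theorem theorem7:
  fixes M :: "('k::comm_ring_1, 'v::ab_group_add) smodule"
    and B :: "'v \<Rightarrow> 'v \<Rightarrow> 'k"
    and l d :: "('k, 'v) cochain"
    and p :: bit
  assumes "graded_module M"
    and "inner_product M B"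
    and "lie_structure M l"
    and "cyclic M B l"
    and "d \<in> CW (\<Pi> M)"
    and "conj_eta M d = l"
  shows "equiv (deformations M B p d) (deformation_equiv M B p d) \<and>
    (\<exists>\<Phi>. bij_betw \<Phi> (deformations M B p d // deformation_equiv M B p d) (HC_part M B l (1 - p)) \<and>
      (\<forall>\<delta>. is_deformation M B p d \<delta> \<longrightarrow>
        \<Phi> (deformation_equiv M B p d `` {udef (\<Pi> M) p d \<delta>}) = hc_class M B l (conj_eta M \<delta>)))"
proof -
  interpret deformation M l B d
    by unfold_locales (use assms in auto)
  let ?A = "deformations M B p d" and ?C = "cocycles M B l" and ?s = "cohomologous M B l"
  define f where "f D = conj_eta M (THE \<delta>. is_deformation M B p d \<delta> \<and> D = udef (\<Pi> M) p d \<delta>)" for D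
  have f: "f (udef (\<Pi> M) p d \<delta>) = conj_eta M \<delta>" if "is_deformation M B p d \<delta>" for \<delta>
  proof -
    have "(THE \<delta>'. is_deformation M B p d \<delta>' \<and> udef (\<Pi> M) p d \<delta> = udef (\<Pi> M) p d \<delta>') = \<delta>"
      by (rule the_equality) (use that udef_inject[of \<delta> "1 - p"] in \<open>auto simp only: is_deformation_iff\<close>)
    then show ?thesis by (simp add: f_def)
  qed
  have fC: "f D \<in> ?C" if "D \<in> ?A" for D
    using that f by (auto simp: deformations_def is_deformation_iff)
  have sub: "deformation_equiv M B p d \<subseteq> ?A \<times> ?A"
    by (auto simp: deformation_equiv_def)
  have iff: "(D, D') \<in> deformation_equiv M B p d \<longleftrightarrow> (f D, f D') \<in> ?s" if "D \<in> ?A" "D' \<in> ?A" for D D'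
  proof -
    obtain \<delta> \<delta>' where \<delta>: "D = udef (\<Pi> M) p d \<delta>" "is_deformation M B p d \<delta>"
      "D' = udef (\<Pi> M) p d \<delta>'" "is_deformation M B p d \<delta>'"
      using \<open>D \<in> ?A\<close> \<open>D' \<in> ?A\<close> by (auto simp: deformations_def)
    then show ?thesis
      using deformation_equiv_iff f by simp
  qed
  have part: "{c \<in> ?C // ?s. \<exists>D\<in>?A. f D \<in> c} = HC_part M B l (1 - p)"
  proof -
    have "(\<exists>D\<in>?A. f D \<in> c) \<longleftrightarrow> (\<exists>\<phi>\<in>c. total_parity M (1 - p) \<phi>)" if "c \<in> ?C // ?s" for c
    proof
      assume "\<exists>D\<in>?A. f D \<in> c"
      then obtain \<delta> where "is_deformation M B p d \<delta>" "conj_eta M \<delta> \<in> c"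
        using f by (auto simp: deformations_def)
      then show "\<exists>\<phi>\<in>c. total_parity M (1 - p) \<phi>"
        using has_parity_iff unfolding is_deformation_iff by blast
    next
      assume "\<exists>\<phi>\<in>c. total_parity M (1 - p) \<phi>"
      then obtain \<phi> where \<phi>: "\<phi> \<in> c" "total_parity M (1 - p) \<phi>" by auto
      \<comment> \<open>The representative of the required parity is itself a cocycle, so it is the
        conjugate of some \<delta> that defines a deformation.\<close>
      then have "\<phi> \<in> ?C"
        using in_quotient_imp_subset[OF equiv_cohomologous that] by auto
      then have "\<phi> \<in> CV M" by (simp add: cocycles_def CC_def)
      then obtain \<delta> where "\<delta> \<in> CW (\<Pi> M)" "conj_eta M \<delta> = \<phi>"
        by (rule conj_eta_surj)
      then have "is_deformation M B p d \<delta>" "f (udef (\<Pi> M) p d \<delta>) = \<phi>"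
        using \<phi>(2) \<open>\<phi> \<in> ?C\<close> f by (auto simp only: is_deformation_iff has_parity_iff)
      then show "\<exists>D\<in>?A. f D \<in> c"
        using \<phi>(1) by (auto simp: deformations_def)
    qed
    then show ?thesis by (auto simp: HC_part_def HC_def)
  qed
  from quotient_bij[OF equiv_cohomologous fC sub iff] obtain \<Phi> where
    eq: "equiv ?A (deformation_equiv M B p d)" and
    bij: "bij_betw \<Phi> (?A // deformation_equiv M B p d) {c \<in> ?C // ?s. \<exists>D\<in>?A. f D \<in> c}" and
    val: "\<And>D. D \<in> ?A \<Longrightarrow> \<Phi> (deformation_equiv M B p d `` {D}) = ?s `` {f D}"
    by blast
  have "\<Phi> (deformation_equiv M B p d `` {udef (\<Pi> M) p d \<delta>}) = hc_class M B l (conj_eta M \<delta>)"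
    if "is_deformation M B p d \<delta>" for \<delta>
    using val[of "udef (\<Pi> M) p d \<delta>"] f[OF that] that by (auto simp: hc_class_def deformations_def)
  with eq bij show ?thesis
    unfolding part by blast
qed

end
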